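(* For fixed $\sigma\in(0,\infty]$, let $u_\sigma$ be the unique minimizer of $\mathcal{E}_\sigma$ over $\mathcal{T}_\sigma$ and $u_{\sigma,h}$ the unique minimizer of $\mathcal{E}_\sigma$ over $W_{\sigma,h}$. Then there exists a constant $C>0$, independent of $h$, such that $$\|u_{\sigma,h}-u_\sigma\|_{\mathcal{T}_\sigma} \le C \inf_{v_{\sigma,h}\in W_{\sigma,h}} \|v_{\sigma,h}-u_\sigma\|_{\mathcal{T}_\sigma}^{2/p},$$ and $\|u_{\sigma,h}-u_\sigma\|_{\mathcal{T}_\sigma}\to 0$ as $h\to0$.
   Context: Let $p\ge2$, $\Omega\subset\mathbb{R}^d$ a bounded domain with piecewise flat boundary, $\Omega_{I_\delta}:=\{x\in\mathbb{R}^d\setminus\Omega:\operatorname{dist}(x,\partial\Omega)\le\delta\}$ and $\Omega_\delta:=\Omega\cup\Omega_{I_\delta}$. Let $\rho$ be a kernel with $\rho\in L^\infty(\mathbb{R})$, support compactly contained in $(-1,1)$, $\rho$ even, nonnegative and nonincreasing on $[0,1)$, bounded below by a positive constant on a neighborhood $[-c_\rho,c_\rho]$ of $0$, and normalized so that the nonlocal energy below formally converges to $\frac1p\int_\Omega|\nabla u|^p$; set $\rho_\delta(|z|)=\delta^{-d}\rho(|z|/\delta)$. Define $[u]_{\mathcal{S}^p[\delta](\Omega)}^p:=\int_{\Omega_\delta}\int_{\Omega_\delta}\rho_\delta(|x-y|)\,|(u(x)-u(y))/\delta|^p\,dx\,dy$ and $\mathcal{S}^p_0[\delta](\Omega):=\{u\in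 L^p(\Omega_\delta):[u]_{\mathcal{S}^p[\delta](\Omega)}<\infty,\ u=0\text{ on }\Omega_{I_\delta}\}$ with norm $\|u\|^p=\|u\|_{L^p(\Omega)}^p+[u]^p_{\mathcal{S}^p[\delta](\Omega)}$. Let $\delta_0\in(0,1)$ be a threshold for which the nonlocal Poincaré inequality $\|u\|_{L^p(\Omega)}\le C[u]_{\mathcal{S}^p[\delta](\Omega)}$ holds for all $\delta<\delta_0$ and $u\in\mathcal{S}^p_0[\delta](\Omega)$. Set $\mathcal{T}_\infty=W^{1,p}_0(\Omega)$ and $\mathcal{T}_\sigma=\mathcal{S}^p_0[\min\{\delta_0,1/\sigma\}](\Omega)$ for $\sigma\in(0,\infty)$, with dual data $f\in L^{p'}(\Omega_{\min\{\delta_0,1/\sigma\}})$ (resp. $L^{p'}(\Omega)$ for $\sigma=\infty$). The energies are $\mathcal{E}_\sigma(u)=\frac1p[u]^p_{\mathcal{S}^p[1/\sigma](\Omega)}-\langle f,u\rangle$ for $\sigma<\infty$ and $\mathcal{E}_\infty(u)=\frac1p\int_\Omega|\nabla u|^p\,dx-\langle f,u\rangle$. Discretization: given a quasi-uniform shape-regular triangulation $\tau_h$ of $\Omega$ with mesh size $h$, let $\widetilde W_h$ be the functions on $\Omega$ that are polynomials of degree at most $N$ on each element and vanish on $\partial\Omega$, extended by zero to $\Omega_{\delta_0}$, and $W_{\sigma,h}:=\widetilde W_h\cap\mathcal{T}_\sigma$. It is assumed that $\widehat W_{\infty,h}\subset W_{\sigma,h}$, where $\widehat W_{\infty,h}\subset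 W^{1,p}_0(\Omega)$ is the continuous piecewise linear finite element space on the same mesh $\tau_h$. *)

theory Defs
  imports "HOL-Analysis.Analysis"
begin

definition piecewise_flat_domain :: "'a::euclidean_space set \<Rightarrow> bool" where
  "piecewise_flat_domain \<Omega> \<longleftrightarrow>
     \<Omega> \<noteq> {} \<and> open \<Omega> \<and> connected \<Omega> \<and> bounded \<Omega> \<and>
     (\<exists>H. finite H \<and> (\<forall>(a,b)\<in>H. a \<noteq> 0) \<and>
          frontier \<Omega> \<subseteq> (\<Union>(a,b)\<in>H. {x. a \<bullet> x = b}))"

definition interaction_dom :: "'a::euclidean_space set \<Rightarrow> real \<Rightarrow> 'a set" where
  "interaction_dom \<Omega> \<delta> = {x. x \<notin> \<Omega> \<and> infdist x (frontier \<Omega>) \<le> \<delta>}"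

definition ext_dom :: "'a::euclidean_space set \<Rightarrow> real \<Rightarrow> 'a set" where
  "ext_dom \<Omega> \<delta> = \<Omega> \<union> interaction_dom \<Omega> \<delta>"

definition admissible_kernel :: "'a::euclidean_space itself \<Rightarrow> real \<Rightarrow> (real \<Rightarrow> real) \<Rightarrow> bool" where
  "admissible_kernel _ p \<rho> \<longleftrightarrow>
     \<rho> \<in> borel_measurable borel \<and> (\<exists>M. \<forall>t. \<bar>\<rho> t\<bar> \<le> M) \<and>
     (\<exists>r<1. \<forall>t. r < \<bar>t\<bar> \<longrightarrow> \<rho> t = 0) \<and>
     (\<forall>t. \<rho> (- t) = \<rho> t) \<and> (\<forall>t. 0 \<le> \<rho> t) \<and>
     (\<forall>s t. 0 \<le> s \<and> s \<le> t \<and> t < 1 \<longrightarrow> \<rho> t \<le> \<rho> s) \<and>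
     (\<exists>c c\<^sub>\<rho>. 0 < c \<and> 0 < c\<^sub>\<rho> \<and> (\<forall>t. \<bar>t\<bar> \<le> c\<^sub>\<rho> \<longrightarrow> c \<le> \<rho> t)) \<and>
     (\<forall>e::'a. norm e = 1 \<longrightarrow>
        (\<integral>\<^sup>+ z. ennreal (\<rho> (norm z) * \<bar>z \<bullet> e\<bar> powr p) \<partial>(lborel :: 'a measure)) = 1)"

definition rho_delta :: "'a::euclidean_space itself \<Rightarrow> (real \<Rightarrow> real) \<Rightarrow> real \<Rightarrow> real \<Rightarrow> real" where
  "rho_delta _ \<rho> \<delta> r = \<rho> (r / \<delta>) / \<delta> ^ DIM('a)"

definition nl_semi_p :: "real \<Rightarrow> (real \<Rightarrow> real) \<Rightarrow> 'a::euclidean_space set \<Rightarrow> real \<Rightarrow> ('a \<Rightarrow> real) \<Rightarrow> ennreal" where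
  "nl_semi_p p \<rho> \<Omega> \<delta> u =
     (\<integral>\<^sup>+ x\<in>ext_dom \<Omega> \<delta>. (\<integral>\<^sup>+ y\<in>ext_dom \<Omega> \<delta>.
        ennreal (rho_delta TYPE('a) \<rho> \<delta> (dist x y) * \<bar>(u x - u y) / \<delta>\<bar> powr p) \<partial>lebesgue) \<partial>lebesgue)"

definition Lp_int :: "real \<Rightarrow> 'a::euclidean_space set \<Rightarrow> ('a \<Rightarrow> real) \<Rightarrow> ennreal" where
  "Lp_int p A u = (\<integral>\<^sup>+ x\<in>A. ennreal (\<bar>u x\<bar> powr p) \<partial>lebesgue)"

definition in_Lp :: "real \<Rightarrow> 'a::euclidean_space set \<Rightarrow> ('a \<Rightarrow> real) \<Rightarrow> bool" where
  "in_Lp p A u \<longleftrightarrow> u \<in> borel_measurable lebesgue \<and> Lp_int p A u < \<infinity>"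

text \<open>\<open>S^p_0[\<delta>](\<Omega>)\<close>; functions are taken to vanish (everywhere) outside \<open>\<Omega>\<close>,
  i.e. on \<open>\<Omega>_{I_\<delta>}\<close> and, by the zero extension, beyond.\<close>
definition S0 :: "real \<Rightarrow> (real \<Rightarrow> real) \<Rightarrow> 'a::euclidean_space set \<Rightarrow> real \<Rightarrow> ('a \<Rightarrow> real) set" where
  "S0 p \<rho> \<Omega> \<delta> = {u. in_Lp p (ext_dom \<Omega> \<delta>) u \<and> nl_semi_p p \<rho> \<Omega> \<delta> u < \<infinity> \<and>
                        (\<forall>x. x \<notin> \<Omega> \<longrightarrow> u x = 0)}"

definition poincare_threshold :: "real \<Rightarrow> (real \<Rightarrow> real) \<Rightarrow> 'a::euclidean_space set \<Rightarrow> real \<Rightarrow> bool" where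
  "poincare_threshold p \<rho> \<Omega> \<delta>\<^sub>0 \<longleftrightarrow> 0 < \<delta>\<^sub>0 \<and> \<delta>\<^sub>0 < 1 \<and>
     (\<exists>C. \<forall>\<delta>. 0 < \<delta> \<and> \<delta> < \<delta>\<^sub>0 \<longrightarrow> (\<forall>u\<in>S0 p \<rho> \<Omega> \<delta>.
        enn2real (Lp_int p \<Omega> u) powr (1/p) \<le> C * enn2real (nl_semi_p p \<rho> \<Omega> \<delta> u) powr (1/p)))"

definition partial_deriv :: "'a::euclidean_space \<Rightarrow> ('a \<Rightarrow> real) \<Rightarrow> 'a \<Rightarrow> real" where
  "partial_deriv i f = (\<lambda>x. frechet_derivative f (at x) i)"

inductive_set iter_partials :: "('a::euclidean_space \<Rightarrow> real) \<Rightarrow> ('a \<Rightarrow> real) set"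
  for f :: "'a::euclidean_space \<Rightarrow> real" where
  base: "f \<in> iter_partials f"
| step: "g \<in> iter_partials f \<Longrightarrow> i \<in> Basis \<Longrightarrow> partial_deriv i g \<in> iter_partials f"

definition smooth_fun :: "('a::euclidean_space \<Rightarrow> real) \<Rightarrow> bool" where
  "smooth_fun f \<longleftrightarrow> (\<forall>g\<in>iter_partials f. \<forall>x. g differentiable (at x))"

definition Cc_inf :: "'a::euclidean_space set \<Rightarrow> ('a \<Rightarrow> real) set" where
  "Cc_inf \<Omega> = {\<phi>. smooth_fun \<phi> \<and> (\<exists>K. compact K \<and> K \<subseteq> \<Omega> \<and> (\<forall>x. x \<notin> K \<longrightarrow> \<phi> x = 0))}"

definition grad :: "('a::euclidean_space \<Rightarrow> real) \<Rightarrow> 'a \<Rightarrow> 'a" where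
  "grad f x = (\<Sum>i\<in>Basis. partial_deriv i f x *\<^sub>R i)"

definition W1p0 :: "real \<Rightarrow> 'a::euclidean_space set \<Rightarrow> ('a \<Rightarrow> real) \<Rightarrow> ('a \<Rightarrow> 'a) \<Rightarrow> bool" where
  "W1p0 p \<Omega> u g \<longleftrightarrow> in_Lp p \<Omega> u \<and> g \<in> borel_measurable lebesgue \<and>
     Lp_int p \<Omega> (\<lambda>x. norm (g x)) < \<infinity> \<and>
     (\<exists>\<phi>::nat \<Rightarrow> 'a \<Rightarrow> real. (\<forall>n. \<phi> n \<in> Cc_inf \<Omega>) \<and>
        (\<lambda>n. Lp_int p \<Omega> (\<lambda>x. \<phi> n x - u x)) \<longlonglongrightarrow> 0 \<and>
        (\<lambda>n. Lp_int p \<Omega> (\<lambda>x. norm (grad (\<phi> n) x - g x))) \<longlonglongrightarrow> 0)"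

definition wgrad :: "real \<Rightarrow> 'a::euclidean_space set \<Rightarrow> ('a \<Rightarrow> real) \<Rightarrow> 'a \<Rightarrow> 'a" where
  "wgrad p \<Omega> u = (SOME g. W1p0 p \<Omega> u g)"

definition hor :: "real \<Rightarrow> ereal \<Rightarrow> real" where
  "hor \<delta>\<^sub>0 \<sigma> = min \<delta>\<^sub>0 (1 / real_of_ereal \<sigma>)"

definition Tspace :: "real \<Rightarrow> (real \<Rightarrow> real) \<Rightarrow> 'a::euclidean_space set \<Rightarrow> real \<Rightarrow> ereal \<Rightarrow> ('a \<Rightarrow> real) set" where
  "Tspace p \<rho> \<Omega> \<delta>\<^sub>0 \<sigma> =
     (if \<sigma> = \<infinity> then {u. \<exists>g. W1p0 p \<Omega> u g} else S0 p \<rho> \<Omega> (hor \<delta>\<^sub>0 \<sigma>))"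

definition Tnorm :: "real \<Rightarrow> (real \<Rightarrow> real) \<Rightarrow> 'a::euclidean_space set \<Rightarrow> real \<Rightarrow> ereal \<Rightarrow> ('a \<Rightarrow> real) \<Rightarrow> real" where
  "Tnorm p \<rho> \<Omega> \<delta>\<^sub>0 \<sigma> u =
     (if \<sigma> = \<infinity> then
        (enn2real (Lp_int p \<Omega> u) + enn2real (Lp_int p \<Omega> (\<lambda>x. norm (wgrad p \<Omega> u x)))) powr (1/p)
      else
        (enn2real (Lp_int p \<Omega> u) + enn2real (nl_semi_p p \<rho> \<Omega> (hor \<delta>\<^sub>0 \<sigma>) u)) powr (1/p))"

text \<open>Energies; \<open>\<langle>f,u\<rangle> = \<integral>_\<Omega> f u\<close> (elements of \<open>\<T>_\<sigma>\<close> vanish outside \<open>\<Omega>\<close>).\<close>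
definition energy :: "real \<Rightarrow> (real \<Rightarrow> real) \<Rightarrow> 'a::euclidean_space set \<Rightarrow> ereal \<Rightarrow> ('a \<Rightarrow> real) \<Rightarrow> ('a \<Rightarrow> real) \<Rightarrow> real" where
  "energy p \<rho> \<Omega> \<sigma> f u =
     (if \<sigma> = \<infinity> then (1/p) * enn2real (Lp_int p \<Omega> (\<lambda>x. norm (wgrad p \<Omega> u x)))
      else (1/p) * enn2real (nl_semi_p p \<rho> \<Omega> (1 / real_of_ereal \<sigma>) u))
     - (LINT x:\<Omega>|lebesgue. f x * u x)"

definition is_minimizer :: "('b \<Rightarrow> real) \<Rightarrow> 'b set \<Rightarrow> 'b \<Rightarrow> bool" where
  "is_minimizer E S u \<longleftrightarrow> u \<in> S \<and> (\<forall>v\<in>S. E u \<le> E v)"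

definition triangulation_of :: "'a::euclidean_space set set \<Rightarrow> 'a set \<Rightarrow> bool" where
  "triangulation_of \<T> \<Omega> \<longleftrightarrow> triangulation \<T> \<and> \<T> \<noteq> {} \<and>
     (\<forall>T\<in>\<T>. int DIM('a) simplex T) \<and> \<Union>\<T> = closure \<Omega>"

definition mesh_size :: "'a::euclidean_space set set \<Rightarrow> real" where
  "mesh_size \<T> = Max (diameter ` \<T>)"

definition inradius :: "'a::euclidean_space set \<Rightarrow> real" where
  "inradius T = Sup {r. \<exists>c. ball c r \<subseteq> T}"

definition qu_sr_family :: "'a::euclidean_space set set set \<Rightarrow> 'a set \<Rightarrow> bool" where
  "qu_sr_family \<F> \<Omega> \<longleftrightarrow> (\<forall>\<T>\<in>\<F>. triangulation_of \<T> \<Omega>) \<and>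
     (\<exists>\<kappa>. \<forall>\<T>\<in>\<F>. \<forall>T\<in>\<T>. diameter T \<le> \<kappa> * inradius T \<and> mesh_size \<T> \<le> \<kappa> * diameter T)"

definition multi_indices :: "'a::euclidean_space itself \<Rightarrow> nat \<Rightarrow> ('a \<Rightarrow> nat) set" where
  "multi_indices _ N = {\<alpha>. (\<forall>i. i \<notin> (Basis::'a set) \<longrightarrow> \<alpha> i = 0) \<and> (\<Sum>i\<in>Basis. \<alpha> i) \<le> N}"

definition poly_deg_le :: "nat \<Rightarrow> ('a::euclidean_space \<Rightarrow> real) \<Rightarrow> bool" where
  "poly_deg_le N q \<longleftrightarrow> (\<exists>c. \<forall>x. q x =
      (\<Sum>\<alpha>\<in>multi_indices TYPE('a) N. c \<alpha> * (\<Prod>i\<in>Basis. (x \<bullet> i) ^ \<alpha> i)))"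

text \<open>\<open>W-tilde_h\<close>: (possibly discontinuous) piecewise polynomials of degree \<open>\<le> N\<close> vanishing on
  \<open>\<partial>\<Omega>\<close>, extended by zero outside \<open>\<Omega>\<close>. Values on element interfaces are irrelevant
  (null set) and left free.\<close>
definition Wtilde :: "nat \<Rightarrow> 'a::euclidean_space set \<Rightarrow> 'a set set \<Rightarrow> ('a \<Rightarrow> real) set" where
  "Wtilde N \<Omega> \<T> = {u. (\<forall>x. x \<notin> \<Omega> \<longrightarrow> u x = 0) \<and>
      (\<forall>T\<in>\<T>. \<exists>q. poly_deg_le N q \<and> (\<forall>x\<in>T \<inter> frontier \<Omega>. q x = 0) \<and>
                 (\<forall>x\<in>interior T. u x = q x))}"

definition Wsh :: "real \<Rightarrow> (real \<Rightarrow> real) \<Rightarrow> 'a::euclidean_space set \<Rightarrow> real \<Rightarrow> ereal \<Rightarrow> nat \<Rightarrow> 'a set set \<Rightarrow> ('a \<Rightarrow> real) set" where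
  "Wsh p \<rho> \<Omega> \<delta>\<^sub>0 \<sigma> N \<T> = Wtilde N \<Omega> \<T> \<inter> Tspace p \<rho> \<Omega> \<delta>\<^sub>0 \<sigma>"

definition P1_space :: "'a::euclidean_space set \<Rightarrow> 'a set set \<Rightarrow> ('a \<Rightarrow> real) set" where
  "P1_space \<Omega> \<T> = {v. continuous_on UNIV v \<and> (\<forall>x. x \<notin> \<Omega> \<longrightarrow> v x = 0) \<and>
      (\<forall>T\<in>\<T>. \<exists>a b. \<forall>x\<in>T. v x = a \<bullet> x + b)}"

end

theory Submission
  imports Defs
begin

text \<open>Write the energy as \<open>I/p - L\<close> with \<open>L\<close> linear and \<open>I\<close> the integral of \<open>|Du|^p\<close>, where \<open>D\<close> is
  either the difference operator \<open>u(x) - u(y)\<close> or the weak gradient. Clarkson's inequality at the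
  midpoint of \<open>u\<close> and \<open>u_h\<close> gives \<open>c \<parallel>u_h - u\<parallel>^p \<le> E(u_h) - E(u)\<close>. For a competitor \<open>v = u + w\<close> the
  minimality of \<open>u\<close> at the reflected point \<open>u - w\<close> gives
  \<open>E(u_h) - E(u) \<le> E(v) - E(u) \<le> E(u + w) + E(u - w) - 2 E(u)\<close>, a second difference of \<open>I/p\<close>, which
  is of order \<open>\<parallel>w\<parallel>^2\<close>. Convergence follows because piecewise linear interpolants of continuous
  (respectively smooth) functions with compact support are dense: shape regularity bounds the gradient of the
  interpolation error by the oscillation of the gradient, and the weak gradient of a piecewise
  affine function is identified by testing against \<open>C^1\<close> bumps times polynomials.\<close>

section \<open>Pointwise inequalities and quasi-best approximation\<close>

text \<open>The exponent 2/p comes from an energy gap bounded below by the p-th power of the error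
  and above by the square of the competitor's distance. The reflected point replaces the
  Euler-Lagrange equation: adding its energy cancels the linear functional, so no derivative of the
  energy is computed. Midpoints and reflections are tested only against the minimality of
  \<open>u\<close> in the full space; the discrete minimizer is compared only with elements of its
  own set, such as 0. In the nonlocal case the norm lives at horizon min(delta_0, 1/sigma) and the
  energy at 1/sigma, while the Poincare inequality is granted strictly below delta_0; monotonicity
  in the horizon bridges both gaps. At a fixed horizon the bounded kernel makes the nonlocal space
  L^p extended by zero, so density is shown there in L^p alone. In the local case
  \<open>wgrad\<close> is a \<open>SOME\<close>-choice, and even its linearity almost everywhere
  rests on the uniqueness of gradients obtained as L^p limits.\<close>

lemma powr_add_le_two_powr:
  fixes x y p :: real
  assumes "0 \<le> x" "0 \<le> y" "0 \<le> p"
  shows "(x + y) powr p \<le> 2 powr p * (x powr p + y powr p)"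
proof -
  have "(x + y) powr p \<le> (2 * max x y) powr p"
    using assms by (intro powr_mono2) auto
  also have "\<dots> = 2 powr p * max x y powr p"
    using assms by (simp add: powr_mult)
  also have "max x y powr p \<le> x powr p + y powr p"
    by (auto simp: max_def)
  finally show ?thesis by simp
qed

text \<open>Since t^(q-1) is increasing, each z among x and y satisfies z^q <= z (x + y)^(q-1); the
  two bounds add up to (x + y)^q.\<close>

lemma powr_add_superadditive:
  fixes x y q :: real
  assumes "0 \<le> x" "0 \<le> y" "1 \<le> q"
  shows "x powr q + y powr q \<le> (x + y) powr q"
proof (cases "x + y = 0")
  case True
  then show ?thesis using assms by (simp add: add_nonneg_eq_0_iff)
next
  case False
  then have s: "x + y > 0" using assms by auto
  have *: "z powr q \<le> z * (x + y) powr (q - 1)" if "0 \<le> z" "z \<le> x + y" for z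
  proof (cases "z = 0")
    case False
    then have "z powr q = z * z powr (q - 1)"
      using that by (simp add: powr_diff)
    also have "\<dots> \<le> z * (x + y) powr (q - 1)"
      using that assms by (intro mult_left_mono powr_mono2) auto
    finally show ?thesis .
  qed auto
  have "x powr q + y powr q \<le> x * (x + y) powr (q - 1) + y * (x + y) powr (q - 1)"
    using assms by (intro add_mono *) auto
  also have "\<dots> = (x + y) * (x + y) powr (q - 1)"
    by (simp add: distrib_right)
  also have "\<dots> = (x + y) powr q"
    using s by (simp add: powr_diff)
  finally show ?thesis .
qed

text \<open>Powers p/2 of the squared norm make the inner product available, and p >= 2 makes the
  new exponent at least 1.\<close>

lemma norm_powr_eq_square: "norm x powr p = ((norm x)\<^sup>2) powr (p / 2)"
  by (cases "x = 0") (auto simp: powr_powr simp flip: powr_realpow powr_numeral)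

text \<open>Three facts with the exponent p/2 >= 1: superadditivity merges the two powers on the
  left, the parallelogram law evaluates the sum of squares inside, and convexity splits it
  again.\<close>

lemma clarkson_pointwise:
  fixes a b :: "'c::real_inner"
  assumes "2 \<le> p"
  shows "norm ((a + b) /\<^sub>R 2) powr p + norm ((a - b) /\<^sub>R 2) powr p
          \<le> (norm a powr p + norm b powr p) / 2"
proof -
  define q where "q = p / 2"
  have q: "1 \<le> q" using assms by (simp add: q_def)
  have "norm ((a + b) /\<^sub>R 2) powr p + norm ((a - b) /\<^sub>R 2) powr p
      \<le> ((norm ((a + b) /\<^sub>R 2))\<^sup>2 + (norm ((a - b) /\<^sub>R 2))\<^sup>2) powr q"
    unfolding norm_powr_eq_square q_def [symmetric]
    by (intro powr_add_superadditive) (use q in auto)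
  also have "(norm ((a + b) /\<^sub>R 2))\<^sup>2 + (norm ((a - b) /\<^sub>R 2))\<^sup>2
      = (1/2) * (norm a)\<^sup>2 + (1/2) * (norm b)\<^sup>2"
    by (simp add: power2_norm_eq_inner inner_add inner_diff inner_commute field_simps)
  also have "\<dots> powr q \<le> (1/2) * ((norm a)\<^sup>2) powr q + (1/2) * ((norm b)\<^sup>2) powr q"
  \<comment> \<open>Convexity of \<open>powr\<close> is invoked at positive arguments only; a
    vanishing vector is settled directly by (1/2)^q <= 1/2.\<close>
  proof (cases "a = 0 \<or> b = 0")
    case True
    have "(1/2) powr q \<le> (1/2::real)" using powr_mono' [of 1 q "1/2::real"] q by simp
    then have "(1/2) powr q * z powr q \<le> 1/2 * z powr q" for z :: real
      by (rule mult_right_mono) simp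
    then have "(1/2 * z) powr q \<le> 1/2 * z powr q" for z :: real
      by (simp only: powr_mult)
    then show ?thesis using True by auto
  next
    case False
    then show ?thesis
      using convex_onD [OF powr_convex [OF q], of "1/2" "(norm a)\<^sup>2" "(norm b)\<^sup>2"] by simp
  qed
  finally show ?thesis
    unfolding norm_powr_eq_square q_def [symmetric] by simp
qed

text \<open>Taylor expansion to second order. The interval is the range of |a + c|^2 / |a|^2 - 1 for
  |c| <= |a| / 2, where the ratio lies between 1/4 and 9/4.\<close>

lemma powr_quadratic_bound:
  fixes q :: real
  assumes "1 \<le> q"
  obtains C where "0 \<le> C"
    "\<And>x. -3/4 \<le> x \<Longrightarrow> x \<le> 5/4 \<Longrightarrow> (1 + x) powr q \<le> 1 + q * x + C * x\<^sup>2"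
proof
  \<comment> \<open>Here 1 + t lies in [1/4, 9/4]. As q - 2 may have either sign, (1 + t)^(q-2) is
    split into (1 + t)^q <= (9/4)^q and (1 + t)^(-2) <= 16.\<close>
  define C where "C = q * (q - 1) * (16 * (9/4) powr q)"
  show "0 \<le> C" using assms by (simp add: C_def)
  fix x :: real assume x: "-3/4 \<le> x" "x \<le> 5/4"
  show "(1 + x) powr q \<le> 1 + q * x + C * x\<^sup>2"
  proof (cases "x = 0")
    case False
    define diff :: "nat \<Rightarrow> real \<Rightarrow> real" where
      "diff m t = (if m = 0 then (1 + t) powr q else if m = 1 then q * (1 + t) powr (q - 1)
                  else q * (q - 1) * (1 + t) powr (q - 2))" for m t
    have "\<exists>t. (if x < 0 then x < t \<and> t < 0 else 0 < t \<and> t < x) \<and>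
        (1 + x) powr q = (\<Sum>m<2. (diff m 0 / fact m) * (x - 0)^m) + (diff 2 t / fact 2) * (x - 0)^2"
    proof (rule Taylor [where a = "-3/4" and b = "5/4"])
      show "diff 0 = (\<lambda>x. (1 + x) powr q)" by (simp add: diff_def fun_eq_iff)
      show "\<forall>m t. m < 2 \<and> - 3 / 4 \<le> t \<and> t \<le> 5 / 4 \<longrightarrow> DERIV (diff m) t :> diff (Suc m) t"
      proof (intro allI impI)
        fix m :: nat and t :: real assume mt: "m < 2 \<and> - 3 / 4 \<le> t \<and> t \<le> 5 / 4"
        then have "m = 0 \<or> m = 1" by auto
        moreover have "((\<lambda>t. (1 + t) powr r) has_real_derivative r * (1 + t) powr (r - 1)) (at t)" for r
          using mt has_real_derivative_powr [of "1 + t" r] DERIV_shift [of "\<lambda>z. z powr r" _ t 1]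
          by (simp add: add.commute)
        note this [of q] DERIV_cmult [OF this [of "q - 1"], of q]
        ultimately show "DERIV (diff m) t :> diff (Suc m) t"
          unfolding diff_def by (auto simp: mult.assoc)
      qed
    qed (use x False in auto)
    then obtain t where t0: "if x < 0 then x < t \<and> t < 0 else 0 < t \<and> t < x"
      and eq0: "(1 + x) powr q = (\<Sum>m<2. (diff m 0 / fact m) * (x - 0)^m) + (diff 2 t / fact 2) * (x - 0)^2"
      by blast
    have t: "- 3 / 4 \<le> t" "t \<le> 5 / 4" using t0 x by (auto split: if_splits)
    have eq: "(1 + x) powr q = 1 + q * x + q * (q - 1) * (1 + t) powr (q - 2) / 2 * x\<^sup>2"
      using eq0 by (simp add: diff_def numeral_2_eq_2)
    have "(1 + t) powr (q - 2) = (1 + t) powr q * inverse ((1 + t)\<^sup>2)"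
    proof -
      have "(1 + t) powr 2 = (1 + t)\<^sup>2" using t by (intro powr_numeral) auto
      then show ?thesis by (simp only: powr_diff divide_inverse)
    qed
    also have "\<dots> \<le> (9/4) powr q * inverse ((1/4)\<^sup>2)"
    proof (rule mult_mono)
      show "(1 + t) powr q \<le> (9/4) powr q"
        using t assms by (intro powr_mono2) auto
      have "(1/4)\<^sup>2 \<le> (1 + t)\<^sup>2"
        using t by (intro power_mono) auto
      then show "inverse ((1 + t)\<^sup>2) \<le> inverse ((1/4)\<^sup>2)"
        by (rule le_imp_inverse_le) simp
    qed auto
    finally have "(1 + t) powr (q - 2) / 2 \<le> 16 * (9/4) powr q"
      using powr_ge_zero [of "9/4" q] by (simp add: power2_eq_square del: powr_ge_zero)
    then have "q * (q - 1) * ((1 + t) powr (q - 2) / 2) * x\<^sup>2 \<le> C * x\<^sup>2"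
      unfolding C_def using assms by (intro mult_right_mono mult_left_mono) auto
    then show ?thesis using eq by simp
  qed auto
qed

text \<open>The scaling parameter \<open>t\<close>, later the size of \<open>b\<close> in \<open>L^p\<close>, lets Young's inequality do the
  work of Hoelder's.\<close>

lemma second_difference_pointwise:
  fixes p :: real
  assumes p: "2 \<le> p"
  obtains K where "0 \<le> K"
    "\<And>(a::'c::real_inner) b t. 0 < t \<Longrightarrow> t \<le> 1 \<Longrightarrow>
       norm (a + b) powr p + norm (a - b) powr p
         \<le> 2 * norm a powr p + K * t\<^sup>2 * (norm a powr p + (norm b / t) powr p)"
proof -
  define q where "q = p / 2"
  have q: "1 \<le> q" using p by (simp add: q_def)
  obtain C where C: "0 \<le> C"
    "\<And>x. -3/4 \<le> x \<Longrightarrow> x \<le> 5/4 \<Longrightarrow> (1 + x) powr q \<le> 1 + q * x + C * x\<^sup>2"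
    using powr_quadratic_bound [OF q] by blast
  \<comment> \<open>The first summand serves the regime |a| <= 2 |b|, where both norms are at most 3
    |b|. The others serve |b| < |a| / 2, where each of b and -b contributes q s^2 + 9 C s^2 with s =
    |b| / |a|.\<close>
  define K where "K = 2 * 3 powr p + 2 * q + 18 * C"
  have K: "2 * 3 powr p \<le> K" "2 * q + 18 * C \<le> K" "0 \<le> K"
    using q C(1) by (auto simp: K_def)
  show thesis
  proof (rule that)
    show "0 \<le> K" by fact
    fix a b :: 'c and t :: real
    assume t: "0 < t" "t \<le> 1"
    define x y where "x = norm a" and "y = norm b / t"
    have xy: "0 \<le> x" "0 \<le> y" and b: "norm b = t * y"
      using t by (auto simp: x_def y_def)
    show "norm (a + b) powr p + norm (a - b) powr p
         \<le> 2 * norm a powr p + K * t\<^sup>2 * (norm a powr p + (norm b / t) powr p)"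
    proof (cases "norm a \<le> 2 * norm b")
      case True
      have *: "norm (a + b) powr p \<le> (3 * norm b) powr p" "norm (a - b) powr p \<le> (3 * norm b) powr p"
        using True p norm_triangle_ineq [of a b] norm_triangle_ineq4 [of a b]
        by (auto intro!: powr_mono2)
      \<comment> \<open>Here p >= 2 and t <= 1 turn order p into order 2.\<close>
      have "t powr p \<le> t\<^sup>2"
        using t p powr_mono' [of 2 p t] by simp
      then have "norm b powr p \<le> t\<^sup>2 * y powr p"
        using b t xy by (simp add: powr_mult mult_right_mono)
      then have "2 * 3 powr p * norm b powr p \<le> K * (t\<^sup>2 * (x powr p + y powr p))"
        using K by (intro mult_mono) (auto intro: order_trans simp: distrib_left add_increasing)
      then show ?thesis
        using * powr_ge_zero [of "norm a" p] unfolding powr_mult x_def y_def mult.assoc by linarith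
    next
      case False
      then have a: "0 < norm a" and ba: "norm b < norm a / 2" by auto
      define s where "s = norm b / norm a"
      have s: "0 \<le> s" "s < 1/2" using a ba by (auto simp: s_def field_simps)
      \<comment> \<open>The term linear in c is kept exact: it changes sign between c = b and c =
        -b, so only terms of order s^2 survive in the sum.\<close>
      have one: "norm (a + c) powr p \<le> norm a powr p * (1 + q * (2 * (a \<bullet> c) / (norm a)\<^sup>2 + s\<^sup>2) + C * (9 * s\<^sup>2))"
        if c: "norm c = norm b" for c
      proof -
        define z where "z = 2 * (a \<bullet> c) / (norm a)\<^sup>2 + s\<^sup>2"
        have "\<bar>a \<bullet> c\<bar> \<le> norm a * norm b" using Cauchy_Schwarz_ineq2 [of a c] c by simp
        then have "\<bar>2 * (a \<bullet> c) / (norm a)\<^sup>2\<bar> \<le> 2 * s"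
          using a by (simp add: s_def field_simps power2_eq_square abs_mult)
        moreover have "s\<^sup>2 \<le> s / 2" using s mult_left_mono [of s "1/2" s] by (simp add: power2_eq_square)
        moreover have "z \<ge> -3/4"
        proof -
          have "2 * s - s\<^sup>2 \<le> 3/4"
            using s mult_nonneg_nonneg [of "1/2 - s" "3/2 - s"]
            by (simp add: field_simps power2_eq_square)
          then show ?thesis using calculation(1) unfolding z_def by linarith
        qed
        ultimately have z: "-3/4 \<le> z" "z \<le> 5/4" "\<bar>z\<bar> \<le> 3 * s"
          using s zero_le_power2 [of s] unfolding z_def abs_le_iff by linarith+
        have "(norm (a + c))\<^sup>2 = (norm a)\<^sup>2 * (1 + z)"
        proof -
          have "(norm (a + c))\<^sup>2 = (norm a)\<^sup>2 + 2 * (a \<bullet> c) + (norm b)\<^sup>2"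
            using dot_norm [of a c] c by simp
          also have "\<dots> = (norm a)\<^sup>2 * (1 + z)"
            using a unfolding z_def s_def by (simp add: power_divide distrib_left)
          finally show ?thesis .
        qed
        then have "norm (a + c) powr p = norm a powr p * (1 + z) powr q"
          unfolding norm_powr_eq_square q_def [symmetric] using z by (simp add: powr_mult)
        also have "\<dots> \<le> norm a powr p * (1 + q * z + C * z\<^sup>2)"
          using C(2) z by (intro mult_left_mono) auto
        also have "\<dots> \<le> norm a powr p * (1 + q * z + C * (9 * s\<^sup>2))"
        proof -
          have "z\<^sup>2 \<le> (3 * s)\<^sup>2" using z s by (intro abs_le_square_iff [THEN iffD1]) auto
          then show ?thesis using C(1) by (intro mult_left_mono add_left_mono) (auto simp: power_mult_distrib)
        qed
        finally show ?thesis by (simp add: z_def)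
      qed
      have sum: "norm (a + b) powr p + norm (a + (- b)) powr p
          \<le> 2 * norm a powr p + (2 * q + 18 * C) * (norm a powr p * s\<^sup>2)"
        using add_mono [OF one [of b] one [of "- b"]] by (simp add: algebra_simps)
      \<comment> \<open>Young's inequality by cases: x^p (y/x)^2 is at most x^p if y <= x, and at
        most y^p otherwise.\<close>
      have "norm a powr p * s\<^sup>2 \<le> t\<^sup>2 * (x powr p + y powr p)"
      proof -
        have "s\<^sup>2 = t\<^sup>2 * (y / x)\<^sup>2" using b by (simp add: s_def x_def power_mult_distrib power_divide)
        moreover have "x powr p * (y / x)\<^sup>2 \<le> x powr p + y powr p"
        proof (cases "y \<le> x")
          case True
          have "(y / x)\<^sup>2 \<le> 1" using True xy a by (simp add: x_def power_le_one)
          then have "x powr p * (y / x)\<^sup>2 \<le> x powr p * 1" by (intro mult_left_mono) auto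
          then show ?thesis by (simp add: add_increasing2)
        next
          case False
          have "x powr p * (y / x)\<^sup>2 = x powr (p - 2) * y\<^sup>2"
            using a by (simp add: x_def powr_diff power_divide)
          also have "\<dots> \<le> y powr (p - 2) * y\<^sup>2"
            using False p xy by (intro mult_right_mono powr_mono2) auto
          also have "\<dots> = y powr p" using False xy by (simp add: powr_diff)
          finally show ?thesis by (simp add: add_increasing)
        qed
        ultimately show ?thesis
          using mult_left_mono [of "x powr p * (y / x)\<^sup>2" "x powr p + y powr p" "t\<^sup>2"]
          by (simp add: x_def mult_ac)
      qed
      then have "(2 * q + 18 * C) * (norm a powr p * s\<^sup>2) \<le> K * (t\<^sup>2 * (x powr p + y powr p))"
        using K q C(1) by (intro mult_mono [OF K(2)]) auto
      then show ?thesis using sum by (simp add: x_def y_def mult.assoc)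
    qed
  qed
qed

text \<open>Comparing x with y^(p-1) decides which summand alone dominates the product; this gives
  Young's inequality with constant 1.\<close>

lemma mult_le_powr_conjugate:
  fixes x y p :: real
  assumes "0 \<le> x" "0 \<le> y" "1 < p"
  shows "x * y \<le> x powr (p / (p - 1)) + y powr p"
proof (cases "x = 0 \<or> y = 0")
  case False
  then have pos: "0 < x" "0 < y" using assms by auto
  show ?thesis
  proof (cases "x \<le> y powr (p - 1)")
    case True
    have "x * y \<le> y powr (p - 1) * y" using True pos by simp
    also have "\<dots> = y powr p" using pos by (simp add: powr_diff)
    finally show ?thesis by (simp add: add_increasing)
  next
    case False
    have "y = (y powr (p - 1)) powr (1 / (p - 1))" using pos assms by (simp add: powr_powr)
    also have "\<dots> \<le> x powr (1 / (p - 1))" using False assms by (intro powr_mono2) auto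
    finally have "x * y \<le> x * x powr (1 / (p - 1))" using pos by simp
    also have "\<dots> = x powr (1 + 1 / (p - 1))" using pos by (simp add: powr_add)
    also have "1 + 1 / (p - 1) = p / (p - 1)" using assms by (simp add: field_simps)
    finally show ?thesis by (simp add: add_increasing2)
  qed
qed auto

text \<open>\<open>I\<close> stands for the p-th power of the energy seminorm, equivalent to
  \<open>Nm\<close> to the power p. The constant is built from \<open>p\<close>, \<open>K\<close>,
  \<open>c1\<close>, \<open>c2\<close>, \<open>I u\<close> and the energies of 0 and
  \<open>u\<close>, none of which involves \<open>W\<close>; this is the independence of the
  mesh.\<close>

lemma cea_estimate:
  fixes T :: "('a \<Rightarrow> real) set" and I L Nm :: "('a \<Rightarrow> real) \<Rightarrow> real" and p K c1 c2 :: real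
  assumes p: "2 \<le> p"
    and lin: "\<And>v w \<alpha> \<beta>. v \<in> T \<Longrightarrow> w \<in> T \<Longrightarrow> (\<lambda>x. \<alpha> * v x + \<beta> * w x) \<in> T"
    and L: "\<And>v w \<alpha> \<beta>. v \<in> T \<Longrightarrow> w \<in> T \<Longrightarrow> L (\<lambda>x. \<alpha> * v x + \<beta> * w x) = \<alpha> * L v + \<beta> * L w"
    and E: "\<And>v. E v = (1/p) * I v - L v"
    and I0: "\<And>v. 0 \<le> I v"
    and half: "\<And>v. v \<in> T \<Longrightarrow> I (\<lambda>x. v x / 2) = I v / 2 powr p"
    and clarkson: "\<And>v w. v \<in> T \<Longrightarrow> w \<in> T \<Longrightarrow>
        I (\<lambda>x. (v x + w x) / 2) + I (\<lambda>x. (v x - w x) / 2) \<le> (I v + I w) / 2"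
    and K: "0 \<le> K"
    and second: "\<And>v w t. v \<in> T \<Longrightarrow> w \<in> T \<Longrightarrow> 0 < t \<Longrightarrow> t \<le> 1 \<Longrightarrow> I w \<le> t powr p \<Longrightarrow>
        I (\<lambda>x. v x + w x) + I (\<lambda>x. v x - w x) \<le> 2 * I v + K * t\<^sup>2 * (I v + 1)"
    and N0: "\<And>v. 0 \<le> Nm v"
    and c1: "0 < c1" "\<And>v. v \<in> T \<Longrightarrow> c1 * Nm v powr p \<le> I v"
    and c2: "0 < c2" "\<And>v. v \<in> T \<Longrightarrow> I v \<le> c2 * Nm v powr p"
    and u: "is_minimizer E T u"
  obtains C where "0 < C"
    "\<And>W uh v. W \<subseteq> T \<Longrightarrow> (\<lambda>_. 0) \<in> W \<Longrightarrow> is_minimizer E W uh \<Longrightarrow> v \<in> W \<Longrightarrow>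
       Nm (\<lambda>x. uh x - u x) \<le> C * Nm (\<lambda>x. v x - u x) powr (2 / p)"
proof -
  have uT: "u \<in> T" and umin: "\<And>v. v \<in> T \<Longrightarrow> E u \<le> E v"
    using u by (auto simp: is_minimizer_def)
  \<comment> \<open>The midpoint halves the energy gap and the half difference costs 2^p; the factor
    2 / p undoes the halving and carries the 1/p of the energy.\<close>
  define c where "c = 2 / p * c1 / 2 powr p"
  have c: "0 < c" using p c1 by (simp add: c_def)
  have lower: "c * Nm (\<lambda>x. v x - u x) powr p \<le> E v - E u" if v: "v \<in> T" for v
  proof -
    have mid: "(\<lambda>x. (v x + u x) / 2) \<in> T" and diff: "(\<lambda>x. v x - u x) \<in> T"
      using lin [OF v uT, of "1/2" "1/2"] lin [OF v uT, of 1 "-1"] by (simp_all add: add_divide_distrib)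
    have Lm: "L (\<lambda>x. (v x + u x) / 2) = (L v + L u) / 2"
      using L [OF v uT, of "1/2" "1/2"] by (simp add: add_divide_distrib)
    have "I (\<lambda>x. (v x - u x) / 2) = I (\<lambda>x. v x - u x) / 2 powr p"
      using half [OF diff] .
    moreover have "c1 * Nm (\<lambda>x. v x - u x) powr p \<le> I (\<lambda>x. v x - u x)" by (rule c1(2) [OF diff])
    ultimately have "c1 * Nm (\<lambda>x. v x - u x) powr p / 2 powr p \<le> I (\<lambda>x. (v x - u x) / 2)"
      by (simp add: divide_right_mono)
    also have "\<dots> \<le> (I v + I u) / 2 - I (\<lambda>x. (v x + u x) / 2)"
      using clarkson [OF v uT] by linarith
    finally have *: "1/p * (c1 * Nm (\<lambda>x. v x - u x) powr p / 2 powr p)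
        \<le> 1/p * ((I v + I u) / 2 - I (\<lambda>x. (v x + u x) / 2))"
      using p by (intro mult_left_mono) auto
    have "E u \<le> 1/p * I (\<lambda>x. (v x + u x) / 2) - (L v + L u) / 2"
      using umin [OF mid] by (simp add: E Lm)
    moreover have "c * Nm (\<lambda>x. v x - u x) powr p = 2 * (1/p * (c1 * Nm (\<lambda>x. v x - u x) powr p / 2 powr p))"
      by (simp add: c_def)
    moreover have "1/p * ((I v + I u) / 2 - I (\<lambda>x. (v x + u x) / 2))
        = (1/p * I v) / 2 + (1/p * I u) / 2 - 1/p * I (\<lambda>x. (v x + u x) / 2)"
      using p by (simp add: field_simps)
    moreover have "n \<le> iv - lv - (iu - lu)"
      if "iu - lu \<le> im - (lv + lu) / 2" "n = 2 * x" "y = iv / 2 + iu / 2 - im" "x \<le> y"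
      for n iv lv iu lu im x y :: real
      using that by (simp add: field_simps)
    ultimately show ?thesis
      using * unfolding E by blast
  qed
  define B where "B = K / p * (I u + 1)"
  have B: "0 \<le> B" using K p I0 by (simp add: B_def)
  \<comment> \<open>\<open>t\<close> is any bound in (0, 1] for the size of v - u rather than that
    size itself, because \<open>second\<close> asks for a positive scale and v may equal u.\<close>
  have upper: "E v - E u \<le> B * t\<^sup>2"
    if v: "v \<in> T" and t: "0 < t" "t \<le> 1" "c2 * Nm (\<lambda>x. v x - u x) powr p \<le> t powr p" for v t
  proof -
    define w where "w = (\<lambda>x. v x - u x)"
    have w: "w \<in> T" and r: "(\<lambda>x. u x - w x) \<in> T"
      using lin [OF v uT, of 1 "-1"] lin [OF uT v, of 2 "-1"] by (simp_all add: w_def algebra_simps)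
    \<comment> \<open>The values of \<open>L\<close> at \<open>v\<close> and at its reflection sum
      to 2 \<open>L u\<close>; this is the cancellation that leaves only \<open>I\<close>.\<close>
    have Lw: "L (\<lambda>x. u x - w x) = 2 * L u - L v"
      using L [OF uT v, of 2 "-1"] by (simp add: w_def algebra_simps)
    have veq: "v = (\<lambda>x. u x + w x)" by (simp add: w_def)
    have "I w \<le> t powr p" using c2(2) [OF w] t(3) by (simp add: w_def)
    then have "I v + I (\<lambda>x. u x - w x) \<le> 2 * I u + K * t\<^sup>2 * (I u + 1)"
      using second [OF uT w t(1,2)] veq by simp
    then have "1/p * (I v + I (\<lambda>x. u x - w x)) \<le> 1/p * (2 * I u + K * t\<^sup>2 * (I u + 1))"
      using p by (intro mult_left_mono) auto
    moreover have "E u \<le> E (\<lambda>x. u x - w x)" by (rule umin [OF r])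
    moreover have "1/p * (I v + I (\<lambda>x. u x - w x)) = 1/p * I v + 1/p * I (\<lambda>x. u x - w x)"
      "1/p * (2 * I u + K * t\<^sup>2 * (I u + 1)) = 2 * (1/p * I u) + B * t\<^sup>2"
      unfolding B_def by (simp_all add: algebra_simps)
    moreover have "iv - lv - (iu - lu) \<le> b"
      if "x \<le> y" "iu - lu \<le> ir - (2 * lu - lv)" "x = iv + ir" "y = 2 * iu + b"
      for x y iv lv iu lu ir b :: real
      using that by linarith
    ultimately show ?thesis
      unfolding E Lw by blast
  qed
  \<comment> \<open>With this scaling the condition \<open>c2 * n powr p \<le> t powr p\<close>
    becomes tau n <= t.\<close>
  define \<tau> where "\<tau> = c2 powr (1/p)"
  have \<tau>: "0 < \<tau>" "\<tau> powr p = c2" using c2 p by (auto simp: \<tau>_def powr_powr)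
  \<comment> \<open>A priori bound from the competitor 0. It covers the competitors so far from
    \<open>u\<close> that no t <= 1 is available.\<close>
  define M where "M = ((\<bar>E (\<lambda>_. 0)\<bar> + \<bar>E u\<bar>) / c) powr (1/p)"
  define C where "C = 1 + M * \<tau> powr (2/p) + (B * \<tau>\<^sup>2 / c) powr (1/p)"
  show thesis
  proof (rule that)
    show "0 < C" using \<tau> by (simp add: C_def M_def add_pos_nonneg)
    fix W uh v
    assume W: "W \<subseteq> T" "(\<lambda>_. 0) \<in> W" and uh: "is_minimizer E W uh" and v: "v \<in> W"
    define n where "n = Nm (\<lambda>x. v x - u x)"
    define e where "e = Nm (\<lambda>x. uh x - u x)"
    have n: "0 \<le> n" and e: "0 \<le> e" using N0 by (auto simp: n_def e_def)
    have uhW: "uh \<in> W" "E uh \<le> E (\<lambda>_. 0)" "E uh \<le> E v"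
      using uh W v by (auto simp: is_minimizer_def)
    have le: "c * e powr p \<le> E uh - E u" using lower uhW W by (auto simp: e_def)
    have root: "e \<le> x powr (1/p)" if "c * e powr p \<le> c * x" for x
    proof -
      have "e powr p \<le> x" using that c by simp
      then have "(e powr p) powr (1/p) \<le> x powr (1/p)" using p by (intro powr_mono2) auto
      then show ?thesis using e p by (simp add: powr_powr)
    qed
    have eM: "e \<le> M" unfolding M_def using le uhW c by (intro root) auto
    have M: "0 \<le> M" by (simp add: M_def)
    show "e \<le> C * n powr (2/p)"
    proof (cases "\<tau> * n \<le> 1")
      case False
      then have "1 \<le> (\<tau> * n) powr (2/p)" using p by (intro ge_one_powr_ge_zero) auto
      then have "e \<le> M * (\<tau> * n) powr (2/p)" using eM M mult_left_mono [of 1 "(\<tau> * n) powr (2/p)" M] by auto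
      also have "\<dots> = (M * \<tau> powr (2/p)) * n powr (2/p)" using \<tau> n by (simp add: powr_mult)
      also have "\<dots> \<le> C * n powr (2/p)" by (intro mult_right_mono) (auto simp: C_def)
      finally show ?thesis .
    next
      case True
      have *: "c * e powr p \<le> B * t\<^sup>2" if "0 < t" "t \<le> 1" "\<tau> * n \<le> t" for t
      proof -
        have "c2 * n powr p = (\<tau> * n) powr p" using \<tau> n by (simp add: powr_mult)
        also have "\<dots> \<le> t powr p" using that \<tau> n p by (intro powr_mono2) auto
        finally have "E v - E u \<le> B * t\<^sup>2" using that W v by (intro upper) (auto simp: n_def)
        then show ?thesis using le uhW by simp
      qed
      have "c * e powr p \<le> B * (\<tau> * n)\<^sup>2"
      \<comment> \<open>The natural choice t = tau n is not positive when n = 0; then the bound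
        holds for all small t > 0 and passes to the limit.\<close>
      proof (cases "n = 0")
        case False
        then show ?thesis using True \<tau> n by (intro *) auto
      next
        case True
        have "((\<lambda>t. B * t\<^sup>2) \<longlongrightarrow> B * 0\<^sup>2) (at_right 0)" by (intro tendsto_intros)
        moreover have "eventually (\<lambda>t. c * e powr p \<le> B * t\<^sup>2) (at_right 0)"
          using eventually_at_right_real [OF zero_less_one]
          by (rule eventually_mono) (use True in \<open>auto intro!: *\<close>)
        ultimately have "c * e powr p \<le> B * 0\<^sup>2"
          by (rule tendsto_lowerbound) auto
        then show ?thesis using True by simp
      qed
      then have "e \<le> (B * (\<tau> * n)\<^sup>2 / c) powr (1/p)" using c by (intro root) auto
      also have "B * (\<tau> * n)\<^sup>2 / c = (B * \<tau>\<^sup>2 / c) * n\<^sup>2" by (simp add: power_mult_distrib)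
      also have "\<dots> powr (1/p) = (B * \<tau>\<^sup>2 / c) powr (1/p) * n powr (2/p)"
        using n by (cases "n = 0") (simp_all only: powr_mult, simp_all add: powr_powr flip: powr_numeral)
      also have "\<dots> \<le> C * n powr (2/p)"
        using M by (intro mult_right_mono) (auto simp: C_def)
      finally show ?thesis .
    qed
  qed
qed

section \<open>Weighted integrals of p-th powers\<close>

text \<open>A common form for both energies: \<open>M\<close> carries pairs of points weighted by
  the kernel, with F(x, y) = u(x) - u(y), or points weighted by the indicator of the domain, with F
  the vector-valued weak gradient.\<close>

definition weighted_Lp_int ::
  "real \<Rightarrow> 'b measure \<Rightarrow> ('b \<Rightarrow> ennreal) \<Rightarrow> ('b \<Rightarrow> 'c::real_normed_vector) \<Rightarrow> ennreal" where
  "weighted_Lp_int p M W F = (\<integral>\<^sup>+ z. W z * ennreal (norm (F z) powr p) \<partial>M)"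

lemma weighted_Lp_int_cong_AE:
  assumes "AE z in M. W z = 0 \<or> F z = G z"
  shows "weighted_Lp_int p M W F = weighted_Lp_int p M W G"
  unfolding weighted_Lp_int_def
  by (intro nn_integral_cong_AE) (use assms in eventually_elim, auto)

text \<open>Clarkson's inequality and the second difference inequality both have the shape of
  \<open>le\<close>, so one integration serves both; with \<open>B\<close> zero it also yields
  finiteness of linear combinations.\<close>

lemma weighted_Lp_int_combination:
  fixes A B F G :: "'b \<Rightarrow> 'c::euclidean_space"
  assumes meas [measurable]: "W \<in> borel_measurable M" "A \<in> borel_measurable M"
      "B \<in> borel_measurable M" "F \<in> borel_measurable M" "G \<in> borel_measurable M"
    and fin: "weighted_Lp_int p M W F < \<infinity>" "weighted_Lp_int p M W G < \<infinity>"
    and nonneg: "0 \<le> \<alpha>" "0 \<le> \<beta>"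
    and le: "\<And>z. norm (A z) powr p + norm (B z) powr p
               \<le> \<alpha> * norm (F z) powr p + \<beta> * norm (G z) powr p"
  shows "weighted_Lp_int p M W A < \<infinity>" "weighted_Lp_int p M W B < \<infinity>"
    "enn2real (weighted_Lp_int p M W A) + enn2real (weighted_Lp_int p M W B)
       \<le> \<alpha> * enn2real (weighted_Lp_int p M W F) + \<beta> * enn2real (weighted_Lp_int p M W G)"
proof -
  let ?I = "weighted_Lp_int p M W"
  have "?I A + ?I B = (\<integral>\<^sup>+ z. W z * ennreal (norm (A z) powr p + norm (B z) powr p) \<partial>M)"
    unfolding weighted_Lp_int_def
    by (subst nn_integral_add [symmetric]) (auto simp: ennreal_plus distrib_left)
  also have "\<dots> \<le> (\<integral>\<^sup>+ z. W z * ennreal (\<alpha> * norm (F z) powr p + \<beta> * norm (G z) powr p) \<partial>M)"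
    by (intro nn_integral_mono mult_left_mono ennreal_leI le) auto
  also have "\<dots> = (\<integral>\<^sup>+ z. ennreal \<alpha> * (W z * ennreal (norm (F z) powr p))
      + ennreal \<beta> * (W z * ennreal (norm (G z) powr p)) \<partial>M)"
    using nonneg by (intro nn_integral_cong) (auto simp: ennreal_plus ennreal_mult distrib_left mult_ac)
  also have "\<dots> = ennreal \<alpha> * ?I F + ennreal \<beta> * ?I G"
    unfolding weighted_Lp_int_def by (simp add: nn_integral_add nn_integral_cmult)
  finally have *: "?I A + ?I B \<le> ennreal \<alpha> * ?I F + ennreal \<beta> * ?I G" .
  have fin': "ennreal \<alpha> * ?I F + ennreal \<beta> * ?I G < \<infinity>"
    using fin by (auto simp: ennreal_mult_less_top)
  then show A: "?I A < \<infinity>" and B: "?I B < \<infinity>"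
    using le_less_trans [OF * fin'] by auto
  have "enn2real (?I A + ?I B) \<le> enn2real (ennreal \<alpha> * ?I F + ennreal \<beta> * ?I G)"
    using * fin' by (intro enn2real_mono) auto
  then show "enn2real (?I A) + enn2real (?I B) \<le> \<alpha> * enn2real (?I F) + \<beta> * enn2real (?I G)"
    using A B fin nonneg by (simp add: enn2real_plus enn2real_mult ennreal_mult_less_top)
qed

lemma weighted_Lp_int_scale:
  fixes F :: "'b \<Rightarrow> 'c::euclidean_space"
  assumes [measurable]: "W \<in> borel_measurable M" "F \<in> borel_measurable M"
  shows "weighted_Lp_int p M W (\<lambda>z. c *\<^sub>R F z) = ennreal (\<bar>c\<bar> powr p) * weighted_Lp_int p M W F"
  unfolding weighted_Lp_int_def
  by (subst nn_integral_cmult [symmetric]) (auto simp: powr_mult ennreal_mult mult_ac)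

lemma weighted_Lp_int_lincomb_finite:
  fixes F G :: "'b \<Rightarrow> 'c::euclidean_space"
  assumes [measurable]: "W \<in> borel_measurable M" "F \<in> borel_measurable M" "G \<in> borel_measurable M"
    and fin: "weighted_Lp_int p M W F < \<infinity>" "weighted_Lp_int p M W G < \<infinity>" and p: "0 \<le> p"
  shows "weighted_Lp_int p M W (\<lambda>z. a *\<^sub>R F z + b *\<^sub>R G z) < \<infinity>"
proof (rule weighted_Lp_int_combination(1) [where B = "\<lambda>_. 0" and F = F and G = G
      and \<alpha> = "2 powr p * \<bar>a\<bar> powr p" and \<beta> = "2 powr p * \<bar>b\<bar> powr p"])
  fix z
  have "norm (a *\<^sub>R F z + b *\<^sub>R G z) powr p \<le> (norm (a *\<^sub>R F z) + norm (b *\<^sub>R G z)) powr p"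
    using p by (intro powr_mono2 norm_triangle_ineq) auto
  also have "\<dots> \<le> 2 powr p * (norm (a *\<^sub>R F z) powr p + norm (b *\<^sub>R G z) powr p)"
    using p by (intro powr_add_le_two_powr) auto
  finally show "norm (a *\<^sub>R F z + b *\<^sub>R G z) powr p + norm (0::'c) powr p
      \<le> 2 powr p * \<bar>a\<bar> powr p * norm (F z) powr p + 2 powr p * \<bar>b\<bar> powr p * norm (G z) powr p"
    by (simp add: powr_mult algebra_simps)
qed (use assms in auto)

lemma weighted_Lp_int_weight_mono:
  fixes F :: "'b \<Rightarrow> 'c::euclidean_space"
  assumes [measurable]: "W' \<in> borel_measurable M" "F \<in> borel_measurable M"
    and "\<And>z. W z \<le> c * W' z"
  shows "weighted_Lp_int p M W F \<le> c * weighted_Lp_int p M W' F"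
proof -
  have "weighted_Lp_int p M W F \<le> (\<integral>\<^sup>+ z. c * (W' z * ennreal (norm (F z) powr p)) \<partial>M)"
    unfolding weighted_Lp_int_def mult.assoc [symmetric]
    by (intro nn_integral_mono mult_right_mono assms) auto
  also have "\<dots> = c * weighted_Lp_int p M W' F"
    unfolding weighted_Lp_int_def by (simp add: nn_integral_cmult)
  finally show ?thesis .
qed

text \<open>\<open>D\<close> is linear only almost everywhere off the zeros of the weight, because a
  chosen weak gradient is linear only up to null sets. \<open>X\<close> is the p-th power of the
  norm, so the equivalences \<open>c1\<close> and \<open>c2\<close> are free of roots.\<close>

lemma cea_estimate_weighted:
  fixes T :: "('a \<Rightarrow> real) set" and D :: "('a \<Rightarrow> real) \<Rightarrow> 'b \<Rightarrow> 'c::euclidean_space"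
    and I L X :: "('a \<Rightarrow> real) \<Rightarrow> real" and p c1 c2 :: real
  assumes p: "2 \<le> p"
    and lin: "\<And>v w \<alpha> \<beta>. v \<in> T \<Longrightarrow> w \<in> T \<Longrightarrow> (\<lambda>x. \<alpha> * v x + \<beta> * w x) \<in> T"
    and L: "\<And>v w \<alpha> \<beta>. v \<in> T \<Longrightarrow> w \<in> T \<Longrightarrow> L (\<lambda>x. \<alpha> * v x + \<beta> * w x) = \<alpha> * L v + \<beta> * L w"
    and E: "\<And>v. E v = (1/p) * I v - L v"
    and I0: "\<And>v. 0 \<le> I v"
    and W [measurable]: "W \<in> borel_measurable M"
    and D [measurable]: "\<And>v. v \<in> T \<Longrightarrow> D v \<in> borel_measurable M"
    and D_lin: "\<And>v w \<alpha> \<beta>. v \<in> T \<Longrightarrow> w \<in> T \<Longrightarrow>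
        AE z in M. W z = 0 \<or> D (\<lambda>x. \<alpha> * v x + \<beta> * w x) z = \<alpha> *\<^sub>R D v z + \<beta> *\<^sub>R D w z"
    and fin: "\<And>v. v \<in> T \<Longrightarrow> weighted_Lp_int p M W (D v) < \<infinity>"
    and I: "\<And>v. v \<in> T \<Longrightarrow> I v = enn2real (weighted_Lp_int p M W (D v))"
    and X0: "\<And>v. 0 \<le> X v"
    and c1: "0 < c1" "\<And>v. v \<in> T \<Longrightarrow> c1 * X v \<le> I v"
    and c2: "0 < c2" "\<And>v. v \<in> T \<Longrightarrow> I v \<le> c2 * X v"
    and u: "is_minimizer E T u"
  obtains C where "0 < C"
    "\<And>V uh v. V \<subseteq> T \<Longrightarrow> (\<lambda>_. 0) \<in> V \<Longrightarrow> is_minimizer E V uh \<Longrightarrow> v \<in> V \<Longrightarrow>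
       X (\<lambda>x. uh x - u x) powr (1/p) \<le> C * (X (\<lambda>x. v x - u x) powr (1/p)) powr (2 / p)"
proof -
  have I_lin: "I (\<lambda>x. \<alpha> * v x + \<beta> * w x) = enn2real (weighted_Lp_int p M W (\<lambda>z. \<alpha> *\<^sub>R D v z + \<beta> *\<^sub>R D w z))"
    if "v \<in> T" "w \<in> T" for v w \<alpha> \<beta>
    using I [OF lin [OF that]] weighted_Lp_int_cong_AE [OF D_lin [OF that]] by metis
  obtain K where K: "0 \<le> K"
    "\<And>(a::'c) b t. 0 < t \<Longrightarrow> t \<le> 1 \<Longrightarrow> norm (a + b) powr p + norm (a - b) powr p
         \<le> 2 * norm a powr p + K * t\<^sup>2 * (norm a powr p + (norm b / t) powr p)"
    using second_difference_pointwise [OF p] by metis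
  show thesis
  proof (rule cea_estimate [where E = E and T = T and I = I and L = L and p = p and K = K
      and Nm = "\<lambda>v. X v powr (1/p)" and ?c1.0 = c1 and ?c2.0 = c2 and u = u])
    fix v assume v: "v \<in> T"
    note Dv [measurable] = D [OF v]
    have "I (\<lambda>x. v x / 2) = enn2real (weighted_Lp_int p M W (\<lambda>z. (1/2) *\<^sub>R D v z))"
      using I_lin [OF v v, of "1/2" 0] by simp
    also have "\<dots> = I v / 2 powr p"
      by (subst weighted_Lp_int_scale) (auto simp: enn2real_mult powr_divide I [OF v])
    finally show "I (\<lambda>x. v x / 2) = I v / 2 powr p" .
    show "c1 * (X v powr (1/p)) powr p \<le> I v" "I v \<le> c2 * (X v powr (1/p)) powr p"
      using c1(2) [OF v] c2(2) [OF v] p X0 [of v] by (simp_all add: powr_powr)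
  next
    fix v w assume v: "v \<in> T" and w: "w \<in> T"
    note Dv [measurable] = D [OF v] D [OF w]
    have eq: "(\<lambda>x. (v x + w x) / 2) = (\<lambda>x. 1/2 * v x + 1/2 * w x)"
      "(\<lambda>x. (v x - w x) / 2) = (\<lambda>x. 1/2 * v x + (-1/2) * w x)"
      by (auto simp: field_simps)
    have "I (\<lambda>x. (v x + w x) / 2) + I (\<lambda>x. (v x - w x) / 2) \<le> 1/2 * I v + 1/2 * I w"
      unfolding eq I_lin [OF v w] I [OF v] I [OF w]
    proof (rule weighted_Lp_int_combination(3))
      fix z
      show "norm ((1/2) *\<^sub>R D v z + (1/2) *\<^sub>R D w z) powr p + norm ((1/2) *\<^sub>R D v z + (-1/2) *\<^sub>R D w z) powr p
        \<le> 1/2 * norm (D v z) powr p + 1/2 * norm (D w z) powr p"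
      proof -
        have "(1/2) *\<^sub>R D v z + (1/2) *\<^sub>R D w z = (D v z + D w z) /\<^sub>R 2"
          "(1/2) *\<^sub>R D v z + (-1/2) *\<^sub>R D w z = (D v z - D w z) /\<^sub>R 2"
          by (simp_all add: scaleR_add_right scaleR_diff_right)
        then show ?thesis
          using clarkson_pointwise [OF p, of "D v z" "D w z"] by simp
      qed
    qed (use fin v w in auto)
    then show "I (\<lambda>x. (v x + w x) / 2) + I (\<lambda>x. (v x - w x) / 2) \<le> (I v + I w) / 2"
      by simp
    fix t :: real assume t: "0 < t" "t \<le> 1" "I w \<le> t powr p"
    have eq': "(\<lambda>x. v x + w x) = (\<lambda>x. 1 * v x + 1 * w x)" "(\<lambda>x. v x - w x) = (\<lambda>x. 1 * v x + (-1) * w x)"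
      by auto
    \<comment> \<open>The coefficient K t^2 / t^p of \<open>I w\<close> comes from the scaled term
      (|b| / t)^p; the hypothesis \<open>I w \<le> t powr p\<close> reduces its contribution to K
      t^2.\<close>
    have "I (\<lambda>x. v x + w x) + I (\<lambda>x. v x - w x) \<le> (2 + K * t\<^sup>2) * I v + (K * t\<^sup>2 / t powr p) * I w"
      unfolding eq' I_lin [OF v w] I [OF v] I [OF w]
    proof (rule weighted_Lp_int_combination(3))
      fix z
      show "norm (1 *\<^sub>R D v z + 1 *\<^sub>R D w z) powr p + norm (1 *\<^sub>R D v z + (-1) *\<^sub>R D w z) powr p
        \<le> (2 + K * t\<^sup>2) * norm (D v z) powr p + (K * t\<^sup>2 / t powr p) * norm (D w z) powr p"
        using K(2) [OF t(1,2), of "D v z" "D w z"] t by (simp add: algebra_simps powr_divide)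
    qed (use fin v w K(1) in auto)
    also have "\<dots> \<le> (2 + K * t\<^sup>2) * I v + (K * t\<^sup>2 / t powr p) * t powr p"
      using t K(1) by (intro add_left_mono mult_left_mono) auto
    also have "\<dots> = 2 * I v + K * t\<^sup>2 * (I v + 1)"
      using t by (simp add: algebra_simps)
    finally show "I (\<lambda>x. v x + w x) + I (\<lambda>x. v x - w x) \<le> 2 * I v + K * t\<^sup>2 * (I v + 1)" .
  qed (fact p lin L E I0 K(1) c1(1) c2(1) u powr_ge_zero that)+
qed

section \<open>L^p integrals over a domain, the dual pairing and the nonlocal seminorm\<close>

lemma Lp_int_eq_weighted: "Lp_int p A u = weighted_Lp_int p lebesgue (indicator A) u"
  by (simp add: Lp_int_def weighted_Lp_int_def mult.commute)

lemma Lp_int_norm_eq_weighted: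
  "Lp_int p A (\<lambda>x. norm (g x)) = weighted_Lp_int p lebesgue (indicator A) g"
  by (simp add: Lp_int_def weighted_Lp_int_def mult.commute)

lemma Lp_int_lincomb_finite:
  assumes "A \<in> sets lebesgue" "u \<in> borel_measurable lebesgue" "v \<in> borel_measurable lebesgue"
    "Lp_int p A u < \<infinity>" "Lp_int p A v < \<infinity>" "0 \<le> p"
  shows "Lp_int p A (\<lambda>x. a * u x + b * v x) < \<infinity>"
  using weighted_Lp_int_lincomb_finite [of "indicator A" lebesgue u v p a b] assms
  by (simp add: Lp_int_eq_weighted)

text \<open>Only integrability is at stake, so the pointwise Young inequality does the work of
  Hoelder's.\<close>

lemma set_integrable_mult_conjugate:
  fixes f v :: "'a::euclidean_space \<Rightarrow> real"
  assumes A: "A \<in> sets lebesgue" and p: "1 < p"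
    and f: "f \<in> borel_measurable lebesgue" "Lp_int (p / (p - 1)) A f < \<infinity>"
    and v: "v \<in> borel_measurable lebesgue" "Lp_int p A v < \<infinity>"
  shows "set_integrable lebesgue A (\<lambda>x. f x * v x)"
  unfolding set_integrable_def
proof (rule integrableI_bounded)
  note [measurable] = A f(1) v(1)
  show "(\<lambda>x. indicat_real A x *\<^sub>R (f x * v x)) \<in> borel_measurable lebesgue" by measurable
  have "(\<integral>\<^sup>+ x. ennreal (norm (indicat_real A x *\<^sub>R (f x * v x))) \<partial>lebesgue)
    \<le> (\<integral>\<^sup>+ x. ennreal (\<bar>f x\<bar> powr (p / (p - 1))) * indicator A x + ennreal (\<bar>v x\<bar> powr p) * indicator A x \<partial>lebesgue)"
    using mult_le_powr_conjugate [OF _ _ p, of "\<bar>f x\<bar>" "\<bar>v x\<bar>" for x]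
    by (intro nn_integral_mono) (auto simp: indicator_def abs_mult simp flip: ennreal_plus)
  also have "\<dots> = Lp_int (p / (p - 1)) A f + Lp_int p A v"
    unfolding Lp_int_def by (intro nn_integral_add) auto
  also have "\<dots> < \<infinity>" using f v by simp
  finally show "(\<integral>\<^sup>+ x. ennreal (norm (indicat_real A x *\<^sub>R (f x * v x))) \<partial>lebesgue) < \<infinity>" .
qed

lemma pairing_lincomb:
  fixes f v w :: "'a::euclidean_space \<Rightarrow> real"
  assumes A: "A \<in> sets lebesgue" and p: "1 < p"
    and f: "f \<in> borel_measurable lebesgue" "Lp_int (p / (p - 1)) A f < \<infinity>"
    and v: "v \<in> borel_measurable lebesgue" "Lp_int p A v < \<infinity>"
    and w: "w \<in> borel_measurable lebesgue" "Lp_int p A w < \<infinity>"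
  shows "(LINT x:A|lebesgue. f x * (\<alpha> * v x + \<beta> * w x))
      = \<alpha> * (LINT x:A|lebesgue. f x * v x) + \<beta> * (LINT x:A|lebesgue. f x * w x)"
proof -
  note int = set_integrable_mult_conjugate [OF A p f v] set_integrable_mult_conjugate [OF A p f w]
  have "(\<lambda>x. f x * (\<alpha> * v x + \<beta> * w x)) = (\<lambda>x. \<alpha> * (f x * v x) + \<beta> * (f x * w x))"
    by (auto simp: algebra_simps)
  then show ?thesis using int by (simp add: set_integral_add)
qed

lemma continuous_imp_lebesgue_measurable:
  fixes f :: "'a::euclidean_space \<Rightarrow> 'b::euclidean_space"
  assumes "continuous_on UNIV f" shows "f \<in> borel_measurable lebesgue"
  using borel_measurable_continuous_onI [OF assms] by (intro measurable_completion) auto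

lemma bounded_imp_finite_lebesgue:
  fixes A :: "'a::euclidean_space set"
  assumes "bounded A" "A \<in> sets lebesgue"
  obtains m where "emeasure lebesgue A = ennreal m" "0 \<le> m"
proof -
  have "emeasure lebesgue A \<noteq> top"
    using bounded_set_imp_lmeasurable [OF assms] by (rule fmeasurableD2)
  then show thesis using that by (cases "emeasure lebesgue A") auto
qed

text \<open>For Tonelli on pairs of points. A countable cover for \<open>lborel\<close> serves,
  since completion leaves the measure of Borel sets unchanged.\<close>

lemma sigma_finite_lebesgue: "sigma_finite_measure (lebesgue :: 'a::euclidean_space measure)"
proof
  from lborel.sigma_finite_countable obtain A :: "'a set set" where
    A: "countable A" "A \<subseteq> sets lborel" "\<Union>A = space lborel" "\<forall>a\<in>A. emeasure lborel a \<noteq> \<infinity>"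
    by blast
  then have "\<forall>a\<in>A. emeasure lebesgue a = emeasure lborel a" by auto
  with A show "\<exists>A::'a set set. countable A \<and> A \<subseteq> sets lebesgue \<and> \<Union> A = space lebesgue \<and> (\<forall>a\<in>A. emeasure lebesgue a \<noteq> \<infinity>)"
    by (intro exI [of _ A]) auto
qed

text \<open>The factor \<open>\<delta> powr p\<close> of the difference quotient is moved into the
  weight. The operator is then the plain difference u(x) - u(y), the same for all horizons, and
  horizons are compared through weights alone.\<close>

definition nl_weight :: "real \<Rightarrow> (real \<Rightarrow> real) \<Rightarrow> 'a::euclidean_space set \<Rightarrow> real \<Rightarrow> 'a \<times> 'a \<Rightarrow> ennreal" where
  "nl_weight p \<rho> \<Omega> \<delta> z = indicator (ext_dom \<Omega> \<delta>) (fst z) * indicator (ext_dom \<Omega> \<delta>) (snd z) *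
     ennreal (rho_delta TYPE('a) \<rho> \<delta> (dist (fst z) (snd z)) / \<delta> powr p)"

lemma closed_interaction_cover: "closed {x. infdist x A \<le> d}"
  by (intro closed_Collect_le continuous_intros)

lemma ext_dom_sets [measurable]:
  assumes "open \<Omega>" shows "ext_dom \<Omega> \<delta> \<in> sets lebesgue"
proof -
  have "ext_dom \<Omega> \<delta> = \<Omega> \<union> ({x. infdist x (frontier \<Omega>) \<le> \<delta>} - \<Omega>)"
    by (auto simp: ext_dom_def interaction_dom_def)
  then show ?thesis
    using assms closed_interaction_cover [of "frontier \<Omega>" \<delta>] by (auto intro!: sets_completionI_sets)
qed

lemma bounded_ext_dom:
  assumes "\<Omega> \<noteq> {}" "bounded \<Omega>" shows "bounded (ext_dom \<Omega> \<delta>)"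
proof -
  \<comment> \<open>\<open>infdist\<close> to an empty frontier would be 0, and the collar would
    contain everything outside the domain.\<close>
  have fne: "frontier \<Omega> \<noteq> {}"
    using assms frontier_eq_empty not_bounded_UNIV by blast
  have bf: "bounded (frontier \<Omega>)"
    using assms by (auto simp: frontier_def intro: bounded_subset)
  obtain R where R: "\<And>y. y \<in> frontier \<Omega> \<Longrightarrow> norm y \<le> R" using bf by (auto simp: bounded_iff)
  have "norm x \<le> R + (\<delta> + 1)" if x: "infdist x (frontier \<Omega>) \<le> \<delta>" for x
  proof -
    obtain y where y: "y \<in> frontier \<Omega>" "infdist x (frontier \<Omega>) = dist x y"
      using infdist_attains_inf [OF frontier_closed fne, of x] by blast
    then have "norm x \<le> norm y + dist x y" by (simp add: dist_norm norm_triangle_sub)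
    then show ?thesis using R [OF y(1)] y(2) x by linarith
  qed
  then have "bounded {x. infdist x (frontier \<Omega>) \<le> \<delta>}" by (auto simp: bounded_iff)
  then show ?thesis
    using assms by (auto simp: ext_dom_def interaction_dom_def intro: bounded_subset)
qed

lemma measurable_lebesgue_borel_id [measurable]: "(\<lambda>x. x) \<in> lebesgue \<rightarrow>\<^sub>M borel"
  by (intro measurable_completion) auto

lemma nl_weight_measurable:
  fixes \<Omega> :: "'a::euclidean_space set"
  assumes "open \<Omega>" and [measurable]: "\<rho> \<in> borel_measurable borel"
  shows "nl_weight p \<rho> \<Omega> \<delta> \<in> borel_measurable (lebesgue \<Otimes>\<^sub>M lebesgue)"
proof -
  note [measurable] = ext_dom_sets [OF assms(1), of \<delta>]
  have [measurable]: "fst \<in> (lebesgue \<Otimes>\<^sub>M lebesgue) \<rightarrow>\<^sub>M (borel :: 'a measure)"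
      "snd \<in> (lebesgue \<Otimes>\<^sub>M lebesgue) \<rightarrow>\<^sub>M (borel :: 'a measure)"
    using measurable_compose [OF measurable_fst measurable_lebesgue_borel_id]
      measurable_compose [OF measurable_snd measurable_lebesgue_borel_id] by auto
  show ?thesis unfolding nl_weight_def rho_delta_def by measurable
qed

lemma nl_semi_p_eq_weighted:
  fixes \<Omega> :: "'a::euclidean_space set"
  assumes op: "open \<Omega>" and \<rho> [measurable]: "\<rho> \<in> borel_measurable borel" and \<rho>0: "\<And>t. 0 \<le> \<rho> t"
    and \<delta>: "0 < \<delta>" and u [measurable]: "u \<in> borel_measurable lebesgue"
  shows "nl_semi_p p \<rho> \<Omega> \<delta> u
    = weighted_Lp_int p (lebesgue \<Otimes>\<^sub>M lebesgue) (nl_weight p \<rho> \<Omega> \<delta>) (\<lambda>z. u (fst z) - u (snd z))"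
proof -
  interpret sigma_finite_measure "lebesgue :: 'a measure" by (rule sigma_finite_lebesgue)
  note [measurable] = nl_weight_measurable [OF op \<rho>]
  have eq: "(\<integral>\<^sup>+ y\<in>ext_dom \<Omega> \<delta>. ennreal (rho_delta TYPE('a) \<rho> \<delta> (dist x y) * \<bar>(u x - u y) / \<delta>\<bar> powr p) \<partial>lebesgue)
      * indicator (ext_dom \<Omega> \<delta>) x
      = (\<integral>\<^sup>+ y. nl_weight p \<rho> \<Omega> \<delta> (x, y) * ennreal (norm (u x - u y) powr p) \<partial>lebesgue)" for x
  proof (cases "x \<in> ext_dom \<Omega> \<delta>")
    case True
    then show ?thesis
      using \<rho>0 \<delta> unfolding nl_weight_def rho_delta_def
      by (auto intro!: nn_integral_cong simp: powr_divide simp flip: ennreal_mult split: split_indicator)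
  qed (simp add: nl_weight_def)
  have "nl_semi_p p \<rho> \<Omega> \<delta> u =
    (\<integral>\<^sup>+ x. (\<integral>\<^sup>+ y. nl_weight p \<rho> \<Omega> \<delta> (x, y) * ennreal (norm (u x - u y) powr p) \<partial>lebesgue) \<partial>lebesgue)"
    unfolding nl_semi_p_def eq ..
  also have "\<dots> = (\<integral>\<^sup>+ z. nl_weight p \<rho> \<Omega> \<delta> z * ennreal (norm (u (fst z) - u (snd z)) powr p) \<partial>(lebesgue \<Otimes>\<^sub>M lebesgue))"
    by (subst nn_integral_fst [symmetric]) auto
  finally show ?thesis by (simp add: weighted_Lp_int_def)
qed

text \<open>At a fixed horizon the kernel is bounded, so no cancellation in u(x) - u(y) is needed:
  the p-th power is split into two terms, each integrated over the bounded extended domain. The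
  constant depends on the horizon.\<close>

lemma nl_semi_p_le_Lp_int:
  fixes \<Omega> :: "'a::euclidean_space set"
  assumes dom: "\<Omega> \<noteq> {}" "open \<Omega>" "bounded \<Omega>" and \<rho>: "\<And>t. 0 \<le> \<rho> t" "\<And>t. \<rho> t \<le> M"
    and \<delta>: "0 < \<delta>" and p: "0 \<le> p"
  obtains C where "0 \<le> C" "\<And>u. u \<in> borel_measurable lebesgue \<Longrightarrow> (\<And>x. x \<notin> \<Omega> \<Longrightarrow> u x = 0) \<Longrightarrow>
     nl_semi_p p \<rho> \<Omega> \<delta> u \<le> ennreal C * Lp_int p \<Omega> u"
proof -
  let ?A = "ext_dom \<Omega> \<delta>"
  note [measurable] = ext_dom_sets [OF dom(2), of \<delta>]
  obtain m where m: "emeasure lebesgue ?A = ennreal m" "0 \<le> m"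
    using bounded_imp_finite_lebesgue [OF bounded_ext_dom [OF dom(1,3)] ext_dom_sets [OF dom(2)]] by blast
  have M: "0 \<le> M" using \<rho> [of 0] by linarith
  define B where "B = M / \<delta> ^ DIM('a) / \<delta> powr p * 2 powr p"
  have B: "0 \<le> B" using M \<delta> by (simp add: B_def)
  show thesis
  proof (rule that)
    show "0 \<le> 2 * B * m" using B m by simp
    fix u :: "'a \<Rightarrow> real"
    assume u [measurable]: "u \<in> borel_measurable lebesgue" and u0: "\<And>x. x \<notin> \<Omega> \<Longrightarrow> u x = 0"
    define a where "a x = ennreal (\<bar>u x\<bar> powr p)" for x
    have [measurable]: "a \<in> borel_measurable lebesgue" by (simp add: a_def [abs_def])
    have S: "(\<integral>\<^sup>+x. a x * indicator ?A x \<partial>lebesgue) = Lp_int p \<Omega> u"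
      unfolding Lp_int_def a_def using u0
      by (intro nn_integral_cong) (auto simp: ext_dom_def split: split_indicator)
    have pw: "ennreal (rho_delta TYPE('a) \<rho> \<delta> (dist x y) * \<bar>(u x - u y) / \<delta>\<bar> powr p) \<le> ennreal B * (a x + a y)" for x y
    proof -
      have "\<bar>u x - u y\<bar> powr p \<le> (\<bar>u x\<bar> + \<bar>u y\<bar>) powr p" using p by (intro powr_mono2) auto
      also have "\<dots> \<le> 2 powr p * (\<bar>u x\<bar> powr p + \<bar>u y\<bar> powr p)" using p by (intro powr_add_le_two_powr) auto
      finally have "rho_delta TYPE('a) \<rho> \<delta> (dist x y) * (\<bar>u x - u y\<bar> powr p / \<delta> powr p)
          \<le> (M / \<delta> ^ DIM('a)) * (2 powr p * (\<bar>u x\<bar> powr p + \<bar>u y\<bar> powr p) / \<delta> powr p)"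
        unfolding rho_delta_def using \<rho> M \<delta> by (intro mult_mono divide_right_mono) auto
      then have "rho_delta TYPE('a) \<rho> \<delta> (dist x y) * \<bar>(u x - u y) / \<delta>\<bar> powr p \<le> B * (\<bar>u x\<bar> powr p + \<bar>u y\<bar> powr p)"
        using \<delta> by (simp add: B_def powr_divide mult_ac)
      then show ?thesis unfolding a_def using B by (simp flip: ennreal_plus ennreal_mult add: ennreal_leI)
    qed
    have inner: "(\<integral>\<^sup>+ y\<in>?A. ennreal B * (a x + a y) \<partial>lebesgue) = ennreal B * (a x * m + Lp_int p \<Omega> u)" for x
    proof -
      have "(\<integral>\<^sup>+ y\<in>?A. ennreal B * (a x + a y) \<partial>lebesgue)
          = (\<integral>\<^sup>+ y. ennreal B * (a x * indicator ?A y + a y * indicator ?A y) \<partial>lebesgue)"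
        by (intro nn_integral_cong) (auto simp: algebra_simps)
      also have "\<dots> = ennreal B * (a x * m + Lp_int p \<Omega> u)"
        by (simp add: nn_integral_cmult nn_integral_add S m nn_integral_cmult_indicator)
      finally show ?thesis .
    qed
    have "nl_semi_p p \<rho> \<Omega> \<delta> u \<le> (\<integral>\<^sup>+ x\<in>?A. (\<integral>\<^sup>+ y\<in>?A. ennreal B * (a x + a y) \<partial>lebesgue) \<partial>lebesgue)"
      unfolding nl_semi_p_def by (intro nn_integral_mono mult_right_mono pw) auto
    also have "\<dots> = (\<integral>\<^sup>+ x. ennreal B * (m * (a x * indicator ?A x) + Lp_int p \<Omega> u * indicator ?A x) \<partial>lebesgue)"
      unfolding inner by (intro nn_integral_cong) (auto simp: algebra_simps)
    also have "\<dots> = ennreal B * (m * Lp_int p \<Omega> u + Lp_int p \<Omega> u * m)"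
      by (simp add: nn_integral_cmult nn_integral_add S m nn_integral_cmult_indicator)
    also have "\<dots> = ennreal (2 * B * m) * Lp_int p \<Omega> u"
      using B m by (simp add: ennreal_mult mult_ac mult_2 distrib_left flip: ennreal_plus)
    finally show "nl_semi_p p \<rho> \<Omega> \<delta> u \<le> ennreal (2 * B * m) * Lp_int p \<Omega> u" .
  qed
qed

text \<open>A larger horizon lowers the argument of the nonincreasing kernel and enlarges the domain
  of integration; the factor only undoes the normalizations \<open>\<delta> ^ DIM('a)\<close> and
  \<open>\<delta> powr p\<close>.\<close>

lemma nl_semi_p_mono_horizon:
  fixes \<Omega> :: "'a::euclidean_space set"
  assumes op: "open \<Omega>" and ker: "admissible_kernel TYPE('a) p \<rho>" and p: "0 \<le> p"
    and \<delta>: "0 < \<delta>" "\<delta> \<le> \<delta>'" and u [measurable]: "u \<in> borel_measurable lebesgue"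
  shows "nl_semi_p p \<rho> \<Omega> \<delta> u \<le> ennreal ((\<delta>' / \<delta>) ^ DIM('a) * (\<delta>' / \<delta>) powr p) * nl_semi_p p \<rho> \<Omega> \<delta>' u"
proof -
  from ker obtain r where \<rho>m: "\<rho> \<in> borel_measurable borel" and \<rho>0: "\<And>t. 0 \<le> \<rho> t"
    and r: "r < 1" "\<And>t. r < \<bar>t\<bar> \<Longrightarrow> \<rho> t = 0"
    and mono: "\<And>s t. 0 \<le> s \<Longrightarrow> s \<le> t \<Longrightarrow> t < 1 \<Longrightarrow> \<rho> t \<le> \<rho> s"
    unfolding admissible_kernel_def by metis
  have \<delta>': "0 < \<delta>'" using \<delta> by simp
  let ?c = "(\<delta>' / \<delta>) ^ DIM('a) * (\<delta>' / \<delta>) powr p"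
  have sub: "ext_dom \<Omega> \<delta> \<subseteq> ext_dom \<Omega> \<delta>'"
    using \<delta> by (auto simp: ext_dom_def interaction_dom_def)
  show ?thesis
    unfolding nl_semi_p_eq_weighted [OF op \<rho>m \<rho>0 \<delta>(1) u] nl_semi_p_eq_weighted [OF op \<rho>m \<rho>0 \<delta>' u]
  proof (rule weighted_Lp_int_weight_mono)
    fix z :: "'a \<times> 'a"
    let ?d = "dist (fst z) (snd z)"
    have "\<rho> (?d / \<delta>) \<le> \<rho> (?d / \<delta>')"
    proof (cases "?d / \<delta> < 1")
      case True
      then show ?thesis using \<delta> by (intro mono) (auto intro!: divide_left_mono)
    next
      \<comment> \<open>Monotonicity of the kernel is granted only on [0, 1); from 1 on, its compact
        support in (-1, 1) makes the left side 0.\<close>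
      case False
      then have "1 \<le> ?d / \<delta>" by simp
      then have "r < \<bar>?d / \<delta>\<bar>" using r(1) by linarith
      then have "\<rho> (?d / \<delta>) = 0" by (rule r(2))
      then show ?thesis using \<rho>0 by simp
    qed
    then have "\<rho> (?d / \<delta>) / \<delta> ^ DIM('a) / \<delta> powr p \<le> \<rho> (?d / \<delta>') / \<delta> ^ DIM('a) / \<delta> powr p"
      using \<delta> by (intro divide_right_mono) auto
    also have "\<dots> = ?c * (\<rho> (?d / \<delta>') / \<delta>' ^ DIM('a) / \<delta>' powr p)"
      using \<delta> by (simp add: power_divide powr_divide)
    finally have "ennreal (rho_delta TYPE('a) \<rho> \<delta> ?d / \<delta> powr p)
        \<le> ennreal ?c * ennreal (rho_delta TYPE('a) \<rho> \<delta>' ?d / \<delta>' powr p)"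
      unfolding rho_delta_def using \<delta> \<rho>0 by (subst ennreal_mult [symmetric]) (auto intro!: ennreal_leI)
    then show "nl_weight p \<rho> \<Omega> \<delta> z \<le> ennreal ?c * nl_weight p \<rho> \<Omega> \<delta>' z"
      unfolding nl_weight_def using sub by (auto split: split_indicator)
  qed (use nl_weight_measurable [OF op \<rho>m] in auto)
qed

section \<open>The nonlocal problem\<close>

text \<open>The right-hand side does not mention the horizon, so the spaces \<open>S0\<close>
  coincide for all positive horizons.\<close>

lemma S0_iff:
  fixes \<Omega> :: "'a::euclidean_space set"
  assumes dom: "piecewise_flat_domain \<Omega>" and ker: "admissible_kernel TYPE('a) p \<rho>"
    and p: "0 \<le> p" and \<delta>: "0 < \<delta>"
  shows "u \<in> S0 p \<rho> \<Omega> \<delta> \<longleftrightarrow>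
    u \<in> borel_measurable lebesgue \<and> Lp_int p \<Omega> u < \<infinity> \<and> (\<forall>x. x \<notin> \<Omega> \<longrightarrow> u x = 0)"
proof -
  have D: "\<Omega> \<noteq> {}" "open \<Omega>" "bounded \<Omega>" using dom by (auto simp: piecewise_flat_domain_def)
  obtain M where \<rho>: "\<And>t. 0 \<le> \<rho> t" "\<And>t. \<rho> t \<le> M"
    using ker unfolding admissible_kernel_def by (metis abs_le_D1)
  obtain C where C: "0 \<le> C" "\<And>u. u \<in> borel_measurable lebesgue \<Longrightarrow> (\<And>x. x \<notin> \<Omega> \<Longrightarrow> u x = 0) \<Longrightarrow>
     nl_semi_p p \<rho> \<Omega> \<delta> u \<le> ennreal C * Lp_int p \<Omega> u"
    by (rule nl_semi_p_le_Lp_int [where M = M and \<rho> = \<rho>, OF D \<rho> \<delta> p]) (rule that; blast)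
  have eq: "Lp_int p (ext_dom \<Omega> \<delta>) u = Lp_int p \<Omega> u" if "\<forall>x. x \<notin> \<Omega> \<longrightarrow> u x = 0"
    unfolding Lp_int_def using that
    by (intro nn_integral_cong) (auto simp: ext_dom_def split: split_indicator)
  have "nl_semi_p p \<rho> \<Omega> \<delta> u < \<infinity>"
    if "u \<in> borel_measurable lebesgue" "Lp_int p \<Omega> u < \<infinity>" "\<forall>x. x \<notin> \<Omega> \<longrightarrow> u x = 0"
    using that by (intro le_less_trans [OF C(2)]) (auto simp: ennreal_mult_less_top)
  then show ?thesis by (auto simp: S0_def in_Lp_def eq)
qed

lemma S0_lincomb:
  fixes \<Omega> :: "'a::euclidean_space set"
  assumes "piecewise_flat_domain \<Omega>" "admissible_kernel TYPE('a) p \<rho>" "0 \<le> p" "0 < \<delta>"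
    and "v \<in> S0 p \<rho> \<Omega> \<delta>" "w \<in> S0 p \<rho> \<Omega> \<delta>"
  shows "(\<lambda>x. \<alpha> * v x + \<beta> * w x) \<in> S0 p \<rho> \<Omega> \<delta>"
proof -
  have "\<Omega> \<in> sets lebesgue" using assms(1) by (auto simp: piecewise_flat_domain_def)
  with assms(3,5,6) show ?thesis
    unfolding S0_iff [OF assms(1-4)] by (intro conjI Lp_int_lincomb_finite) auto
qed

lemma poincare_threshold_bound:
  fixes \<Omega> :: "'a::euclidean_space set"
  assumes "poincare_threshold p \<rho> \<Omega> \<delta>\<^sub>0" "0 < \<delta>" "\<delta> < \<delta>\<^sub>0" "0 < p"
  obtains C where "0 \<le> C"
    "\<And>u. u \<in> S0 p \<rho> \<Omega> \<delta> \<Longrightarrow> enn2real (Lp_int p \<Omega> u) \<le> C * enn2real (nl_semi_p p \<rho> \<Omega> \<delta> u)"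
proof -
  obtain C where C: "\<And>u. u \<in> S0 p \<rho> \<Omega> \<delta> \<Longrightarrow>
      enn2real (Lp_int p \<Omega> u) powr (1/p) \<le> C * enn2real (nl_semi_p p \<rho> \<Omega> \<delta> u) powr (1/p)"
    using assms unfolding poincare_threshold_def by blast
  show thesis
  proof (rule that)
    \<comment> \<open>The constant of \<open>poincare_threshold\<close> comes without a sign, hence
      the absolute value.\<close>
    show "0 \<le> \<bar>C\<bar> powr p" by simp
    fix u assume "u \<in> S0 p \<rho> \<Omega> \<delta>"
    let ?l = "enn2real (Lp_int p \<Omega> u)" and ?s = "enn2real (nl_semi_p p \<rho> \<Omega> \<delta> u)"
    have "?l powr (1/p) \<le> C * ?s powr (1/p)" by (rule C) fact
    also have "\<dots> \<le> \<bar>C\<bar> * ?s powr (1/p)" by (intro mult_right_mono) auto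
    finally have "(?l powr (1/p)) powr p \<le> (\<bar>C\<bar> * ?s powr (1/p)) powr p"
      using assms by (intro powr_mono2) auto
    then show "?l \<le> \<bar>C\<bar> powr p * ?s"
      using assms by (simp add: powr_mult powr_powr)
  qed
qed

text \<open>\<open>\<delta>\<close> is the horizon of the norm and \<open>\<delta>'\<close> that of
  the energy. Coercivity brings both parts of the norm to \<open>\<delta>'\<close> by monotonicity.
  The upper bound involves \<open>Lp_int\<close> alone, the form that the density argument
  uses.\<close>

lemma nonlocal_norm_equivalences:
  fixes \<Omega> :: "'a::euclidean_space set"
  assumes p: "2 \<le> p" and dom: "piecewise_flat_domain \<Omega>" and ker: "admissible_kernel TYPE('a) p \<rho>"
    and \<delta>\<^sub>0: "poincare_threshold p \<rho> \<Omega> \<delta>\<^sub>0" and \<delta>: "0 < \<delta>" "\<delta> \<le> \<delta>\<^sub>0" "\<delta> \<le> \<delta>'"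
  obtains c C where "0 < c" "0 < C"
    "\<And>v. v \<in> S0 p \<rho> \<Omega> \<delta> \<Longrightarrow> c * (enn2real (Lp_int p \<Omega> v) + enn2real (nl_semi_p p \<rho> \<Omega> \<delta> v))
        \<le> enn2real (nl_semi_p p \<rho> \<Omega> \<delta>' v)"
    "\<And>v. v \<in> S0 p \<rho> \<Omega> \<delta> \<Longrightarrow> nl_semi_p p \<rho> \<Omega> \<delta>' v < \<infinity>"
    "\<And>v. v \<in> S0 p \<rho> \<Omega> \<delta> \<Longrightarrow> enn2real (nl_semi_p p \<rho> \<Omega> \<delta>' v) \<le> C * enn2real (Lp_int p \<Omega> v)"
proof -
  have D: "\<Omega> \<noteq> {}" "open \<Omega>" "bounded \<Omega>" using dom by (auto simp: piecewise_flat_domain_def)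
  have p0: "0 \<le> p" "0 < p" using p by auto
  have \<delta>': "0 < \<delta>'" using \<delta> by simp
  obtain M where \<rho>: "\<And>t. 0 \<le> \<rho> t" "\<And>t. \<rho> t \<le> M"
    using ker unfolding admissible_kernel_def by (metis abs_le_D1)
  obtain C where C: "0 \<le> C" "\<And>u. u \<in> borel_measurable lebesgue \<Longrightarrow> (\<And>x. x \<notin> \<Omega> \<Longrightarrow> u x = 0) \<Longrightarrow>
     nl_semi_p p \<rho> \<Omega> \<delta>' u \<le> ennreal C * Lp_int p \<Omega> u"
    by (rule nl_semi_p_le_Lp_int [where M = M and \<rho> = \<rho>, OF D \<rho> \<delta>' p0(1)]) (rule that; blast)
  note S0 = S0_iff [OF dom ker p0(1) \<delta>(1)]
  have fin: "nl_semi_p p \<rho> \<Omega> \<delta>' v < \<infinity>" if "v \<in> S0 p \<rho> \<Omega> \<delta>" for v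
    using that unfolding S0 by (intro le_less_trans [OF C(2)]) (auto simp: ennreal_mult_less_top)
  have upper: "enn2real (nl_semi_p p \<rho> \<Omega> \<delta>' v) \<le> (C + 1) * enn2real (Lp_int p \<Omega> v)"
    if "v \<in> S0 p \<rho> \<Omega> \<delta>" for v
  proof -
    have "enn2real (nl_semi_p p \<rho> \<Omega> \<delta>' v) \<le> enn2real (ennreal C * Lp_int p \<Omega> v)"
      using that unfolding S0 by (intro enn2real_mono C(2)) (auto simp: ennreal_mult_less_top)
    also have "\<dots> \<le> (C + 1) * enn2real (Lp_int p \<Omega> v)"
      using C(1) by (simp add: enn2real_mult mult_right_mono)
    finally show ?thesis .
  qed
  have mono: "\<exists>c\<ge>0. \<forall>v\<in>S0 p \<rho> \<Omega> \<delta>. enn2real (nl_semi_p p \<rho> \<Omega> \<gamma> v) \<le> c * enn2real (nl_semi_p p \<rho> \<Omega> \<delta>' v)"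
    if \<gamma>: "0 < \<gamma>" "\<gamma> \<le> \<delta>'" for \<gamma>
  proof (intro exI conjI ballI)
    let ?c = "(\<delta>' / \<gamma>) ^ DIM('a) * (\<delta>' / \<gamma>) powr p"
    show "0 \<le> ?c" using \<gamma> by auto
    fix v assume v: "v \<in> S0 p \<rho> \<Omega> \<delta>"
    then have "nl_semi_p p \<rho> \<Omega> \<gamma> v \<le> ennreal ?c * nl_semi_p p \<rho> \<Omega> \<delta>' v"
      unfolding S0 by (intro nl_semi_p_mono_horizon [OF D(2) ker p0(1) \<gamma>]) auto
    then have "enn2real (nl_semi_p p \<rho> \<Omega> \<gamma> v) \<le> enn2real (ennreal ?c * nl_semi_p p \<rho> \<Omega> \<delta>' v)"
      using fin [OF v] by (intro enn2real_mono) (auto simp: ennreal_mult_less_top)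
    then show "enn2real (nl_semi_p p \<rho> \<Omega> \<gamma> v) \<le> ?c * enn2real (nl_semi_p p \<rho> \<Omega> \<delta>' v)"
      using \<open>0 \<le> ?c\<close> by (simp only: enn2real_mult enn2real_ennreal)
  qed
  obtain c1 where c1: "0 \<le> c1"
    "\<And>v. v \<in> S0 p \<rho> \<Omega> \<delta> \<Longrightarrow> enn2real (nl_semi_p p \<rho> \<Omega> \<delta> v) \<le> c1 * enn2real (nl_semi_p p \<rho> \<Omega> \<delta>' v)"
    using mono [OF \<delta>(1,3)] by blast
  \<comment> \<open>The Poincare inequality is granted strictly below
    \<open>\<delta>\<^sub>0\<close>, which \<open>\<delta>\<close> may equal; half the horizon is
    admissible and has the same space \<open>S0\<close>.\<close>
  obtain c2 where c2: "0 \<le> c2"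
    "\<And>v. v \<in> S0 p \<rho> \<Omega> \<delta> \<Longrightarrow> enn2real (nl_semi_p p \<rho> \<Omega> (\<delta>/2) v) \<le> c2 * enn2real (nl_semi_p p \<rho> \<Omega> \<delta>' v)"
    using mono [of "\<delta>/2"] \<delta> by auto
  obtain P where P: "0 \<le> P" "\<And>u. u \<in> S0 p \<rho> \<Omega> (\<delta>/2) \<Longrightarrow>
      enn2real (Lp_int p \<Omega> u) \<le> P * enn2real (nl_semi_p p \<rho> \<Omega> (\<delta>/2) u)"
    using poincare_threshold_bound [OF \<delta>\<^sub>0, of "\<delta>/2"] \<delta> p0 by auto
  have same: "S0 p \<rho> \<Omega> (\<delta>/2) = S0 p \<rho> \<Omega> \<delta>"
    using S0_iff [OF dom ker p0(1)] \<delta>(1) by auto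
  show thesis
  proof (rule that)
    show "0 < 1 / (1 + P * c2 + c1)" "0 < C + 1" using P c1 c2 C by (auto intro!: divide_pos_pos add_pos_nonneg)
    fix v assume v: "v \<in> S0 p \<rho> \<Omega> \<delta>"
    let ?J = "enn2real (nl_semi_p p \<rho> \<Omega> \<delta>' v)"
    have "enn2real (Lp_int p \<Omega> v) \<le> P * (c2 * ?J)"
      using P(2) [of v] c2(2) [OF v] v same P(1) mult_left_mono order_trans by blast
    then have "enn2real (Lp_int p \<Omega> v) + enn2real (nl_semi_p p \<rho> \<Omega> \<delta> v) \<le> P * (c2 * ?J) + c1 * ?J"
      using c1(2) [OF v] by simp
    also have "\<dots> \<le> (1 + P * c2 + c1) * ?J" by (simp add: algebra_simps)
    finally show "1 / (1 + P * c2 + c1) * (enn2real (Lp_int p \<Omega> v) + enn2real (nl_semi_p p \<rho> \<Omega> \<delta> v)) \<le> ?J"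
      using P(1) c1(1) c2(1) by (simp add: divide_le_eq mult_ac add_pos_nonneg)
  qed (use fin upper in auto)
qed

lemma cea_nonlocal:
  fixes \<Omega> :: "'a::euclidean_space set"
  assumes p: "2 \<le> p" and dom: "piecewise_flat_domain \<Omega>" and ker: "admissible_kernel TYPE('a) p \<rho>"
    and \<delta>\<^sub>0: "poincare_threshold p \<rho> \<Omega> \<delta>\<^sub>0" and \<delta>: "0 < \<delta>" "\<delta> \<le> \<delta>\<^sub>0" "\<delta> \<le> \<delta>'"
    and f: "f \<in> borel_measurable lebesgue" "Lp_int (p / (p - 1)) \<Omega> f < \<infinity>"
    and E: "\<And>v. E v = (1/p) * enn2real (nl_semi_p p \<rho> \<Omega> \<delta>' v) - (LINT x:\<Omega>|lebesgue. f x * v x)"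
    and u: "is_minimizer E (S0 p \<rho> \<Omega> \<delta>) u"
  obtains C where "0 < C"
    "\<And>V uh v. V \<subseteq> S0 p \<rho> \<Omega> \<delta> \<Longrightarrow> (\<lambda>_. 0) \<in> V \<Longrightarrow> is_minimizer E V uh \<Longrightarrow> v \<in> V \<Longrightarrow>
       (enn2real (Lp_int p \<Omega> (\<lambda>x. uh x - u x)) + enn2real (nl_semi_p p \<rho> \<Omega> \<delta> (\<lambda>x. uh x - u x))) powr (1/p)
       \<le> C * ((enn2real (Lp_int p \<Omega> (\<lambda>x. v x - u x)) +
               enn2real (nl_semi_p p \<rho> \<Omega> \<delta> (\<lambda>x. v x - u x))) powr (1/p)) powr (2 / p)"
proof -
  have D: "\<Omega> \<noteq> {}" "open \<Omega>" "bounded \<Omega>" "\<Omega> \<in> sets lebesgue"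
    using dom by (auto simp: piecewise_flat_domain_def)
  have p0: "0 \<le> p" "1 < p" using p by auto
  have \<delta>': "0 < \<delta>'" using \<delta> by simp
  have \<rho>: "\<rho> \<in> borel_measurable borel" "\<And>t. 0 \<le> \<rho> t"
    using ker by (auto simp: admissible_kernel_def)
  note S0 = S0_iff [OF dom ker p0(1) \<delta>(1)]
  obtain c C where cC: "0 < c" "0 < C"
    "\<And>v. v \<in> S0 p \<rho> \<Omega> \<delta> \<Longrightarrow> c * (enn2real (Lp_int p \<Omega> v) + enn2real (nl_semi_p p \<rho> \<Omega> \<delta> v))
        \<le> enn2real (nl_semi_p p \<rho> \<Omega> \<delta>' v)"
    and fin: "\<And>v. v \<in> S0 p \<rho> \<Omega> \<delta> \<Longrightarrow> nl_semi_p p \<rho> \<Omega> \<delta>' v < \<infinity>"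
    and C: "\<And>v. v \<in> S0 p \<rho> \<Omega> \<delta> \<Longrightarrow> enn2real (nl_semi_p p \<rho> \<Omega> \<delta>' v) \<le> C * enn2real (Lp_int p \<Omega> v)"
    by (rule nonlocal_norm_equivalences [OF p dom ker \<delta>\<^sub>0 \<delta>]) (rule that; blast)
  note eq = nl_semi_p_eq_weighted [OF D(2) \<rho> \<delta>', of _ p]
  show thesis
  proof (rule cea_estimate_weighted [where E = E and T = "S0 p \<rho> \<Omega> \<delta>" and p = p
        and I = "\<lambda>v. enn2real (nl_semi_p p \<rho> \<Omega> \<delta>' v)" and L = "\<lambda>v. LINT x:\<Omega>|lebesgue. f x * v x"
        and X = "\<lambda>v. enn2real (Lp_int p \<Omega> v) + enn2real (nl_semi_p p \<rho> \<Omega> \<delta> v)"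
        and M = "lebesgue \<Otimes>\<^sub>M lebesgue" and W = "nl_weight p \<rho> \<Omega> \<delta>'"
        and D = "\<lambda>v z. v (fst z) - v (snd z)" and u = u and ?c1.0 = c and ?c2.0 = C])
    fix v assume v: "v \<in> S0 p \<rho> \<Omega> \<delta>"
    then have [measurable]: "v \<in> borel_measurable lebesgue" unfolding S0 by simp
    show "(\<lambda>z. v (fst z) - v (snd z)) \<in> borel_measurable (lebesgue \<Otimes>\<^sub>M lebesgue)" by measurable
    show "weighted_Lp_int p (lebesgue \<Otimes>\<^sub>M lebesgue) (nl_weight p \<rho> \<Omega> \<delta>') (\<lambda>z. v (fst z) - v (snd z)) < \<infinity>"
      using fin [OF v] by (simp add: eq)
    show "enn2real (nl_semi_p p \<rho> \<Omega> \<delta>' v)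
        = enn2real (weighted_Lp_int p (lebesgue \<Otimes>\<^sub>M lebesgue) (nl_weight p \<rho> \<Omega> \<delta>') (\<lambda>z. v (fst z) - v (snd z)))"
      by (simp add: eq)
    have "enn2real (nl_semi_p p \<rho> \<Omega> \<delta>' v) \<le> C * enn2real (Lp_int p \<Omega> v)" by (rule C [OF v])
    also have "\<dots> \<le> C * (enn2real (Lp_int p \<Omega> v) + enn2real (nl_semi_p p \<rho> \<Omega> \<delta> v))"
      using cC by (intro mult_left_mono) auto
    finally show "enn2real (nl_semi_p p \<rho> \<Omega> \<delta>' v)
        \<le> C * (enn2real (Lp_int p \<Omega> v) + enn2real (nl_semi_p p \<rho> \<Omega> \<delta> v))" .
  next
    fix v w \<alpha> \<beta> assume vw: "v \<in> S0 p \<rho> \<Omega> \<delta>" "w \<in> S0 p \<rho> \<Omega> \<delta>"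
    show "(\<lambda>x. \<alpha> * v x + \<beta> * w x) \<in> S0 p \<rho> \<Omega> \<delta>" by (rule S0_lincomb [OF dom ker p0(1) \<delta>(1) vw])
    show "(LINT x:\<Omega>|lebesgue. f x * (\<alpha> * v x + \<beta> * w x))
      = \<alpha> * (LINT x:\<Omega>|lebesgue. f x * v x) + \<beta> * (LINT x:\<Omega>|lebesgue. f x * w x)"
      using vw unfolding S0 by (intro pairing_lincomb [OF D(4) p0(2) f]) auto
    show "AE z in lebesgue \<Otimes>\<^sub>M lebesgue. nl_weight p \<rho> \<Omega> \<delta>' z = 0 \<or>
       \<alpha> * v (fst z) + \<beta> * w (fst z) - (\<alpha> * v (snd z) + \<beta> * w (snd z))
       = \<alpha> *\<^sub>R (v (fst z) - v (snd z)) + \<beta> *\<^sub>R (w (fst z) - w (snd z))"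
      by (simp add: algebra_simps)
  next
    show "nl_weight p \<rho> \<Omega> \<delta>' \<in> borel_measurable (lebesgue \<Otimes>\<^sub>M lebesgue)"
      by (rule nl_weight_measurable [OF D(2) \<rho>(1)])
    show "0 \<le> enn2real (Lp_int p \<Omega> v) + enn2real (nl_semi_p p \<rho> \<Omega> \<delta> v)" for v by simp
  qed (fact p E enn2real_nonneg cC u that)+
qed

section \<open>Density of compactly supported continuous functions in L^p\<close>

lemma Lp_int_tendsto_0_dominated:
  fixes w :: "nat \<Rightarrow> 'a::euclidean_space \<Rightarrow> real"
  assumes A [measurable]: "A \<in> sets lebesgue"
    and w [measurable]: "\<And>n. w n \<in> borel_measurable lebesgue"
    and h [measurable]: "h \<in> borel_measurable lebesgue" and hfin: "Lp_int p A h < \<infinity>" and p: "0 < p"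
    and le: "\<And>n x. x \<in> A \<Longrightarrow> \<bar>w n x\<bar> \<le> \<bar>h x\<bar>"
    and lim: "AE x in lebesgue. x \<in> A \<longrightarrow> (\<lambda>n. w n x) \<longlonglongrightarrow> 0"
  shows "(\<lambda>n. Lp_int p A (w n)) \<longlonglongrightarrow> 0"
proof -
  have "(\<lambda>n. \<integral>\<^sup>+ x. ennreal (\<bar>w n x\<bar> powr p) * indicator A x \<partial>lebesgue) \<longlonglongrightarrow> (\<integral>\<^sup>+ x. 0 \<partial>(lebesgue :: 'a measure))"
  proof (rule nn_integral_dominated_convergence [where w = "\<lambda>x. ennreal (\<bar>h x\<bar> powr p) * indicator A x"])
    show "AE x in lebesgue. ennreal (\<bar>w j x\<bar> powr p) * indicator A x \<le> ennreal (\<bar>h x\<bar> powr p) * indicator A x" for j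
      using le p by (intro AE_I2) (auto split: split_indicator intro!: ennreal_leI powr_mono2)
    show "AE x in lebesgue. (\<lambda>i. ennreal (\<bar>w i x\<bar> powr p) * indicator A x) \<longlonglongrightarrow> 0"
      using lim
    proof eventually_elim
      case (elim x)
      show ?case
      proof (cases "x \<in> A")
        case True
        then have "(\<lambda>n. \<bar>w n x\<bar>) \<longlonglongrightarrow> 0" using elim by (simp add: tendsto_rabs_zero_iff)
        then have "(\<lambda>n. \<bar>w n x\<bar> powr p) \<longlonglongrightarrow> 0 powr p"
          using p by (intro tendsto_powr') (auto intro: tendsto_intros)
        then have "(\<lambda>n. ennreal (\<bar>w n x\<bar> powr p)) \<longlonglongrightarrow> ennreal 0" using p by (intro tendsto_ennrealI) simp
        then show ?thesis using True by simp
      qed simp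
    qed
  qed (use hfin in \<open>auto simp: Lp_int_def\<close>)
  then show ?thesis by (simp add: Lp_int_def)
qed

lemma Lp_int_triangle:
  fixes u v :: "'a::euclidean_space \<Rightarrow> 'c::euclidean_space"
  assumes A: "A \<in> sets lebesgue" and m: "u \<in> borel_measurable lebesgue" "v \<in> borel_measurable lebesgue"
    and p: "0 \<le> p"
  shows "Lp_int p A (\<lambda>x. norm (u x + v x))
     \<le> ennreal (2 powr p) * (Lp_int p A (\<lambda>x. norm (u x)) + Lp_int p A (\<lambda>x. norm (v x)))"
proof -
  note [measurable] = A m
  have pw: "norm (u x + v x) powr p \<le> 2 powr p * (norm (u x) powr p + norm (v x) powr p)" for x
    using powr_mono2 [OF p norm_ge_zero norm_triangle_ineq, of "u x" "v x"]
      powr_add_le_two_powr [of "norm (u x)" "norm (v x)" p] p by simp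
  have "Lp_int p A (\<lambda>x. norm (u x + v x))
     \<le> (\<integral>\<^sup>+ x. ennreal (2 powr p) * (ennreal (norm (u x) powr p) * indicator A x + ennreal (norm (v x) powr p) * indicator A x) \<partial>lebesgue)"
    unfolding Lp_int_def using pw
    by (intro nn_integral_mono) (auto split: split_indicator simp flip: ennreal_plus ennreal_mult intro!: ennreal_leI)
  also have "\<dots> = ennreal (2 powr p) * (Lp_int p A (\<lambda>x. norm (u x)) + Lp_int p A (\<lambda>x. norm (v x)))"
    unfolding Lp_int_def by (simp add: nn_integral_cmult nn_integral_add)
  finally show ?thesis .
qed

lemma Lp_int_triangle_real:
  fixes u v :: "'a::euclidean_space \<Rightarrow> real"
  assumes "A \<in> sets lebesgue" "u \<in> borel_measurable lebesgue" "v \<in> borel_measurable lebesgue" "0 \<le> p"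
  shows "Lp_int p A (\<lambda>x. u x + v x) \<le> ennreal (2 powr p) * (Lp_int p A u + Lp_int p A v)"
  using Lp_int_triangle [OF assms] by (simp add: Lp_int_def)

text \<open>Dominated convergence twice: \<open>u\<close> is truncated at a height m, with majorant
  |u|; then the truncation is replaced by truncated continuous functions times a cutoff, with the
  constant majorant 2 m on a bounded domain. \<open>measurable_on\<close> supplies the continuous
  functions with limit \<open>u\<close> almost everywhere.\<close>

lemma Lp_approx_continuous_compact_support:
  fixes \<Omega> :: "'a::euclidean_space set"
  assumes \<Omega>: "open \<Omega>" "bounded \<Omega>" and p: "0 < p"
    and u [measurable]: "u \<in> borel_measurable lebesgue" and ufin: "Lp_int p \<Omega> u < \<infinity>" and e: "0 < (e::ennreal)"
  obtains \<phi> K where "continuous_on UNIV \<phi>" "compact K" "K \<subseteq> \<Omega>" "\<And>x. x \<notin> K \<Longrightarrow> \<phi> x = 0"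
    "Lp_int p \<Omega> (\<lambda>x. \<phi> x - u x) < e"
proof -
  have [measurable]: "\<Omega> \<in> sets lebesgue" using \<Omega> by auto
  define cl where "cl M t = max (- M) (min M t)" for M t :: real
  have cl_cont: "continuous_on UNIV (cl M)" for M unfolding cl_def by (intro continuous_intros)
  have [measurable]: "cl M \<in> borel_measurable borel" for M
    using cl_cont by (rule borel_measurable_continuous_onI)
  \<comment> \<open>The tolerance may be infinite, so it is first cut down to a real number; 2^p is
    the loss in \<open>Lp_int_triangle_real\<close>.\<close>
  have "\<exists>e'>0. ennreal (2 powr p) * (e' + e') \<le> e"
  proof -
    define e1 where "e1 = min 1 (enn2real (min 1 e))"
    have fin: "min 1 e < top" by (simp add: min_less_iff_disj)
    have e1: "0 < e1" "ennreal e1 \<le> e"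
    proof -
      show "0 < e1" using e fin by (auto simp: e1_def enn2real_positive_iff)
      have "ennreal e1 \<le> ennreal (enn2real (min 1 e))" by (intro ennreal_leI) (simp add: e1_def)
      also have "\<dots> \<le> e" using fin by (simp add: ennreal_enn2real)
      finally show "ennreal e1 \<le> e" .
    qed
    let ?e = "e1 / (2 * 2 powr p)"
    have "ennreal (2 powr p) * (ennreal ?e + ennreal ?e) = ennreal (2 powr p * (?e + ?e))"
      using e1 by (subst ennreal_mult, simp, simp, subst ennreal_plus) auto
    also have "2 powr p * (?e + ?e) = e1" by (simp add: field_simps)
    finally show ?thesis using e1 by (intro exI [of _ "ennreal ?e"]) auto
  qed
  then obtain e' where e': "0 < e'" "ennreal (2 powr p) * (e' + e') \<le> e" by blast
  have "(\<lambda>n. Lp_int p \<Omega> (\<lambda>x. cl (real n) (u x) - u x)) \<longlonglongrightarrow> 0"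
  proof (rule Lp_int_tendsto_0_dominated [where h = u])
    show "AE x in lebesgue. x \<in> \<Omega> \<longrightarrow> (\<lambda>n. cl (real n) (u x) - u x) \<longlonglongrightarrow> 0"
    proof (intro AE_I2 impI)
      fix x
      obtain N where N: "\<bar>u x\<bar> \<le> real N" using real_arch_simple by blast
      have "eventually (\<lambda>n. cl (real n) (u x) - u x = 0) sequentially"
        using eventually_ge_at_top [of N]
        by eventually_elim (use N in \<open>auto simp: cl_def abs_le_iff\<close>)
      then show "(\<lambda>n. cl (real n) (u x) - u x) \<longlonglongrightarrow> 0" by (rule tendsto_eventually)
    qed
    show "\<bar>cl (real n) (u x) - u x\<bar> \<le> \<bar>u x\<bar>" for n x by (auto simp: cl_def)
  qed (use ufin p in auto)
  then have "eventually (\<lambda>n. Lp_int p \<Omega> (\<lambda>x. cl (real n) (u x) - u x) < e') sequentially"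
    using e' by (simp add: order_tendsto_iff)
  then obtain m where m: "Lp_int p \<Omega> (\<lambda>x. cl (real m) (u x) - u x) < e'"
    by (auto simp: eventually_sequentially)
  have "u measurable_on \<Omega>" by (rule lebesgue_measurable_imp_measurable_on) auto
  then obtain Ng g where g: "negligible Ng" "\<And>n. continuous_on UNIV (g n)"
    "\<And>x. x \<notin> Ng \<Longrightarrow> (\<lambda>n. g n x) \<longlonglongrightarrow> (if x \<in> \<Omega> then u x else 0)"
    by (auto simp: measurable_on_def)
  have ne: "- \<Omega> \<noteq> {}" using \<Omega>(2) not_bounded_UNIV by (metis Compl_empty_eq double_complement)
  \<comment> \<open>For n > 0 the cutoff vanishes within distance 1/n of the complement and is 1
    from distance 2/n on.\<close>
  define \<theta> where "\<theta> n x = min 1 (max 0 (real n * infdist x (- \<Omega>) - 1))" for n x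
  define \<psi> where "\<psi> n x = \<theta> n x * cl (real m) (g n x)" for n x
  have \<psi>_cont: "continuous_on UNIV (\<psi> n)" for n
    unfolding \<psi>_def \<theta>_def cl_def by (intro continuous_intros g)
  have [measurable]: "\<psi> n \<in> borel_measurable lebesgue" for n
    by (rule continuous_imp_lebesgue_measurable [OF \<psi>_cont])
  have cl_le: "\<bar>cl (real m) t\<bar> \<le> real m" for t by (auto simp: cl_def)
  have "(\<lambda>n. Lp_int p \<Omega> (\<lambda>x. \<psi> n x - cl (real m) (u x))) \<longlonglongrightarrow> 0"
  proof (rule Lp_int_tendsto_0_dominated [where h = "\<lambda>_. 2 * real m"])
    have "emeasure lebesgue \<Omega> < \<infinity>"
      using bounded_set_imp_lmeasurable [OF \<Omega>(2)] by (simp add: fmeasurable_def)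
    then show "Lp_int p \<Omega> (\<lambda>_. 2 * real m) < \<infinity>"
      unfolding Lp_int_def by (simp add: nn_integral_cmult_indicator ennreal_mult_less_top)
    have \<psi>_le: "\<bar>\<psi> n x\<bar> \<le> 1 * real m" for n x
      unfolding \<psi>_def abs_mult by (intro mult_mono cl_le) (auto simp: \<theta>_def)
    show "\<bar>\<psi> n x - cl (real m) (u x)\<bar> \<le> \<bar>2 * real m\<bar>" for n x
      using \<psi>_le [of n x] cl_le [of "u x"] by linarith
    have "AE x in lebesgue. x \<notin> Ng" using g(1) by (simp add: negligible_iff_null_sets AE_not_in)
    then show "AE x in lebesgue. x \<in> \<Omega> \<longrightarrow> (\<lambda>n. \<psi> n x - cl (real m) (u x)) \<longlonglongrightarrow> 0"
    proof eventually_elim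
      case (elim x)
      show ?case
      proof
        assume x: "x \<in> \<Omega>"
        have d: "0 < infdist x (- \<Omega>)"
          using x \<Omega>(1) ne by (intro infdist_pos_not_in_closed) auto
        obtain N where N: "2 / infdist x (- \<Omega>) \<le> real N" using real_arch_simple by blast
        have "eventually (\<lambda>n. \<theta> n x = 1) sequentially"
          using eventually_ge_at_top [of N]
        proof eventually_elim
          case (elim n)
          then have "2 / infdist x (- \<Omega>) \<le> real n" using N by linarith
          then show ?case using d by (simp add: \<theta>_def field_simps)
        qed
        then have "(\<lambda>n. \<theta> n x) \<longlonglongrightarrow> 1" by (rule tendsto_eventually)
        moreover have "(\<lambda>n. cl (real m) (g n x)) \<longlonglongrightarrow> cl (real m) (u x)"
          unfolding cl_def using g(3) [OF elim] x by (intro tendsto_intros) auto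
        ultimately have "(\<lambda>n. \<psi> n x - cl (real m) (u x)) \<longlonglongrightarrow> 1 * cl (real m) (u x) - cl (real m) (u x)"
          unfolding \<psi>_def by (intro tendsto_intros)
        then show "(\<lambda>n. \<psi> n x - cl (real m) (u x)) \<longlonglongrightarrow> 0" by simp
      qed
    qed
  qed (use p in auto)
  then have "eventually (\<lambda>n. Lp_int p \<Omega> (\<lambda>x. \<psi> n x - cl (real m) (u x)) < e') sequentially"
    using e' by (simp add: order_tendsto_iff)
  then obtain n where n: "Lp_int p \<Omega> (\<lambda>x. \<psi> n x - cl (real m) (u x)) < e'"
    by (auto simp: eventually_sequentially)
  define K where "K = {x. 1 \<le> real n * infdist x (- \<Omega>)}"
  show thesis
  proof (rule that)
    show "continuous_on UNIV (\<psi> n)" by (rule \<psi>_cont)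
    show "K \<subseteq> \<Omega>"
    proof
      fix x assume "x \<in> K"
      then have "infdist x (- \<Omega>) \<noteq> 0" by (auto simp: K_def)
      then show "x \<in> \<Omega>" by (metis Compl_iff infdist_zero)
    qed
    then have "bounded K" using \<Omega>(2) bounded_subset by blast
    moreover have "closed K" unfolding K_def by (intro closed_Collect_le continuous_intros)
    ultimately show "compact K" by (simp add: compact_eq_bounded_closed)
    show "\<psi> n x = 0" if "x \<notin> K" for x using that by (simp add: K_def \<psi>_def \<theta>_def)
    have "Lp_int p \<Omega> (\<lambda>x. \<psi> n x - u x) = Lp_int p \<Omega> (\<lambda>x. (\<psi> n x - cl (real m) (u x)) + (cl (real m) (u x) - u x))"
      by simp
    also have "\<dots> \<le> ennreal (2 powr p) * (Lp_int p \<Omega> (\<lambda>x. \<psi> n x - cl (real m) (u x)) + Lp_int p \<Omega> (\<lambda>x. cl (real m) (u x) - u x))"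
      using p by (intro Lp_int_triangle_real) auto
    also have "\<dots> < ennreal (2 powr p) * (e' + e')"
      using n m by (intro ennreal_mult_strict_left_mono add_strict_mono) auto
    also have "\<dots> \<le> e" by (rule e')
    finally show "Lp_int p \<Omega> (\<lambda>x. \<psi> n x - u x) < e" .
  qed
qed

section \<open>Piecewise linear interpolation\<close>

text \<open>Moving one vertex to the origin makes the others linearly independent, so the prescribed
  values extend to a linear form; its adjoint at 1 is the representing vector.\<close>

lemma affine_interpolation:
  fixes C :: "'a::euclidean_space set" and \<phi> :: "'a \<Rightarrow> real"
  assumes "\<not> affine_dependent C"
  obtains a b where "\<And>x. x \<in> C \<Longrightarrow> a \<bullet> x + b = \<phi> x"
proof (cases "C = {}")
  case False
  then obtain c where c: "c \<in> C" by blast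
  have "independent ((\<lambda>x. - c + x) ` (C - {c}))"
    using assms affine_dependent_iff_dependent2 [OF c] by simp
  then obtain g :: "'a \<Rightarrow> real" where g: "linear g"
    "\<And>y. y \<in> (\<lambda>x. - c + x) ` (C - {c}) \<Longrightarrow> g y = \<phi> (y + c) - \<phi> c"
    using linear_independent_extend [of _ "\<lambda>y. \<phi> (y + c) - \<phi> c"] by metis
  define a where "a = adjoint g 1"
  have a: "g y = a \<bullet> y" for y
    using adjoint_works [OF g(1), of y 1] by (simp add: a_def inner_commute)
  show thesis
  proof (rule that [of a "\<phi> c - a \<bullet> c"])
    fix x assume x: "x \<in> C"
    show "a \<bullet> x + (\<phi> c - a \<bullet> c) = \<phi> x"
    proof (cases "x = c")
      case False
      with x have "g (- c + x) = \<phi> (- c + x + c) - \<phi> c" by (intro g) auto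
      then show ?thesis by (simp add: a inner_diff_right)
    qed simp
  qed
qed (use that in auto)

lemma affine_le_on_convex_hull:
  fixes a :: "'a::real_inner"
  assumes "\<And>y. y \<in> C \<Longrightarrow> a \<bullet> y + b \<le> m" "x \<in> convex hull C"
  shows "a \<bullet> x + b \<le> m"
proof -
  have "convex hull C \<subseteq> {y. a \<bullet> y \<le> m - b}"
    using assms(1) by (intro hull_minimal convex_halfspace_le) (auto simp: algebra_simps)
  then show ?thesis using assms(2) by auto
qed

lemma affine_ge_on_convex_hull:
  fixes a :: "'a::real_inner"
  assumes "\<And>y. y \<in> C \<Longrightarrow> m \<le> a \<bullet> y + b" "x \<in> convex hull C"
  shows "m \<le> a \<bullet> x + b"
  using affine_le_on_convex_hull [of C "- a" "- b" "- m" x] assms by fastforce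

text \<open>A common face is the hull of some vertices of either simplex, and those vertices are its
  extreme points, so the two vertex sets agree.\<close>

lemma simplices_intersect_in_common_vertices:
  fixes C C' :: "'a::euclidean_space set"
  assumes ind: "\<not> affine_dependent C" "\<not> affine_dependent C'"
    and faces: "(convex hull C \<inter> convex hull C') face_of convex hull C"
      "(convex hull C \<inter> convex hull C') face_of convex hull C'"
  shows "convex hull C \<inter> convex hull C' \<subseteq> convex hull (C \<inter> C')"
proof -
  obtain c where c: "c \<subseteq> C" "convex hull C \<inter> convex hull C' = convex hull c"
    using faces(1) face_of_convex_hull_affine_independent [OF ind(1)] by blast
  obtain c' where c': "c' \<subseteq> C'" "convex hull C \<inter> convex hull C' = convex hull c'"
    using faces(2) face_of_convex_hull_affine_independent [OF ind(2)] by blast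
  have "x \<in> c \<longleftrightarrow> x \<in> c'" for x
    using extreme_point_of_convex_hull_affine_independent affine_dependent_subset c c' ind by metis
  then have "c \<subseteq> C \<inter> C'" using c c' by blast
  then show ?thesis using c(2) hull_mono by metis
qed

text \<open>A mesh stores simplices as point sets, so the vertices are quantified here; the slope
  \<open>a\<close> is exposed because it is the gradient of \<open>v\<close> on
  \<open>T\<close>.\<close>

definition interpolates_on_simplex ::
  "('a::euclidean_space \<Rightarrow> real) \<Rightarrow> ('a \<Rightarrow> real) \<Rightarrow> 'a set \<Rightarrow> bool" where
  "interpolates_on_simplex \<phi> v T \<longleftrightarrow>
     (\<exists>C a b. \<not> affine_dependent C \<and> card C = DIM('a) + 1 \<and> T = convex hull C \<and>
        (\<forall>x\<in>T. v x = a \<bullet> x + b) \<and> (\<forall>c\<in>C. a \<bullet> c + b = \<phi> c))"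

text \<open>Shared vertices make the local interpolants fit together. The hypothesis on simplices
  touching the frontier makes the interpolant 0 on them, so its extension by zero is
  continuous.\<close>

lemma P1_interpolant:
  fixes \<Omega> :: "'a::euclidean_space set" and \<phi> :: "'a \<Rightarrow> real"
  assumes tri: "triangulation_of \<T> \<Omega>" and \<Omega>: "open \<Omega>" and \<phi>: "\<And>x. x \<notin> K \<Longrightarrow> \<phi> x = 0"
    and bdry: "\<And>T. T \<in> \<T> \<Longrightarrow> T \<inter> frontier \<Omega> \<noteq> {} \<Longrightarrow> T \<inter> K = {}"
  obtains v where "v \<in> P1_space \<Omega> \<T>"
    "\<And>T. T \<in> \<T> \<Longrightarrow> interpolates_on_simplex \<phi> v T"
proof -
  have fin: "finite \<T>" and faces: "\<And>T T'. T \<in> \<T> \<Longrightarrow> T' \<in> \<T> \<Longrightarrow> (T \<inter> T') face_of T"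
    and simplex: "\<And>T. T \<in> \<T> \<Longrightarrow> int DIM('a) simplex T" and cover: "\<Union>\<T> = closure \<Omega>"
    using tri by (auto simp: triangulation_of_def triangulation_def)
  have "\<forall>T\<in>\<T>. \<exists>C a b. \<not> affine_dependent C \<and> card C = DIM('a) + 1 \<and> T = convex hull C \<and>
      (\<forall>c\<in>C. a \<bullet> c + b = \<phi> c)"
  proof
    fix T assume "T \<in> \<T>"
    then obtain C where C: "\<not> affine_dependent C" "int (card C) = int DIM('a) + 1" "T = convex hull C"
      using simplex by (auto simp: simplex_def)
    obtain a b where "\<And>x. x \<in> C \<Longrightarrow> a \<bullet> x + b = \<phi> x"
      using affine_interpolation [OF C(1)] by blast
    then show "\<exists>C a b. \<not> affine_dependent C \<and> card C = DIM('a) + 1 \<and> T = convex hull C \<and>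
      (\<forall>c\<in>C. a \<bullet> c + b = \<phi> c)"
      using C by (intro exI [of _ C] exI [of _ a] exI [of _ b]) auto
  qed
  then obtain C a b where C: "\<And>T. T \<in> \<T> \<Longrightarrow> \<not> affine_dependent (C T)"
      "\<And>T. T \<in> \<T> \<Longrightarrow> card (C T) = DIM('a) + 1" "\<And>T. T \<in> \<T> \<Longrightarrow> T = convex hull (C T)"
    and ab: "\<And>T c. T \<in> \<T> \<Longrightarrow> c \<in> C T \<Longrightarrow> a T \<bullet> c + b T = \<phi> c"
    by metis
  \<comment> \<open>The difference of the two affine forms vanishes at the shared vertices and
    therefore on their hull.\<close>
  have agree: "a T \<bullet> x + b T = a T' \<bullet> x + b T'"
    if T: "T \<in> \<T>" "T' \<in> \<T>" "x \<in> T" "x \<in> T'" for T T' x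
  proof -
    have "x \<in> convex hull (C T \<inter> C T')"
      using simplices_intersect_in_common_vertices [OF C(1) [OF T(1)] C(1) [OF T(2)]]
        faces [OF T(1,2)] faces [OF T(2,1)] C(3) [OF T(1)] C(3) [OF T(2)] T(3,4)
      by (metis IntI Int_commute subsetD)
    moreover have *: "(a T - a T') \<bullet> y + (b T - b T') = 0" if "y \<in> C T \<inter> C T'" for y
      using ab [OF T(1), of y] ab [OF T(2), of y] that by (simp add: inner_diff_left)
    ultimately have "(a T - a T') \<bullet> x + (b T - b T') \<le> 0" "0 \<le> (a T - a T') \<bullet> x + (b T - b T')"
      using affine_le_on_convex_hull [OF eq_refl [OF *]] affine_ge_on_convex_hull [OF eq_refl [OF * [symmetric]]]
      by blast+
    then show ?thesis by (simp add: inner_diff_left)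
  qed
  \<comment> \<open>A point of a closed simplex outside the open domain lies on the frontier, so
    that simplex misses \<open>K\<close> and all its vertex values are 0.\<close>
  have zero: "a T \<bullet> x + b T = 0" if T: "T \<in> \<T>" "x \<in> T" "x \<notin> \<Omega>" for T x
  proof -
    have "x \<in> frontier \<Omega>"
      using T cover \<Omega> by (auto simp: frontier_def interior_open)
    then have "T \<inter> K = {}" using bdry [OF T(1)] T(2) by blast
    moreover have "C T \<subseteq> T" using C(3) [OF T(1)] hull_subset by metis
    ultimately have "a T \<bullet> y + b T = 0" if "y \<in> C T" for y
      using ab [OF T(1) that] \<phi> that by auto
    then have "a T \<bullet> x + b T \<le> 0" "0 \<le> a T \<bullet> x + b T"
      using C(3) [OF T(1)] T(2) affine_le_on_convex_hull [of "C T" "a T" "b T" 0 x]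
        affine_ge_on_convex_hull [of "C T" 0 "a T" "b T" x] by auto
    then show ?thesis by simp
  qed
  \<comment> \<open>By \<open>agree\<close> the value does not depend on the simplex chosen.\<close>
  define v where "v x = (if x \<in> \<Omega> then (let T = SOME T. T \<in> \<T> \<and> x \<in> T in a T \<bullet> x + b T) else 0)" for x
  have v: "v x = a T \<bullet> x + b T" if "T \<in> \<T>" "x \<in> T" for T x
  proof (cases "x \<in> \<Omega>")
    case True
    define T' where "T' = (SOME T. T \<in> \<T> \<and> x \<in> T)"
    have "T' \<in> \<T> \<and> x \<in> T'" unfolding T'_def by (rule someI [of _ T]) (use that in auto)
    then show ?thesis using agree [of T' T x] that True by (simp add: v_def T'_def [symmetric])
  qed (use zero that in \<open>simp add: v_def\<close>)
  have cont: "continuous_on UNIV v"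
  proof -
    have "continuous_on (\<Union>T\<in>\<T>. T) v"
    proof (rule continuous_on_closed_Union [OF fin])
      fix T assume T: "T \<in> \<T>"
      show "closed T" using C(1) [OF T] C(3) [OF T] aff_independent_finite compact_convex_hull
          finite_imp_compact compact_imp_closed by metis
      have "continuous_on T (\<lambda>x. a T \<bullet> x + b T)" by (intro continuous_intros)
      then show "continuous_on T v" using v T by (simp cong: continuous_on_cong)
    qed
    then have "continuous_on (closure \<Omega>) v" using cover by simp
    moreover have "continuous_on (- \<Omega>) v"
      by (rule continuous_on_eq [of _ "\<lambda>_. 0"]) (auto simp: v_def)
    ultimately have "continuous_on (closure \<Omega> \<union> - \<Omega>) v"
      using \<Omega> by (intro continuous_on_closed_Un) auto
    moreover have "closure \<Omega> \<union> - \<Omega> = UNIV" using closure_subset by auto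
    ultimately show ?thesis by simp
  qed
  show thesis
  proof (rule that)
    show "v \<in> P1_space \<Omega> \<T>" using cont v by (auto simp: P1_space_def) (auto simp: v_def)
    fix T assume T: "T \<in> \<T>"
    show "interpolates_on_simplex \<phi> v T"
      unfolding interpolates_on_simplex_def using C [OF T] v T ab [OF T] by blast
  qed
qed

lemma diameter_le_mesh_size:
  assumes "triangulation_of \<T> \<Omega>" "T \<in> \<T>" shows "diameter T \<le> mesh_size \<T>"
  using assms by (auto simp: mesh_size_def triangulation_of_def triangulation_def)

text \<open>\<open>inradius\<close> is a supremum, so a ball of more than half that radius is taken,
  at the cost of the factor 2. The positive diameter of a nondegenerate simplex forces both the
  inradius and \<open>\<kappa>\<close> to be positive.\<close>

lemma shape_regular_inner_ball:
  fixes C :: "'a::euclidean_space set"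
  assumes C: "finite C" "card C = DIM('a) + 1" and T: "T = convex hull C"
    and \<kappa>: "diameter T \<le> \<kappa> * inradius T"
  obtains c r where "0 < r" "ball c r \<subseteq> T" "diameter T \<le> 2 * \<kappa> * r" "0 < \<kappa>"
proof -
  have bT: "bounded T" using C T by (simp add: finite_imp_bounded bounded_convex_hull)
  define S where "S = {r. \<exists>c. ball c r \<subseteq> T}"
  \<comment> \<open>This bounds the radii, so that \<open>Sup\<close> has its meaning: the points c
    + (r/2) e and c - (r/2) e of the ball are at distance r.\<close>
  have le_diam: "r \<le> diameter T" if "r \<in> S" for r
  proof (cases "0 < r")
    case True
    from that obtain c where c: "ball c r \<subseteq> T" by (auto simp: S_def)
    obtain e :: 'a where e: "e \<in> Basis" using nonempty_Basis by blast
    have "c + (r/2) *\<^sub>R e \<in> T" "c - (r/2) *\<^sub>R e \<in> T"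
      using c True e by (auto intro!: subsetD [OF c] simp: dist_norm)
    then have "dist (c + (r/2) *\<^sub>R e) (c - (r/2) *\<^sub>R e) \<le> diameter T"
      by (intro diameter_bounded_bound bT)
    moreover have "(c + (r/2) *\<^sub>R e) - (c - (r/2) *\<^sub>R e) = r *\<^sub>R e"
      by (simp add: scaleR_add_left [symmetric])
    ultimately show ?thesis using True e by (simp add: dist_norm)
  next
    case False
    then show ?thesis using diameter_ge_0 [OF bT] by linarith
  qed
  have S0: "0 \<in> S" by (auto simp: S_def)
  have inr: "inradius T = Sup S" by (simp add: inradius_def S_def)
  have inr0: "0 \<le> inradius T"
    unfolding inr by (rule cSup_upper [OF S0]) (use le_diam in \<open>auto simp: bdd_above_def\<close>)
  have "\<not> card C \<le> Suc 0" using C(2) DIM_positive [where 'a = 'a] by simp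
  then obtain x y where xy: "x \<in> C" "y \<in> C" "x \<noteq> y"
    using C(1) by (metis card_le_Suc0_iff_eq)
  then have "x \<in> T" "y \<in> T" using T by (auto intro: hull_inc)
  then have "dist x y \<le> diameter T" by (intro diameter_bounded_bound bT)
  then have diam: "0 < diameter T" using xy by (smt (verit) zero_less_dist_iff)
  then have pos: "0 < \<kappa>" "0 < inradius T"
    using \<kappa> inr0 by (smt (verit) mult_nonpos_nonneg mult_eq_0_iff)+
  have "inradius T / 2 < Sup S" using pos by (simp add: inr)
  then obtain r where r: "r \<in> S" "inradius T / 2 < r" using less_cSupD [of S] S0 by blast
  then obtain c where "ball c r \<subseteq> T" by (auto simp: S_def)
  moreover have "diameter T \<le> 2 * \<kappa> * r"
  proof -
    have "\<kappa> * inradius T \<le> \<kappa> * (2 * r)" using r(2) pos by (intro mult_left_mono) auto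
    then show ?thesis using \<kappa> by simp
  qed
  moreover have "0 < r" using r(2) pos by linarith
  ultimately show thesis using that pos(1) by blast
qed

text \<open>The function z -> phi(z) - G(x) . z has gradient at most \<open>e\<close> on
  \<open>T\<close>, so its vertex values differ by at most e times the diameter. The affine form
  with slope a - G(x) has the same vertex differences, hence is that small on all of
  \<open>T\<close>; on an inner ball of radius r this bounds the slope by a multiple of 1/r.\<close>

lemma interpolation_gradient_error:
  fixes \<phi> :: "'a::euclidean_space \<Rightarrow> real" and G :: "'a \<Rightarrow> 'a"
  assumes C: "finite C" "card C = DIM('a) + 1" and T: "T = convex hull C"
    and \<kappa>: "diameter T \<le> \<kappa> * inradius T"
    and G: "\<And>x. (\<phi> has_derivative (\<lambda>h. G x \<bullet> h)) (at x)"
    and osc: "\<And>x y. x \<in> T \<Longrightarrow> y \<in> T \<Longrightarrow> norm (G x - G y) \<le> e"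
    and ab: "\<And>c. c \<in> C \<Longrightarrow> a \<bullet> c + b = \<phi> c" and x: "x \<in> T"
  shows "norm (a - G x) \<le> 4 * \<kappa> * e"
proof -
  obtain c r where r: "0 < r" "ball c r \<subseteq> T" "diameter T \<le> 2 * \<kappa> * r" "0 < \<kappa>"
    using shape_regular_inner_ball [OF C T \<kappa>] by blast
  have bT: "bounded T" using C T by (simp add: finite_imp_bounded bounded_convex_hull)
  have cT: "convex T" using T by simp
  have e: "0 \<le> e" using osc [OF x x] by simp
  have "C \<noteq> {}" using C(2) by auto
  then obtain c0 where c0: "c0 \<in> C" by blast
  have CT: "C \<subseteq> T" using T hull_subset by metis
  define w where "w = a - G x"
  have vert: "\<bar>w \<bullet> y + (- (w \<bullet> c0))\<bar> \<le> e * diameter T" if y: "y \<in> C" for y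
  proof -
    have "norm ((\<phi> y - G x \<bullet> y) - (\<phi> c0 - G x \<bullet> c0)) \<le> e * norm (y - c0)"
    proof (rule differentiable_bound [OF cT, where f = "\<lambda>z. \<phi> z - G x \<bullet> z" and f' = "\<lambda>z h. G z \<bullet> h - G x \<bullet> h"])
      fix z assume z: "z \<in> T"
      show "((\<lambda>z. \<phi> z - G x \<bullet> z) has_derivative (\<lambda>h. G z \<bullet> h - G x \<bullet> h)) (at z within T)"
        by (intro derivative_intros has_derivative_at_withinI [OF G])
      show "onorm (\<lambda>h. G z \<bullet> h - G x \<bullet> h) \<le> e"
      proof (rule onorm_le)
        fix h
        have "norm (G z \<bullet> h - G x \<bullet> h) \<le> norm (G z - G x) * norm h"
          using Cauchy_Schwarz_ineq2 [of "G z - G x" h] by (simp add: inner_diff_left)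
        also have "\<dots> \<le> e * norm h" using osc [OF z x] by (intro mult_right_mono) auto
        finally show "norm (G z \<bullet> h - G x \<bullet> h) \<le> e * norm h" .
      qed
    qed (use y c0 CT in auto)
    also have "\<dots> \<le> e * diameter T"
      using e y c0 CT diameter_bounded_bound [OF bT, of y c0] by (intro mult_left_mono) (auto simp: dist_norm)
    finally show ?thesis
      using ab [OF y] ab [OF c0] by (simp add: w_def inner_diff_left algebra_simps)
  qed
  have on_T: "\<bar>w \<bullet> y + (- (w \<bullet> c0))\<bar> \<le> e * diameter T" if y: "y \<in> T" for y
  proof -
    have "w \<bullet> y + (- (w \<bullet> c0)) \<le> e * diameter T"
      by (rule affine_le_on_convex_hull [OF abs_le_D1 [OF vert]]) (use y T in simp_all)
    moreover have "- (e * diameter T) \<le> w \<bullet> y + (- (w \<bullet> c0))"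
    proof (rule affine_ge_on_convex_hull [of C])
      show "- (e * diameter T) \<le> w \<bullet> z + (- (w \<bullet> c0))" if "z \<in> C" for z
        using abs_le_D2 [OF vert [OF that]] by linarith
    qed (use y T in simp)
    ultimately show ?thesis by linarith
  qed
  show ?thesis
  proof (cases "w = 0")
    case True
    then show ?thesis using e r by (simp add: w_def)
  next
    case False
    \<comment> \<open>A segment of length r along \<open>w\<close> through the centre of the ball:
      it gives r |w| <= 2 e diam(T) <= 4 kappa r e, the constant of the statement.\<close>
    define d where "d = (r / 2 / norm w) *\<^sub>R w"
    have nd: "norm d = r / 2" using False r by (simp add: d_def)
    have "c + d \<in> T" "c - d \<in> T" using nd r by (auto intro!: subsetD [OF r(2)] simp: dist_norm)
    then have "w \<bullet> (c + d) - w \<bullet> (c - d) \<le> 2 * (e * diameter T)"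
      using on_T [of "c + d"] on_T [of "c - d"] by linarith
    moreover have "w \<bullet> d = r / 2 * norm w"
      using False by (simp add: d_def power2_norm_eq_inner [symmetric] power2_eq_square dot_square_norm)
    ultimately have "r * norm w \<le> 2 * (e * diameter T)" by (simp add: inner_add_right inner_diff_right)
    also have "\<dots> \<le> 2 * (e * (2 * \<kappa> * r))" using e r(3) by (intro mult_left_mono) auto
    finally have "r * norm w \<le> r * (4 * \<kappa> * e)" by (simp add: mult_ac)
    then show ?thesis using r(1) by (simp add: w_def)
  qed
qed

lemma small_mesh_avoids_frontier:
  fixes \<Omega> :: "'a::euclidean_space set"
  assumes "open \<Omega>" "bounded \<Omega>" "compact K" "K \<subseteq> \<Omega>"
  obtains d where "0 < d" "\<And>\<T> T. triangulation_of \<T> \<Omega> \<Longrightarrow> mesh_size \<T> < d \<Longrightarrow> T \<in> \<T> \<Longrightarrow>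
     T \<inter> frontier \<Omega> \<noteq> {} \<Longrightarrow> T \<inter> K = {}"
proof -
  have "K \<inter> frontier \<Omega> = {}" using assms by (auto simp: frontier_def interior_open)
  then obtain d where d: "0 < d" "\<And>x y. x \<in> K \<Longrightarrow> y \<in> frontier \<Omega> \<Longrightarrow> d \<le> dist x y"
    using separate_compact_closed [OF assms(3) frontier_closed [of \<Omega>]] by metis
  show thesis
  proof (rule that [OF d(1)])
    fix \<T> T assume tri: "triangulation_of \<T> \<Omega>" and m: "mesh_size \<T> < d" and T: "T \<in> \<T>"
      and ne: "T \<inter> frontier \<Omega> \<noteq> {}"
    have "T \<subseteq> closure \<Omega>" using tri T by (auto simp: triangulation_of_def)
    then have bT: "bounded T" using assms(2) bounded_closure bounded_subset by blast
    from ne obtain y where y: "y \<in> T" "y \<in> frontier \<Omega>" by blast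
    show "T \<inter> K = {}"
    proof (rule ccontr)
      assume "T \<inter> K \<noteq> {}"
      then obtain x where x: "x \<in> T" "x \<in> K" by blast
      have "d \<le> dist x y" using d x y by blast
      also have "\<dots> \<le> diameter T" by (intro diameter_bounded_bound bT x y)
      also have "\<dots> \<le> mesh_size \<T>" by (rule diameter_le_mesh_size [OF tri T])
      finally show False using m by simp
    qed
  qed
qed

text \<open>At \<open>x\<close> the interpolant is a convex combination of vertex values, each
  within the oscillation \<open>e\<close> of \<open>\<phi> x\<close>.\<close>

lemma P1_interpolant_uniform_error:
  fixes \<Omega> :: "'a::euclidean_space set" and \<phi> :: "'a \<Rightarrow> real"
  assumes tri: "triangulation_of \<T> \<Omega>" and \<Omega>: "open \<Omega>"
    and \<phi>: "\<And>x. x \<notin> K \<Longrightarrow> \<phi> x = 0" "K \<subseteq> \<Omega>"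
    and bdry: "\<And>T. T \<in> \<T> \<Longrightarrow> T \<inter> frontier \<Omega> \<noteq> {} \<Longrightarrow> T \<inter> K = {}"
    and osc: "\<And>T x y. T \<in> \<T> \<Longrightarrow> x \<in> T \<Longrightarrow> y \<in> T \<Longrightarrow> \<bar>\<phi> x - \<phi> y\<bar> \<le> e" and e: "0 \<le> e"
  obtains v where "v \<in> P1_space \<Omega> \<T>" "\<And>x. \<bar>v x - \<phi> x\<bar> \<le> e"
    "\<And>T. T \<in> \<T> \<Longrightarrow> interpolates_on_simplex \<phi> v T"
proof -
  obtain v where v: "v \<in> P1_space \<Omega> \<T>"
    and rep: "\<And>T. T \<in> \<T> \<Longrightarrow> interpolates_on_simplex \<phi> v T"
    by (rule P1_interpolant [where \<phi> = \<phi>, OF tri \<Omega> \<phi>(1) bdry]) (assumption | (rule that; blast))+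
  have "\<bar>v x - \<phi> x\<bar> \<le> e" for x
  proof (cases "x \<in> \<Omega>")
    case True
    then obtain T where T: "T \<in> \<T>" "x \<in> T"
      using tri closure_subset [of \<Omega>] unfolding triangulation_of_def by blast
    then obtain C a b where C: "T = convex hull C" "v x = a \<bullet> x + b" "\<And>c. c \<in> C \<Longrightarrow> a \<bullet> c + b = \<phi> c"
      using rep [OF T(1)] unfolding interpolates_on_simplex_def by blast
    have CT: "C \<subseteq> T" using C(1) hull_subset by metis
    have *: "\<bar>\<phi> c - \<phi> x\<bar> \<le> e" if "c \<in> C" for c using osc [OF T(1)] T(2) CT that by blast
    have "a \<bullet> x + b \<le> \<phi> x + e"
    proof (rule affine_le_on_convex_hull)
      show "a \<bullet> c + b \<le> \<phi> x + e" if "c \<in> C" for c using * [OF that] C(3) [OF that] by linarith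
    qed (use T C in simp)
    moreover have "\<phi> x - e \<le> a \<bullet> x + b"
    proof (rule affine_ge_on_convex_hull)
      show "\<phi> x - e \<le> a \<bullet> c + b" if "c \<in> C" for c using * [OF that] C(3) [OF that] by linarith
    qed (use T C in simp)
    ultimately show ?thesis unfolding C(2) by linarith
  next
    case False
    then have "v x = 0" "\<phi> x = 0" using v \<phi> by (auto simp: P1_space_def)
    then show ?thesis using e by simp
  qed
  then show thesis using that v rep by blast
qed

lemma P1_approximation_continuous:
  fixes \<Omega> :: "'a::euclidean_space set" and \<phi> :: "'a \<Rightarrow> real"
  assumes fam: "qu_sr_family \<F> \<Omega>" and \<Omega>: "open \<Omega>" "bounded \<Omega>"
    and \<phi>: "continuous_on UNIV \<phi>" "compact K" "K \<subseteq> \<Omega>" "\<And>x. x \<notin> K \<Longrightarrow> \<phi> x = 0" and e: "0 < e"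
  obtains \<eta> where "0 < \<eta>" "\<And>\<T>. \<T> \<in> \<F> \<Longrightarrow> mesh_size \<T> < \<eta> \<Longrightarrow>
    \<exists>v\<in>P1_space \<Omega> \<T>. (\<forall>x. \<bar>v x - \<phi> x\<bar> \<le> e) \<and>
      (\<forall>T\<in>\<T>. interpolates_on_simplex \<phi> v T)"
proof -
  have cpt: "compact (closure \<Omega>)" using \<Omega> by simp
  obtain d where d: "0 < d" "\<And>\<T> T. triangulation_of \<T> \<Omega> \<Longrightarrow> mesh_size \<T> < d \<Longrightarrow> T \<in> \<T> \<Longrightarrow>
     T \<inter> frontier \<Omega> \<noteq> {} \<Longrightarrow> T \<inter> K = {}"
    by (rule small_mesh_avoids_frontier [OF \<Omega> \<phi>(2,3)]) (rule that; blast)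
  have "uniformly_continuous_on (closure \<Omega>) \<phi>"
    using cpt \<phi>(1) compact_uniformly_continuous continuous_on_subset by blast
  then obtain d' where d': "0 < d'" "\<And>x y. x \<in> closure \<Omega> \<Longrightarrow> y \<in> closure \<Omega> \<Longrightarrow> dist x y < d' \<Longrightarrow> dist (\<phi> x) (\<phi> y) < e"
    using e unfolding uniformly_continuous_on_def by (metis dist_commute)
  show thesis
  proof (rule that [of "min d d'"])
    show "0 < min d d'" using d d' by simp
    fix \<T> assume F: "\<T> \<in> \<F>" and m: "mesh_size \<T> < min d d'"
    have tri: "triangulation_of \<T> \<Omega>" using fam F by (auto simp: qu_sr_family_def)
    have osc: "\<bar>\<phi> x - \<phi> y\<bar> \<le> e" if "T \<in> \<T>" "x \<in> T" "y \<in> T" for T x y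
    proof -
      have sub: "T \<subseteq> closure \<Omega>" using tri that by (auto simp: triangulation_of_def)
      then have "bounded T" using \<Omega>(2) bounded_closure bounded_subset by blast
      then have "dist x y \<le> diameter T" using that by (intro diameter_bounded_bound)
      then have "dist x y < d'" using diameter_le_mesh_size [OF tri that(1)] m by simp
      then have "dist (\<phi> x) (\<phi> y) < e" using d'(2) sub that by blast
      then show ?thesis by (simp add: dist_real_def)
    qed
    have bdry: "T \<inter> frontier \<Omega> \<noteq> {} \<Longrightarrow> T \<inter> K = {}" if "T \<in> \<T>" for T
      using d(2) [OF tri] m that by simp
    obtain v where v: "v \<in> P1_space \<Omega> \<T>" "\<And>x. \<bar>v x - \<phi> x\<bar> \<le> e"
      and rep: "\<And>T. T \<in> \<T> \<Longrightarrow> interpolates_on_simplex \<phi> v T"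
      by (rule P1_interpolant_uniform_error [where \<phi> = \<phi>, OF tri \<Omega>(1) \<phi>(4,3) bdry osc less_imp_le [OF e]])
        (assumption | (rule that; blast))+
    then show "\<exists>v\<in>P1_space \<Omega> \<T>. (\<forall>x. \<bar>v x - \<phi> x\<bar> \<le> e) \<and>
      (\<forall>T\<in>\<T>. interpolates_on_simplex \<phi> v T)"
      by blast
  qed
qed

lemma P1_approximation_C1:
  fixes \<Omega> :: "'a::euclidean_space set" and \<phi> :: "'a \<Rightarrow> real" and G :: "'a \<Rightarrow> 'a"
  assumes fam: "qu_sr_family \<F> \<Omega>" and \<Omega>: "open \<Omega>" "bounded \<Omega>"
    and \<phi>: "compact K" "K \<subseteq> \<Omega>" "\<And>x. x \<notin> K \<Longrightarrow> \<phi> x = 0" and e: "0 < e"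
    and G: "\<And>x. (\<phi> has_derivative (\<lambda>h. G x \<bullet> h)) (at x)" "continuous_on UNIV G"
  obtains \<eta> where "0 < \<eta>" "\<And>\<T>. \<T> \<in> \<F> \<Longrightarrow> mesh_size \<T> < \<eta> \<Longrightarrow>
    \<exists>v\<in>P1_space \<Omega> \<T>. (\<forall>x. \<bar>v x - \<phi> x\<bar> \<le> e) \<and>
      (\<forall>T\<in>\<T>. \<exists>a b. (\<forall>x\<in>T. v x = a \<bullet> x + b) \<and> (\<forall>x\<in>T. norm (a - G x) \<le> e))"
proof -
  have cpt: "compact (closure \<Omega>)" using \<Omega> by simp
  have cont: "continuous_on UNIV \<phi>"
    using G(1) has_derivative_continuous continuous_at_imp_continuous_on by blast
  obtain \<eta> where \<eta>: "0 < \<eta>" "\<And>\<T>. \<T> \<in> \<F> \<Longrightarrow> mesh_size \<T> < \<eta> \<Longrightarrow>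
    \<exists>v\<in>P1_space \<Omega> \<T>. (\<forall>x. \<bar>v x - \<phi> x\<bar> \<le> e) \<and>
      (\<forall>T\<in>\<T>. interpolates_on_simplex \<phi> v T)"
    by (rule P1_approximation_continuous [OF fam \<Omega> cont \<phi> e]) (assumption | (rule that; blast))+
  obtain \<kappa> where \<kappa>: "\<And>\<T> T. \<T> \<in> \<F> \<Longrightarrow> T \<in> \<T> \<Longrightarrow> diameter T \<le> \<kappa> * inradius T"
    using fam unfolding qu_sr_family_def by blast
  \<comment> \<open>\<open>\<kappa>\<close> comes without a sign, so a positive majorant replaces
    it; the tolerance e / (4 k) absorbs the factor in
    \<open>interpolation_gradient_error\<close>.\<close>
  define k where "k = \<bar>\<kappa>\<bar> + 1"
  have k: "0 < k" "\<kappa> \<le> k" unfolding k_def by linarith+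
  define e' where "e' = e / (4 * k)"
  have e': "0 < e'" "4 * \<kappa> * e' \<le> e"
    using e k by (auto simp: e'_def divide_le_eq mult_ac)
  have "uniformly_continuous_on (closure \<Omega>) G"
    using cpt G(2) compact_uniformly_continuous continuous_on_subset by blast
  then obtain d where d: "0 < d" "\<And>x y. x \<in> closure \<Omega> \<Longrightarrow> y \<in> closure \<Omega> \<Longrightarrow> dist x y < d \<Longrightarrow> dist (G x) (G y) < e'"
    using e'(1) unfolding uniformly_continuous_on_def by (metis dist_commute)
  show thesis
  proof (rule that [of "min \<eta> d"])
    show "0 < min \<eta> d" using d \<eta> by simp
    fix \<T> assume F: "\<T> \<in> \<F>" and m: "mesh_size \<T> < min \<eta> d"
    have tri: "triangulation_of \<T> \<Omega>" using fam F by (auto simp: qu_sr_family_def)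
    obtain v where v: "v \<in> P1_space \<Omega> \<T>" "\<And>x. \<bar>v x - \<phi> x\<bar> \<le> e"
      and rep: "\<And>T. T \<in> \<T> \<Longrightarrow> interpolates_on_simplex \<phi> v T"
      using \<eta>(2) [OF F] m by auto
    have "\<exists>a b. (\<forall>x\<in>T. v x = a \<bullet> x + b) \<and> (\<forall>x\<in>T. norm (a - G x) \<le> e)" if T: "T \<in> \<T>" for T
    proof -
      obtain C a b where C: "\<not> affine_dependent C" "card C = DIM('a) + 1" "T = convex hull C"
        "\<forall>x\<in>T. v x = a \<bullet> x + b" "\<And>c. c \<in> C \<Longrightarrow> a \<bullet> c + b = \<phi> c"
        using rep [OF T] unfolding interpolates_on_simplex_def by blast
      have osc: "norm (G x - G y) \<le> e'" if "x \<in> T" "y \<in> T" for x y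
      proof -
        have sub: "T \<subseteq> closure \<Omega>" using tri T by (auto simp: triangulation_of_def)
        then have "bounded T" using \<Omega>(2) bounded_closure bounded_subset by blast
        then have "dist x y \<le> diameter T" using that by (intro diameter_bounded_bound)
        then have "dist x y < d" using diameter_le_mesh_size [OF tri T] m by simp
        then have "dist (G x) (G y) < e'" using d(2) sub that by blast
        then show ?thesis by (simp add: dist_norm)
      qed
      have "norm (a - G x) \<le> e" if "x \<in> T" for x
        using interpolation_gradient_error [OF aff_independent_finite [OF C(1)] C(2,3) \<kappa> [OF F T] G(1) osc C(5) that] e'(2)
        by linarith
      then show ?thesis using C(4) by blast
    qed
    then show "\<exists>v\<in>P1_space \<Omega> \<T>. (\<forall>x. \<bar>v x - \<phi> x\<bar> \<le> e) \<and>
      (\<forall>T\<in>\<T>. \<exists>a b. (\<forall>x\<in>T. v x = a \<bullet> x + b) \<and> (\<forall>x\<in>T. norm (a - G x) \<le> e))"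
      using v by blast
  qed
qed

section \<open>Test functions\<close>

text \<open>Integration by parts in one direction uses differentiability along that direction only,
  which products with C^1 bumps preserve.\<close>

definition has_dir_deriv :: "'a::real_normed_vector \<Rightarrow> ('a \<Rightarrow> real) \<Rightarrow> ('a \<Rightarrow> real) \<Rightarrow> bool" where
  "has_dir_deriv e G G' \<longleftrightarrow> (\<forall>x. ((\<lambda>t. G (x + t *\<^sub>R e)) has_real_derivative G' x) (at 0))"

lemma has_dir_derivD:
  assumes "has_dir_deriv e G G'"
  shows "((\<lambda>t. G (x + t *\<^sub>R e)) has_real_derivative G' (x + s *\<^sub>R e)) (at s)"
proof -
  have "((\<lambda>t. G ((x + s *\<^sub>R e) + t *\<^sub>R e)) has_real_derivative G' (x + s *\<^sub>R e)) (at 0)"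
    using assms by (simp add: has_dir_deriv_def)
  moreover have "(\<lambda>t. G ((x + s *\<^sub>R e) + t *\<^sub>R e)) = (\<lambda>t. G (x + (t + s) *\<^sub>R e))"
    by (simp add: algebra_simps)
  ultimately show ?thesis
    using DERIV_shift [of "\<lambda>t. G (x + t *\<^sub>R e)" "G' (x + s *\<^sub>R e)" 0 s] by simp
qed

lemma has_dir_deriv_mult:
  assumes "has_dir_deriv e F F'" "has_dir_deriv e G G'"
  shows "has_dir_deriv e (\<lambda>x. F x * G x) (\<lambda>x. F' x * G x + F x * G' x)"
  using assms unfolding has_dir_deriv_def
  by (auto intro!: derivative_eq_intros)

lemma has_dir_deriv_affine:
  "has_dir_deriv e (\<lambda>x. a \<bullet> x + b) (\<lambda>_. a \<bullet> e)"
  unfolding has_dir_deriv_def inner_add_right inner_scaleR_right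
  by (auto intro!: derivative_eq_intros)

lemma has_dir_deriv_diff:
  assumes "has_dir_deriv e F F'" "has_dir_deriv e G G'"
  shows "has_dir_deriv e (\<lambda>x. F x - G x) (\<lambda>x. F' x - G' x)"
  using assms unfolding has_dir_deriv_def by (auto intro!: derivative_intros)

lemma has_dir_deriv_real_polynomial_function:
  assumes "real_polynomial_function P"
  shows "\<exists>P'. continuous_on UNIV P' \<and> has_dir_deriv e P P'"
  using assms
proof (induction P rule: real_polynomial_function.induct)
  case (linear f)
  interpret bounded_linear f by fact
  show ?case
    by (intro exI [of _ "\<lambda>_. f e"])
      (auto simp: has_dir_deriv_def add scaleR intro!: derivative_eq_intros)
next
  case (const c)
  show ?case by (intro exI [of _ "\<lambda>_. 0"]) (auto simp: has_dir_deriv_def)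
next
  case (add f g)
  then obtain f' g' where "continuous_on UNIV f'" "has_dir_deriv e f f'" "continuous_on UNIV g'" "has_dir_deriv e g g'"
    by blast
  then show ?case
    by (intro exI [of _ "\<lambda>x. f' x + g' x"])
      (auto simp: has_dir_deriv_def intro!: derivative_intros continuous_intros)
next
  case (mult f g)
  then obtain f' g' where "continuous_on UNIV f'" "has_dir_deriv e f f'" "continuous_on UNIV g'" "has_dir_deriv e g g'"
    by blast
  moreover have "continuous_on UNIV f" "continuous_on UNIV g"
    using mult.hyps continuous_on_polymonial_function real_polynomial_function_eq by blast+
  ultimately show ?case
    by (intro exI [of _ "\<lambda>x. f' x * g x + f x * g' x"])
      (auto intro!: has_dir_deriv_mult continuous_intros)
qed

lemma has_dir_deriv_zero_outside:
  assumes "has_dir_deriv e G G'" "closed K" "\<And>x. x \<notin> K \<Longrightarrow> G x = 0" "x \<notin> K"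
  shows "G' x = 0"
proof -
  have "open ((\<lambda>t. x + t *\<^sub>R e) -` (- K))"
    using assms(2) by (intro open_vimage continuous_intros) (auto simp: open_Compl)
  then have "eventually (\<lambda>t. t \<in> (\<lambda>t. x + t *\<^sub>R e) -` (- K)) (nhds 0)"
    using assms(4) by (intro eventually_nhds_in_open) auto
  then have "eventually (\<lambda>t. G (x + t *\<^sub>R e) = 0) (nhds 0)"
    by eventually_elim (use assms(3) in auto)
  then have "((\<lambda>t. G (x + t *\<^sub>R e)) has_real_derivative 0) (at 0)"
    by (subst DERIV_cong_ev [OF refl _ refl, of _ "\<lambda>_. 0"]) auto
  then show ?thesis
    using assms(1) DERIV_unique unfolding has_dir_deriv_def by blast
qed

lemma integrable_continuous_compact_support:
  fixes G :: "'a::euclidean_space \<Rightarrow> real"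
  assumes "continuous_on UNIV G" "compact K" "\<And>x. x \<notin> K \<Longrightarrow> G x = 0"
  shows "integrable lborel G"
proof -
  have "integrable lborel (\<lambda>x. indicator K x *\<^sub>R G x)"
    using borel_integrable_compact [OF assms(2) continuous_on_subset [OF assms(1)]]
    by (simp add: set_integrable_def)
  moreover have "(\<lambda>x. indicator K x *\<^sub>R G x) = G"
    using assms(3) by (auto simp: fun_eq_iff indicator_def)
  ultimately show ?thesis by simp
qed

lemma bounded_compact_support:
  fixes G :: "'a::euclidean_space \<Rightarrow> real"
  assumes "continuous_on UNIV G" "compact K" "\<And>x. x \<notin> K \<Longrightarrow> G x = 0"
  obtains B where "0 \<le> B" "\<And>x. \<bar>G x\<bar> \<le> B"
proof -
  have "compact (G ` K)" using assms by (intro compact_continuous_image continuous_on_subset [OF assms(1)]) auto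
  then obtain B where B: "\<And>y. y \<in> G ` K \<Longrightarrow> norm y \<le> B" using compact_imp_bounded bounded_iff by metis
  have "\<bar>G x\<bar> \<le> \<bar>B\<bar>" for x
    using B [of "G x"] assms(3) [of x] by (cases "x \<in> K") auto
  then show thesis using that [of "\<bar>B\<bar>"] by auto
qed

text \<open>Translation invariance gives every difference quotient of \<open>G\<close> the integral
  0, and dominated convergence passes this to \<open>G'\<close>. The mean value theorem supplies the
  uniform bound.\<close>

lemma integral_dir_deriv_eq_0:
  fixes G G' :: "'a::euclidean_space \<Rightarrow> real"
  assumes D: "has_dir_deriv e G G'" and cont: "continuous_on UNIV G" "continuous_on UNIV G'"
    and K: "compact K" and supp: "\<And>x. x \<notin> K \<Longrightarrow> G x = 0"
  shows "integral\<^sup>L lborel G' = 0"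
proof -
  have supp': "G' x = 0" if "x \<notin> K" for x
    using has_dir_deriv_zero_outside [OF D compact_imp_closed [OF K] supp that] .
  obtain B where B: "0 \<le> B" "\<And>x. \<bar>G' x\<bar> \<le> B"
    using bounded_compact_support [OF cont(2) K supp'] by blast
  obtain R where R: "\<And>x. x \<in> K \<Longrightarrow> norm x \<le> R"
    using compact_imp_bounded [OF K] by (auto simp: bounded_iff)
  \<comment> \<open>The steps 1 / (n + 1) move points by at most |e|, so all difference quotients
    vanish outside this ball.\<close>
  define S where "S = cball (0::'a) (R + norm e)"
  define q where "q n x = real (Suc n) * (G (x + (1 / real (Suc n)) *\<^sub>R e) - G x)" for n x
  have [measurable]: "G \<in> borel_measurable borel" "G' \<in> borel_measurable borel"
    using cont by (auto intro: borel_measurable_continuous_onI)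
  have q_le: "\<bar>q n x\<bar> \<le> B" for n x
  proof -
    define s where "s = 1 / real (Suc n)"
    have s: "0 < s" by (simp add: s_def)
    have "\<exists>z. 0 < z \<and> z < s \<and> G (x + s *\<^sub>R e) - G (x + 0 *\<^sub>R e) = (s - 0) * G' (x + z *\<^sub>R e)"
      by (rule MVT2 [OF s, of "\<lambda>t. G (x + t *\<^sub>R e)" "\<lambda>t. G' (x + t *\<^sub>R e)"]) (use has_dir_derivD [OF D] in auto)
    then obtain z where "G (x + s *\<^sub>R e) - G x = s * G' (x + z *\<^sub>R e)" by auto
    then have "q n x = G' (x + z *\<^sub>R e)" by (simp add: q_def s_def)
    then show ?thesis using B by simp
  qed
  have "(\<lambda>n. integral\<^sup>L lborel (q n)) \<longlonglongrightarrow> integral\<^sup>L lborel G'"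
  proof (rule integral_dominated_convergence [where w = "\<lambda>x. B * indicator S x"])
    show "integrable lborel (\<lambda>x. B * indicator S x)"
      unfolding S_def by (intro integrable_mult_right integrable_real_indicator) (use emeasure_bounded_finite [OF bounded_cball, of 0 "R + norm e"] in auto)
    show "AE x in lborel. (\<lambda>n. q n x) \<longlonglongrightarrow> G' x"
    proof (intro AE_I2)
      fix x
      have "((\<lambda>t. (G (x + t *\<^sub>R e) - G x) / t) \<longlongrightarrow> G' x) (at 0)"
        using D by (simp add: has_dir_deriv_def has_field_derivative_iff)
      moreover have "filterlim (\<lambda>n. 1 / real (Suc n)) (at 0) sequentially"
        using LIMSEQ_inverse_real_of_nat by (auto simp: filterlim_at divide_inverse)
      ultimately have "(\<lambda>n. (G (x + (1 / real (Suc n)) *\<^sub>R e) - G x) / (1 / real (Suc n))) \<longlonglongrightarrow> G' x"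
        by (rule filterlim_compose)
      then show "(\<lambda>n. q n x) \<longlonglongrightarrow> G' x" by (simp add: q_def mult.commute)
    qed
    show "AE x in lborel. norm (q n x) \<le> B * indicator S x" for n
    proof (intro AE_I2)
      fix x
      show "norm (q n x) \<le> B * indicator S x"
      proof (cases "x \<in> S")
        case False
        then have nx: "norm x > R + norm e" by (simp add: S_def)
        have "norm x \<le> norm (x + (1 / real (Suc n)) *\<^sub>R e) + norm ((1 / real (Suc n)) *\<^sub>R e)"
          by (metis add_diff_cancel_right' norm_triangle_ineq4)
        also have "norm ((1 / real (Suc n)) *\<^sub>R e) \<le> norm e"
          using mult_right_mono [of "1 / real (Suc n)" 1 "norm e"] by simp
        finally have "x + (1 / real (Suc n)) *\<^sub>R e \<notin> K" using R nx by fastforce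
        moreover have "x \<notin> K" using R [of x] nx norm_ge_zero [of e] by linarith
        ultimately show ?thesis using supp False by (simp add: q_def)
      qed (use q_le in auto)
    qed
  qed (auto simp: q_def [abs_def])
  moreover have "integral\<^sup>L lborel (q n) = 0" for n
  proof -
    have int: "integrable lborel G" by (rule integrable_continuous_compact_support [OF cont(1) K supp])
    let ?c = "(1 / real (Suc n)) *\<^sub>R e"
    have tr: "integrable lborel (\<lambda>x. G (x + ?c)) \<and> integral\<^sup>L lborel (\<lambda>x. G (x + ?c)) = integral\<^sup>L lborel G"
    proof
      have eq: "(\<lambda>x. G (x + ?c)) = (\<lambda>x. G (?c + x))" by (simp add: add.commute)
      have "integrable (distr lborel borel ((+) ?c)) G" using int by (simp add: lborel_distr_plus)
      then show "integrable lborel (\<lambda>x. G (x + ?c))" unfolding eq by (subst (asm) integrable_distr_eq) auto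
      have "integral\<^sup>L lborel G = integral\<^sup>L (distr lborel borel ((+) ?c)) G" by (simp add: lborel_distr_plus)
      also have "\<dots> = integral\<^sup>L lborel (\<lambda>x. G (x + ?c))" unfolding eq by (subst integral_distr) auto
      finally show "integral\<^sup>L lborel (\<lambda>x. G (x + ?c)) = integral\<^sup>L lborel G" ..
    qed
    then show ?thesis unfolding q_def using int by simp
  qed
  ultimately show ?thesis by (simp add: LIMSEQ_const_iff)
qed

text \<open>The square of the positive part is C^1 across 0, so the bump has a continuous derivative
  at its boundary sphere.\<close>

lemma has_dir_deriv_bump:
  fixes c :: "'a::euclidean_space"
  shows "has_dir_deriv e (\<lambda>x. (max 0 (r\<^sup>2 - (norm (x - c))\<^sup>2))\<^sup>2)
     (\<lambda>x. 2 * max 0 (r\<^sup>2 - (norm (x - c))\<^sup>2) * (- 2 * ((x - c) \<bullet> e)))"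
proof -
  have sq: "((\<lambda>y. (max 0 y)\<^sup>2) has_real_derivative 2 * max 0 y) (at y)" for y :: real
  proof -
    consider "y > 0" | "y < 0" | "y = 0" by linarith
    then show ?thesis
    proof cases
      case 1
      have "((\<lambda>y. y\<^sup>2) has_real_derivative 2 * y) (at y)" by (auto intro!: derivative_eq_intros)
      moreover have "eventually (\<lambda>z. (max 0 z)\<^sup>2 = z\<^sup>2) (nhds y)"
        using eventually_nhds_in_open [of "{0<..}" y] 1 by (auto elim!: eventually_mono)
      ultimately show ?thesis using 1 by (subst DERIV_cong_ev [OF refl _ refl]) auto
    next
      case 2
      have "eventually (\<lambda>z. (max 0 z)\<^sup>2 = 0) (nhds y)"
        using eventually_nhds_in_open [of "{..<0}" y] 2 by (auto elim!: eventually_mono)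
      then show ?thesis using 2 by (subst DERIV_cong_ev [OF refl _ refl, of _ "\<lambda>_. 0"]) auto
    next
      case 3
      have "((\<lambda>h. (max 0 h)\<^sup>2 / h) \<longlongrightarrow> 0) (at (0::real))"
      proof (rule Lim_null_comparison)
        show "\<forall>\<^sub>F h in at (0::real). norm ((max 0 h)\<^sup>2 / h) \<le> \<bar>h\<bar>"
          by (intro always_eventually allI) (auto simp: max_def power2_eq_square)
        show "((\<lambda>h::real. \<bar>h\<bar>) \<longlongrightarrow> 0) (at 0)" by (auto intro!: tendsto_eq_intros)
      qed
      then show ?thesis using 3 by (simp add: has_field_derivative_iff)
    qed
  qed
  have "((\<lambda>t. r\<^sup>2 - (norm (x + t *\<^sub>R e - c))\<^sup>2) has_real_derivative - 2 * ((x - c) \<bullet> e)) (at 0)" for x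
  proof -
    have eq: "r\<^sup>2 - (norm (x + t *\<^sub>R e - c))\<^sup>2
        = r\<^sup>2 - ((x - c) \<bullet> (x - c) + t * (2 * ((x - c) \<bullet> e)) + t\<^sup>2 * (e \<bullet> e))" for t
      unfolding power2_norm_eq_inner
      by (simp add: inner_add inner_diff inner_commute algebra_simps power2_eq_square)
    show ?thesis unfolding eq by (auto intro!: derivative_eq_intros)
  qed
  then show ?thesis
    unfolding has_dir_deriv_def using DERIV_chain2 [OF sq] by fastforce
qed

text \<open>The fundamental lemma with C^1 test functions. On a ball, orthogonality to a bump F
  times polynomials extends by Stone-Weierstrass to F times continuous functions, and by
  approximating the sign of \<open>h\<close> it makes the integral of |h F| vanish; F is positive
  inside the ball.\<close>

lemma AE_zero_if_orthogonal_to_test_functions: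
  fixes h :: "'a::euclidean_space \<Rightarrow> real"
  assumes U: "open U" and h [measurable]: "h \<in> borel_measurable lebesgue"
    and loc: "\<And>K. compact K \<Longrightarrow> K \<subseteq> U \<Longrightarrow> set_integrable lebesgue K h"
    and orth: "\<And>\<psi> \<psi>' K. compact K \<Longrightarrow> K \<subseteq> U \<Longrightarrow> (\<And>x. x \<notin> K \<Longrightarrow> \<psi> x = 0) \<Longrightarrow>
      continuous_on UNIV \<psi> \<Longrightarrow> continuous_on UNIV \<psi>' \<Longrightarrow> has_dir_deriv e \<psi> \<psi>' \<Longrightarrow>
      integral\<^sup>L lebesgue (\<lambda>x. h x * \<psi> x) = 0"
  shows "AE x in lebesgue. x \<in> U \<longrightarrow> h x = 0"
proof -
  have ball: "negligible {x \<in> ball c r. h x \<noteq> 0}" if c: "0 < r" "cball c r \<subseteq> U" for c r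
  proof -
    define F where "F x = (max 0 (r\<^sup>2 - (norm (x - c))\<^sup>2))\<^sup>2" for x
    have F: "continuous_on UNIV F" unfolding F_def by (intro continuous_intros)
    have F0: "F x = 0" if "x \<notin> cball c r" for x
    proof -
      have "r < norm (x - c)" using that by (simp add: dist_norm norm_minus_commute)
      then have "r\<^sup>2 < (norm (x - c))\<^sup>2" using c by (intro power_strict_mono) auto
      then show ?thesis by (simp add: F_def)
    qed
    have Fpos: "0 < F x" if "x \<in> ball c r" for x
    proof -
      have "norm (x - c) < r" using that by (simp add: dist_norm norm_minus_commute)
      then have "(norm (x - c))\<^sup>2 < r\<^sup>2" by (intro power_strict_mono) auto
      then show ?thesis by (simp add: F_def)
    qed
    have [measurable]: "F \<in> borel_measurable lebesgue"
      by (rule continuous_imp_lebesgue_measurable [OF F])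
    obtain B where B: "0 \<le> B" "\<And>x. \<bar>F x\<bar> \<le> B"
      using bounded_compact_support [OF F compact_cball F0] by blast
    have intK: "integrable lebesgue (\<lambda>x. indicator (cball c r) x *\<^sub>R h x)"
      using loc [OF compact_cball c(2)] by (simp add: set_integrable_def)
    have int_mult: "integrable lebesgue (\<lambda>x. h x * F x * s x)"
      if s [measurable]: "s \<in> borel_measurable lebesgue" and b: "\<And>x. x \<in> cball c r \<Longrightarrow> \<bar>s x\<bar> \<le> m" for s m
    proof (rule Bochner_Integration.integrable_bound)
      show "integrable lebesgue (\<lambda>x. (B * m) * (indicator (cball c r) x *\<^sub>R h x))"
        using intK by simp
      show "AE x in lebesgue. norm (h x * F x * s x) \<le> norm ((B * m) * (indicator (cball c r) x *\<^sub>R h x))"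
      proof (intro AE_I2)
        fix x
        show "norm (h x * F x * s x) \<le> norm ((B * m) * (indicator (cball c r) x *\<^sub>R h x))"
        proof (cases "x \<in> cball c r")
          case True
          have "\<bar>h x\<bar> * (\<bar>F x\<bar> * \<bar>s x\<bar>) \<le> \<bar>h x\<bar> * (B * \<bar>m\<bar>)"
            using B b [OF True] by (intro mult_left_mono mult_mono) auto
          then show ?thesis using True B by (simp add: abs_mult mult_ac)
        qed (simp add: F0)
      qed
    qed auto
    \<comment> \<open>A uniform error epsilon in the factor that multiplies h F costs at most
      epsilon J.\<close>
    define J where "J = integral\<^sup>L lebesgue (\<lambda>x. \<bar>h x * F x * 1\<bar>)"
    have poly: "integral\<^sup>L lebesgue (\<lambda>x. h x * F x * P x) = 0" if P: "real_polynomial_function P" for P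
    proof -
      obtain P' where P': "continuous_on UNIV P'" "has_dir_deriv e P P'"
        using has_dir_deriv_real_polynomial_function [OF P] by blast
      have Pc: "continuous_on UNIV P"
        using P continuous_on_polymonial_function real_polynomial_function_eq by blast
      have "integral\<^sup>L lebesgue (\<lambda>x. h x * (F x * P x)) = 0"
        by (rule orth [OF compact_cball c(2) _ _ _
            has_dir_deriv_mult [OF has_dir_deriv_bump [of e r c, folded F_def] P'(2)]])
          (use F0 F Pc P'(1) in \<open>auto intro!: continuous_intros\<close>)
      then show ?thesis by (simp add: mult.assoc)
    qed
    have cont: "integral\<^sup>L lebesgue (\<lambda>x. h x * F x * s x) = 0" if s: "continuous_on UNIV s" for s
    proof -
      have [measurable]: "s \<in> borel_measurable lebesgue"
        by (rule continuous_imp_lebesgue_measurable [OF s])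
      have bs: "\<exists>m. \<forall>x\<in>cball c r. \<bar>g x\<bar> \<le> m" if "continuous_on UNIV g" for g :: "'a \<Rightarrow> real"
      proof -
        have "compact (g ` cball c r)"
          by (intro compact_continuous_image continuous_on_subset [OF that]) auto
        then show ?thesis using compact_imp_bounded by (force simp: bounded_iff)
      qed
      have "\<bar>integral\<^sup>L lebesgue (\<lambda>x. h x * F x * s x)\<bar> \<le> \<epsilon> * J" if \<epsilon>: "0 < \<epsilon>" for \<epsilon>
      proof -
        obtain P where P: "real_polynomial_function P" "\<And>x. x \<in> cball c r \<Longrightarrow> \<bar>s x - P x\<bar> < \<epsilon>"
          using Stone_Weierstrass_real_polynomial_function [OF compact_cball continuous_on_subset [OF s] \<epsilon>, of c r] by auto
        have Pc: "continuous_on UNIV P"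
          using P continuous_on_polymonial_function real_polynomial_function_eq by blast
        have [measurable]: "P \<in> borel_measurable lebesgue"
          by (rule continuous_imp_lebesgue_measurable [OF Pc])
        obtain m m' where m: "\<forall>x\<in>cball c r. \<bar>s x\<bar> \<le> m" "\<forall>x\<in>cball c r. \<bar>P x\<bar> \<le> m'"
          using bs [OF s] bs [OF Pc] by blast
        have ints: "integrable lebesgue (\<lambda>x. h x * F x * s x)" "integrable lebesgue (\<lambda>x. h x * F x * P x)"
          "integrable lebesgue (\<lambda>x. h x * F x)"
          using m by (blast intro: int_mult [of s m] int_mult [of P m'] int_mult [of "\<lambda>_. 1" 1, simplified] \<open>s \<in> borel_measurable lebesgue\<close> \<open>P \<in> borel_measurable lebesgue\<close>)+
        have "integral\<^sup>L lebesgue (\<lambda>x. h x * F x * s x)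
            = integral\<^sup>L lebesgue (\<lambda>x. h x * F x * s x - h x * F x * P x)"
          using ints poly [OF P(1)] by simp
        also have "\<bar>\<dots>\<bar> \<le> integral\<^sup>L lebesgue (\<lambda>x. \<bar>h x * F x * s x - h x * F x * P x\<bar>)"
          by (rule integral_abs_bound)
        also have "\<dots> \<le> integral\<^sup>L lebesgue (\<lambda>x. \<epsilon> * \<bar>h x * F x * 1\<bar>)"
        proof (rule integral_mono)
          fix x
          show "\<bar>h x * F x * s x - h x * F x * P x\<bar> \<le> \<epsilon> * \<bar>h x * F x * 1\<bar>"
          proof (cases "x \<in> cball c r")
            case True
            have "\<bar>h x * F x * s x - h x * F x * P x\<bar> = \<bar>h x * F x\<bar> * \<bar>s x - P x\<bar>"
              by (simp add: abs_mult [symmetric] right_diff_distrib)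
            also have "\<dots> \<le> \<bar>h x * F x\<bar> * \<epsilon>" using P(2) [OF True] by (intro mult_left_mono) auto
            finally show ?thesis by (simp add: mult.commute)
          qed (simp add: F0)
        qed (use ints in auto)
        also have "\<dots> = \<epsilon> * J" by (simp add: J_def)
        finally show ?thesis .
      qed
      note bound = this
      have "((\<lambda>\<epsilon>. \<epsilon> * J) \<longlongrightarrow> 0 * J) (at_right 0)" by (intro tendsto_intros)
      then have "\<bar>integral\<^sup>L lebesgue (\<lambda>x. h x * F x * s x)\<bar> \<le> 0 * J"
        by (rule tendsto_lowerbound) (auto intro!: eventually_at_rightI [of 0 1] bound)
      then show ?thesis by simp
    qed
    \<comment> \<open>The sign of \<open>h\<close> is almost everywhere a limit of continuous
      functions; clipping them to [-1, 1] gives the majorant |h F|.\<close>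
    have "(\<lambda>x. sgn (h x)) measurable_on UNIV"
      by (intro lebesgue_measurable_imp_measurable_on) auto
    then obtain N g where g: "negligible N" "\<And>n. continuous_on UNIV (g n)"
      "\<And>x. x \<notin> N \<Longrightarrow> (\<lambda>n. g n x) \<longlonglongrightarrow> sgn (h x)"
      by (auto simp: measurable_on_def)
    define s where "s n x = max (- 1) (min 1 (g n x))" for n x
    have s: "continuous_on UNIV (s n)" for n unfolding s_def by (intro continuous_intros g)
    have [measurable]: "s n \<in> borel_measurable lebesgue" for n
      by (rule continuous_imp_lebesgue_measurable [OF s])
    have "(\<lambda>n. integral\<^sup>L lebesgue (\<lambda>x. h x * F x * s n x)) \<longlonglongrightarrow> integral\<^sup>L lebesgue (\<lambda>x. \<bar>h x * F x\<bar>)"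
    proof (rule integral_dominated_convergence [where w = "\<lambda>x. \<bar>h x * F x * 1\<bar>"])
      show "integrable lebesgue (\<lambda>x. \<bar>h x * F x * 1\<bar>)" by (intro integrable_abs int_mult) auto
      have "\<bar>s n x\<bar> \<le> 1" for n x by (auto simp: s_def)
      then show "AE x in lebesgue. norm (h x * F x * s n x) \<le> \<bar>h x * F x * 1\<bar>" for n
        by (intro AE_I2) (auto simp: abs_mult mult_left_le)
      have "AE x in lebesgue. x \<notin> N" using g(1) by (simp add: negligible_iff_null_sets AE_not_in)
      then show "AE x in lebesgue. (\<lambda>n. h x * F x * s n x) \<longlonglongrightarrow> \<bar>h x * F x\<bar>"
      proof eventually_elim
        case (elim x)
        have "(\<lambda>n. s n x) \<longlonglongrightarrow> max (- 1) (min 1 (sgn (h x)))"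
          unfolding s_def using g(3) [OF elim] by (intro tendsto_intros)
        also have "max (- 1) (min 1 (sgn (h x))) = sgn (h x)" by (simp add: sgn_if)
        finally have "(\<lambda>n. h x * F x * s n x) \<longlonglongrightarrow> h x * F x * sgn (h x)" by (intro tendsto_intros)
        moreover have "h x * F x * sgn (h x) = \<bar>h x * F x\<bar>"
        proof -
          have "0 \<le> F x" by (simp add: F_def)
          then have "\<bar>h x * F x\<bar> = \<bar>h x\<bar> * F x" by (simp add: abs_mult)
          also have "\<dots> = (h x * sgn (h x)) * F x" by (simp only: abs_sgn)
          finally show ?thesis by (simp only: mult_ac)
        qed
        ultimately show ?case by simp
      qed
    qed auto
    then have "integral\<^sup>L lebesgue (\<lambda>x. \<bar>h x * F x\<bar>) = 0"
      using cont [OF s] by (simp add: LIMSEQ_const_iff)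
    moreover have "integrable lebesgue (\<lambda>x. \<bar>h x * F x\<bar>)"
      using int_mult [of "\<lambda>_. 1" 1] by auto
    ultimately have "AE x in lebesgue. \<bar>h x * F x\<bar> = 0"
      by (subst (asm) integral_nonneg_eq_0_iff_AE) auto
    then have "AE x in lebesgue. x \<notin> {x \<in> ball c r. h x \<noteq> 0}"
      by eventually_elim (use Fpos in force)
    moreover have "ball c r \<inter> (h -` (- {0}) \<inter> space lebesgue) \<in> sets lebesgue"
      by (intro sets.Int measurable_sets [OF h]) auto
    moreover have "ball c r \<inter> (h -` (- {0}) \<inter> space lebesgue) = {x \<in> ball c r. h x \<noteq> 0}" by auto
    ultimately show ?thesis
      by (metis negligible_iff_null_sets AE_iff_null_sets)
  qed
  define N where "N = {x \<in> U. h x \<noteq> 0}"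
  \<comment> \<open>Negligibility is a local property, which spares the choice of a countable cover
    by balls.\<close>
  have "negligible N"
  proof (subst locally_negligible_alt, intro ballI)
    fix x assume x: "x \<in> N"
    then obtain r where r: "0 < r" "cball x r \<subseteq> U" using U unfolding open_contains_cball N_def by blast
    show "\<exists>V. openin (top_of_set N) V \<and> x \<in> V \<and> negligible V"
    proof (intro exI conjI)
      show "openin (top_of_set N) (N \<inter> ball x r)" by (simp add: openin_open_Int)
      show "x \<in> N \<inter> ball x r" using x r by simp
      show "negligible (N \<inter> ball x r)"
        by (rule negligible_subset [OF ball [OF r]]) (auto simp: N_def)
    qed
  qed
  then have "AE x in lebesgue. x \<notin> N" by (simp add: negligible_iff_null_sets AE_not_in)
  then show ?thesis by eventually_elim (auto simp: N_def)
qed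

section \<open>The space of weakly differentiable functions\<close>

lemma Cc_inf_has_derivative:
  fixes \<phi> :: "'a::euclidean_space \<Rightarrow> real"
  assumes "\<phi> \<in> Cc_inf \<Omega>"
  shows "(\<phi> has_derivative (\<lambda>h. grad \<phi> x \<bullet> h)) (at x)"
proof -
  define L where "L = frechet_derivative \<phi> (at x)"
  have "\<phi> differentiable (at x)"
    using assms iter_partials.base by (auto simp: Cc_inf_def smooth_fun_def)
  then have L: "(\<phi> has_derivative L) (at x)" by (simp add: L_def frechet_derivative_works)
  then have lin: "linear L" by (rule has_derivative_linear)
  have "L h = grad \<phi> x \<bullet> h" for h
  proof -
    have "L h = L (\<Sum>i\<in>Basis. (h \<bullet> i) *\<^sub>R i)" by (simp add: euclidean_representation)
    also have "\<dots> = (\<Sum>i\<in>Basis. (h \<bullet> i) * L i)"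
      by (simp add: linear_sum [OF lin] linear_scale [OF lin])
    also have "\<dots> = grad \<phi> x \<bullet> h"
      unfolding grad_def partial_deriv_def L_def inner_sum_left inner_scaleR_left
      by (intro sum.cong refl) (simp add: inner_commute mult.commute)
    finally show ?thesis .
  qed
  then have "L = (\<lambda>h. grad \<phi> x \<bullet> h)" by blast
  then show ?thesis using L by simp
qed

lemma Cc_inf_continuous_grad:
  assumes "\<phi> \<in> Cc_inf \<Omega>" shows "continuous_on UNIV (grad \<phi>)"
proof -
  have "continuous_on UNIV (partial_deriv i \<phi>)" if "i \<in> Basis" for i
  proof -
    have "partial_deriv i \<phi> \<in> iter_partials \<phi>" using that by (intro iter_partials.intros)
    then have "partial_deriv i \<phi> differentiable (at x)" for x
      using assms by (auto simp: Cc_inf_def smooth_fun_def)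
    then show ?thesis
      by (simp add: continuous_at_imp_continuous_on differentiable_imp_continuous_within)
  qed
  then show ?thesis unfolding grad_def by (intro continuous_intros) auto
qed

lemma Cc_inf_continuous:
  assumes "\<phi> \<in> Cc_inf \<Omega>" shows "continuous_on UNIV \<phi>"
  using Cc_inf_has_derivative [OF assms] has_derivative_continuous continuous_at_imp_continuous_on by blast

lemma Cc_inf_has_dir_deriv:
  assumes "\<phi> \<in> Cc_inf \<Omega>" shows "has_dir_deriv e \<phi> (\<lambda>x. grad \<phi> x \<bullet> e)"
  unfolding has_dir_deriv_def
proof
  fix x
  have 1: "((\<lambda>t. x + t *\<^sub>R e) has_derivative (\<lambda>t. t *\<^sub>R e)) (at 0)"
    by (auto intro!: derivative_eq_intros)
  have "((\<lambda>t. \<phi> (x + t *\<^sub>R e)) has_derivative (\<lambda>t. grad \<phi> x \<bullet> (t *\<^sub>R e))) (at 0)"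
    using has_derivative_compose [OF 1, of \<phi> "\<lambda>h. grad \<phi> x \<bullet> h"] Cc_inf_has_derivative [OF assms, of x] by simp
  then show "((\<lambda>t. \<phi> (x + t *\<^sub>R e)) has_real_derivative grad \<phi> x \<bullet> e) (at 0)"
    by (simp add: has_field_derivative_def mult.commute [of _ "grad \<phi> x \<bullet> e"])
qed

lemma grad_zero_outside:
  assumes "\<phi> \<in> Cc_inf \<Omega>" "closed K" "\<And>x. x \<notin> K \<Longrightarrow> \<phi> x = 0" "x \<notin> K"
  shows "grad \<phi> x = 0"
  using has_dir_deriv_zero_outside [OF Cc_inf_has_dir_deriv [OF assms(1), of "grad \<phi> x"] assms(2-4)] by simp

text \<open>Smoothness is stated through all iterated partials, so each one of the combination is
  matched with partials of the two functions along the same sequence of directions.\<close>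

lemma iter_partials_lincomb:
  fixes \<phi> \<psi> :: "'a::euclidean_space \<Rightarrow> real"
  assumes "smooth_fun \<phi>" "smooth_fun \<psi>" "k \<in> iter_partials (\<lambda>x. \<alpha> * \<phi> x + \<beta> * \<psi> x)"
  shows "\<exists>g\<in>iter_partials \<phi>. \<exists>h\<in>iter_partials \<psi>. k = (\<lambda>x. \<alpha> * g x + \<beta> * h x)"
  using assms(3)
proof induction
  case base
  then show ?case using iter_partials.base by blast
next
  case (step k i)
  then obtain g h where gh: "g \<in> iter_partials \<phi>" "h \<in> iter_partials \<psi>" "k = (\<lambda>x. \<alpha> * g x + \<beta> * h x)"
    by blast
  have d: "g differentiable (at x)" "h differentiable (at x)" for x
    using assms(1,2) gh by (auto simp: smooth_fun_def)
  have "partial_deriv i k = (\<lambda>x. \<alpha> * partial_deriv i g x + \<beta> * partial_deriv i h x)"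
  proof
    fix x
    have "(k has_derivative (\<lambda>y. \<alpha> * frechet_derivative g (at x) y + \<beta> * frechet_derivative h (at x) y)) (at x)"
      unfolding gh(3) using d [of x] by (intro derivative_intros) (simp_all add: frechet_derivative_works)
    from frechet_derivative_at [OF this]
    show "partial_deriv i k x = \<alpha> * partial_deriv i g x + \<beta> * partial_deriv i h x"
      by (simp add: partial_deriv_def fun_eq_iff)
  qed
  then show ?case using gh step.hyps iter_partials.step by blast
qed

lemma Cc_inf_lincomb:
  assumes \<phi>: "\<phi> \<in> Cc_inf \<Omega>" and \<psi>: "\<psi> \<in> Cc_inf \<Omega>"
  shows "(\<lambda>x. \<alpha> * \<phi> x + \<beta> * \<psi> x) \<in> Cc_inf \<Omega>"
proof -
  have sm: "smooth_fun \<phi>" "smooth_fun \<psi>" using assms by (auto simp: Cc_inf_def)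
  have "smooth_fun (\<lambda>x. \<alpha> * \<phi> x + \<beta> * \<psi> x)"
    unfolding smooth_fun_def
  proof (intro ballI allI)
    fix k x assume "k \<in> iter_partials (\<lambda>x. \<alpha> * \<phi> x + \<beta> * \<psi> x)"
    then obtain g h where gh: "g \<in> iter_partials \<phi>" "h \<in> iter_partials \<psi>" "k = (\<lambda>x. \<alpha> * g x + \<beta> * h x)"
      using iter_partials_lincomb [OF sm] by blast
    have "g differentiable (at x)" "h differentiable (at x)" using sm gh by (auto simp: smooth_fun_def)
    then show "k differentiable (at x)" unfolding gh(3) by (intro derivative_intros) auto
  qed
  moreover obtain K where K: "compact K" "K \<subseteq> \<Omega>" "\<And>x. x \<notin> K \<Longrightarrow> \<phi> x = 0"
    using \<phi> by (auto simp: Cc_inf_def)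
  moreover obtain K' where K': "compact K'" "K' \<subseteq> \<Omega>" "\<And>x. x \<notin> K' \<Longrightarrow> \<psi> x = 0"
    using \<psi> by (auto simp: Cc_inf_def)
  moreover have "\<forall>x. x \<notin> K \<union> K' \<longrightarrow> \<alpha> * \<phi> x + \<beta> * \<psi> x = 0" using K(3) K'(3) by simp
  moreover have "compact (K \<union> K')" "K \<union> K' \<subseteq> \<Omega>" using K K' by auto
  ultimately show ?thesis
    unfolding Cc_inf_def by blast
qed

lemma grad_lincomb:
  assumes "\<phi> \<in> Cc_inf \<Omega>" "\<psi> \<in> Cc_inf \<Omega>"
  shows "grad (\<lambda>x. \<alpha> * \<phi> x + \<beta> * \<psi> x) x = \<alpha> *\<^sub>R grad \<phi> x + \<beta> *\<^sub>R grad \<psi> x"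
proof -
  have "((\<lambda>x. \<alpha> * \<phi> x + \<beta> * \<psi> x) has_derivative (\<lambda>h. \<alpha> * (grad \<phi> x \<bullet> h) + \<beta> * (grad \<psi> x \<bullet> h))) (at x)"
    by (intro derivative_intros Cc_inf_has_derivative [OF assms(1)] Cc_inf_has_derivative [OF assms(2)])
  then have "(\<lambda>h. grad (\<lambda>x. \<alpha> * \<phi> x + \<beta> * \<psi> x) x \<bullet> h) = (\<lambda>h. \<alpha> * (grad \<phi> x \<bullet> h) + \<beta> * (grad \<psi> x \<bullet> h))"
    using Cc_inf_has_derivative [OF Cc_inf_lincomb [OF assms]] has_derivative_unique by blast
  then have "grad (\<lambda>x. \<alpha> * \<phi> x + \<beta> * \<psi> x) x \<bullet> h = (\<alpha> *\<^sub>R grad \<phi> x + \<beta> *\<^sub>R grad \<psi> x) \<bullet> h" for h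
    by (simp add: inner_add_left fun_eq_iff)
  then show ?thesis by (blast intro: euclidean_eqI)
qed

lemma Lp_int_lincomb_le:
  fixes F G :: "'a::euclidean_space \<Rightarrow> 'c::euclidean_space"
  assumes "A \<in> sets lebesgue" "F \<in> borel_measurable lebesgue" "G \<in> borel_measurable lebesgue" "0 \<le> p"
  shows "Lp_int p A (\<lambda>x. norm (\<alpha> *\<^sub>R F x + \<beta> *\<^sub>R G x))
    \<le> ennreal (2 powr p) * (ennreal (\<bar>\<alpha>\<bar> powr p) * Lp_int p A (\<lambda>x. norm (F x)) + ennreal (\<bar>\<beta>\<bar> powr p) * Lp_int p A (\<lambda>x. norm (G x)))"
proof -
  note [measurable] = assms(1-3)
  have "Lp_int p A (\<lambda>x. norm (\<alpha> *\<^sub>R F x + \<beta> *\<^sub>R G x))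
    \<le> ennreal (2 powr p) * (Lp_int p A (\<lambda>x. norm (\<alpha> *\<^sub>R F x)) + Lp_int p A (\<lambda>x. norm (\<beta> *\<^sub>R G x)))"
    using assms by (intro Lp_int_triangle) auto
  also have "Lp_int p A (\<lambda>x. norm (\<alpha> *\<^sub>R F x)) = ennreal (\<bar>\<alpha>\<bar> powr p) * Lp_int p A (\<lambda>x. norm (F x))"
    unfolding Lp_int_norm_eq_weighted by (rule weighted_Lp_int_scale) auto
  also have "Lp_int p A (\<lambda>x. norm (\<beta> *\<^sub>R G x)) = ennreal (\<bar>\<beta>\<bar> powr p) * Lp_int p A (\<lambda>x. norm (G x))"
    unfolding Lp_int_norm_eq_weighted by (rule weighted_Lp_int_scale) auto
  finally show ?thesis .
qed

lemma Lp_int_lincomb_tendsto_0: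
  fixes F G :: "nat \<Rightarrow> 'a::euclidean_space \<Rightarrow> 'c::euclidean_space"
  assumes "A \<in> sets lebesgue" "\<And>n. F n \<in> borel_measurable lebesgue" "\<And>n. G n \<in> borel_measurable lebesgue" "0 \<le> p"
    and "(\<lambda>n. Lp_int p A (\<lambda>x. norm (F n x))) \<longlonglongrightarrow> 0" "(\<lambda>n. Lp_int p A (\<lambda>x. norm (G n x))) \<longlonglongrightarrow> 0"
  shows "(\<lambda>n. Lp_int p A (\<lambda>x. norm (\<alpha> *\<^sub>R F n x + \<beta> *\<^sub>R G n x))) \<longlonglongrightarrow> 0"
proof (rule tendsto_sandwich [where f = "\<lambda>_. 0", OF _ _ tendsto_const])
  let ?u = "\<lambda>n. ennreal (2 powr p) * (ennreal (\<bar>\<alpha>\<bar> powr p) * Lp_int p A (\<lambda>x. norm (F n x)) + ennreal (\<bar>\<beta>\<bar> powr p) * Lp_int p A (\<lambda>x. norm (G n x)))"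
  show "\<forall>\<^sub>F n in sequentially. Lp_int p A (\<lambda>x. norm (\<alpha> *\<^sub>R F n x + \<beta> *\<^sub>R G n x)) \<le> ?u n"
    using assms by (intro always_eventually allI Lp_int_lincomb_le) auto
  have "?u \<longlonglongrightarrow> ennreal (2 powr p) * (ennreal (\<bar>\<alpha>\<bar> powr p) * 0 + ennreal (\<bar>\<beta>\<bar> powr p) * 0)"
    by (intro ennreal_tendsto_cmult tendsto_add assms) auto
  then show "?u \<longlonglongrightarrow> 0" by simp
qed auto

lemma W1p0_lincomb:
  assumes \<Omega>: "open \<Omega>" and p: "0 \<le> p" and u: "W1p0 p \<Omega> u g" and v: "W1p0 p \<Omega> v k"
  shows "W1p0 p \<Omega> (\<lambda>x. \<alpha> * u x + \<beta> * v x) (\<lambda>x. \<alpha> *\<^sub>R g x + \<beta> *\<^sub>R k x)"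
proof -
  have A: "\<Omega> \<in> sets lebesgue" using \<Omega> by auto
  obtain \<phi> where \<phi>: "\<And>n. \<phi> n \<in> Cc_inf \<Omega>" "(\<lambda>n. Lp_int p \<Omega> (\<lambda>x. \<phi> n x - u x)) \<longlonglongrightarrow> 0"
     "(\<lambda>n. Lp_int p \<Omega> (\<lambda>x. norm (grad (\<phi> n) x - g x))) \<longlonglongrightarrow> 0"
    using u unfolding W1p0_def by blast
  obtain \<psi> where \<psi>: "\<And>n. \<psi> n \<in> Cc_inf \<Omega>" "(\<lambda>n. Lp_int p \<Omega> (\<lambda>x. \<psi> n x - v x)) \<longlonglongrightarrow> 0"
     "(\<lambda>n. Lp_int p \<Omega> (\<lambda>x. norm (grad (\<psi> n) x - k x))) \<longlonglongrightarrow> 0"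
    using v unfolding W1p0_def by blast
  have [measurable]: "u \<in> borel_measurable lebesgue" "v \<in> borel_measurable lebesgue"
      "g \<in> borel_measurable lebesgue" "k \<in> borel_measurable lebesgue"
    and fin: "Lp_int p \<Omega> u < \<infinity>" "Lp_int p \<Omega> v < \<infinity>"
      "Lp_int p \<Omega> (\<lambda>x. norm (g x)) < \<infinity>" "Lp_int p \<Omega> (\<lambda>x. norm (k x)) < \<infinity>"
    using u v by (auto simp: W1p0_def in_Lp_def)
  have [measurable]: "\<phi> n \<in> borel_measurable lebesgue" "\<psi> n \<in> borel_measurable lebesgue"
    "grad (\<phi> n) \<in> borel_measurable lebesgue" "grad (\<psi> n) \<in> borel_measurable lebesgue" for n
    using \<phi>(1) \<psi>(1) Cc_inf_continuous Cc_inf_continuous_grad continuous_imp_lebesgue_measurable by blast+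
  show ?thesis
    unfolding W1p0_def in_Lp_def
  proof (intro conjI exI allI)
    show "Lp_int p \<Omega> (\<lambda>x. \<alpha> * u x + \<beta> * v x) < \<infinity>"
      by (rule Lp_int_lincomb_finite) (use A fin p in auto)
    show "Lp_int p \<Omega> (\<lambda>x. norm (\<alpha> *\<^sub>R g x + \<beta> *\<^sub>R k x)) < \<infinity>"
      using fin A p unfolding Lp_int_norm_eq_weighted by (intro weighted_Lp_int_lincomb_finite) auto
    show "(\<lambda>x. \<alpha> * \<phi> n x + \<beta> * \<psi> n x) \<in> Cc_inf \<Omega>" for n by (intro Cc_inf_lincomb \<phi> \<psi>)
    have "(\<lambda>n. Lp_int p \<Omega> (\<lambda>x. norm (\<alpha> *\<^sub>R (\<phi> n x - u x) + \<beta> *\<^sub>R (\<psi> n x - v x)))) \<longlonglongrightarrow> 0"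
      using A p \<phi>(2) \<psi>(2) by (intro Lp_int_lincomb_tendsto_0) (auto simp: Lp_int_def)
    moreover have "(\<lambda>x. \<alpha> *\<^sub>R (\<phi> n x - u x) + \<beta> *\<^sub>R (\<psi> n x - v x))
        = (\<lambda>x. \<alpha> * \<phi> n x + \<beta> * \<psi> n x - (\<alpha> * u x + \<beta> * v x))" for n
      by (auto simp: algebra_simps)
    ultimately show "(\<lambda>n. Lp_int p \<Omega> (\<lambda>x. \<alpha> * \<phi> n x + \<beta> * \<psi> n x - (\<alpha> * u x + \<beta> * v x))) \<longlonglongrightarrow> 0"
      by (simp add: Lp_int_def fun_eq_iff)
    have "(\<lambda>n. Lp_int p \<Omega> (\<lambda>x. norm (\<alpha> *\<^sub>R (grad (\<phi> n) x - g x) + \<beta> *\<^sub>R (grad (\<psi> n) x - k x)))) \<longlonglongrightarrow> 0"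
      using A p \<phi>(3) \<psi>(3) by (intro Lp_int_lincomb_tendsto_0) auto
    moreover have "\<alpha> *\<^sub>R (grad (\<phi> n) x - g x) + \<beta> *\<^sub>R (grad (\<psi> n) x - k x)
        = grad (\<lambda>x. \<alpha> * \<phi> n x + \<beta> * \<psi> n x) x - (\<alpha> *\<^sub>R g x + \<beta> *\<^sub>R k x)" for n x
      unfolding grad_lincomb [OF \<phi>(1) \<psi>(1)] by (simp add: algebra_simps)
    ultimately show "(\<lambda>n. Lp_int p \<Omega> (\<lambda>x. norm (grad (\<lambda>x. \<alpha> * \<phi> n x + \<beta> * \<psi> n x) x - (\<alpha> *\<^sub>R g x + \<beta> *\<^sub>R k x)))) \<longlonglongrightarrow> 0"
      by simp
  qed auto
qed

text \<open>A free parameter in place of Hoelder's inequality: either |y| <= e, or |y| = |y|^(1-p)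
  |y|^p <= e^(1-p) |y|^p.\<close>

lemma Lp_int_1_le:
  fixes w :: "'a::euclidean_space \<Rightarrow> real"
  assumes A [measurable]: "A \<in> sets lebesgue" and m: "emeasure lebesgue A = ennreal m" "0 \<le> m"
    and w [measurable]: "w \<in> borel_measurable lebesgue" and p: "1 \<le> p" and e: "0 < e"
  shows "Lp_int 1 A w \<le> ennreal (e * m) + ennreal (e powr (1 - p)) * Lp_int p A w"
proof -
  have pw: "\<bar>y\<bar> \<le> e + e powr (1 - p) * \<bar>y\<bar> powr p" for y :: real
  proof (cases "\<bar>y\<bar> \<le> e")
    case True
    then show ?thesis by (simp add: add_increasing2)
  next
    case False
    then have "\<bar>y\<bar> = \<bar>y\<bar> powr (1 - p) * \<bar>y\<bar> powr p" using e by (simp flip: powr_add)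
    also have "\<dots> \<le> e powr (1 - p) * \<bar>y\<bar> powr p"
      using False e p by (intro mult_right_mono powr_mono2') auto
    finally show ?thesis using e by linarith
  qed
  have "Lp_int 1 A w \<le> (\<integral>\<^sup>+ x. ennreal e * indicator A x + ennreal (e powr (1 - p)) * (ennreal (\<bar>w x\<bar> powr p) * indicator A x) \<partial>lebesgue)"
    unfolding Lp_int_def using pw e
    by (intro nn_integral_mono) (auto split: split_indicator simp flip: ennreal_plus ennreal_mult intro!: ennreal_leI)
  also have "\<dots> = ennreal (e * m) + ennreal (e powr (1 - p)) * Lp_int p A w"
    unfolding Lp_int_def using e m by (simp add: nn_integral_add nn_integral_cmult nn_integral_cmult_indicator ennreal_mult)
  finally show ?thesis .
qed

text \<open>Differentiability is at hand only for the approximants phi_n, so integration by parts is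
  applied to (phi_n - l) psi with l the affine function. On the support of psi, l equals
  \<open>u\<close>, and what remains tends to 0; hence each component of g - a is orthogonal to all
  test functions in \<open>U\<close>.\<close>

lemma weak_gradient_of_affine:
  fixes \<Omega> :: "'a::euclidean_space set" and g :: "'a \<Rightarrow> 'a"
  assumes \<Omega>: "open \<Omega>" "bounded \<Omega>" and p: "1 \<le> p" and W: "W1p0 p \<Omega> u g"
    and U: "open U" "U \<subseteq> \<Omega>" and aff: "\<And>x. x \<in> U \<Longrightarrow> u x = a \<bullet> x + b"
  shows "AE x in lebesgue. x \<in> U \<longrightarrow> g x = a"
proof -
  have A [measurable]: "\<Omega> \<in> sets lebesgue" using \<Omega> by auto
  obtain m where m: "emeasure lebesgue \<Omega> = ennreal m" "0 \<le> m"
    using bounded_imp_finite_lebesgue [OF \<Omega>(2) A] by blast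
  obtain \<phi> where \<phi>: "\<And>n. \<phi> n \<in> Cc_inf \<Omega>" "(\<lambda>n. Lp_int p \<Omega> (\<lambda>x. \<phi> n x - u x)) \<longlonglongrightarrow> 0"
     "(\<lambda>n. Lp_int p \<Omega> (\<lambda>x. norm (grad (\<phi> n) x - g x))) \<longlonglongrightarrow> 0"
    using W unfolding W1p0_def by blast
  have [measurable]: "u \<in> borel_measurable lebesgue" "g \<in> borel_measurable lebesgue"
    and gfin: "Lp_int p \<Omega> (\<lambda>x. norm (g x)) < \<infinity>"
    using W by (auto simp: W1p0_def in_Lp_def)
  have [measurable]: "\<phi> n \<in> borel_measurable lebesgue" "grad (\<phi> n) \<in> borel_measurable lebesgue" for n
    using \<phi>(1) Cc_inf_continuous Cc_inf_continuous_grad continuous_imp_lebesgue_measurable by blast+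
  have g1: "Lp_int 1 \<Omega> (\<lambda>x. norm (g x)) < \<infinity>"
    using gfin by (intro le_less_trans [OF Lp_int_1_le [OF A m _ p zero_less_one]]) (auto simp: ennreal_mult_less_top)
  have comp: "AE x in lebesgue. x \<in> U \<longrightarrow> g x \<bullet> e - a \<bullet> e = 0" if e: "e \<in> Basis" for e
  proof (rule AE_zero_if_orthogonal_to_test_functions [OF U(1), where e = e])
    let ?h = "\<lambda>x. g x \<bullet> e - a \<bullet> e"
    show "?h \<in> borel_measurable lebesgue" by measurable
    show loc: "set_integrable lebesgue K ?h" if K: "compact K" "K \<subseteq> U" for K
    proof -
      have [measurable]: "K \<in> sets lebesgue" using K by (simp add: borel_compact)
      have "emeasure lebesgue K < \<infinity>"
        using emeasure_compact_finite [OF K(1)] K by (simp add: borel_compact)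
      have "integrable lebesgue (\<lambda>x. indicator K x *\<^sub>R g x)"
      proof (rule integrableI_bounded)
        have "(\<integral>\<^sup>+ x. ennreal (norm (indicator K x *\<^sub>R g x)) \<partial>lebesgue) \<le> Lp_int 1 \<Omega> (\<lambda>x. norm (g x))"
          unfolding Lp_int_def using K U(2)
          by (intro nn_integral_mono) (auto split: split_indicator)
        then show "(\<integral>\<^sup>+ x. ennreal (norm (indicator K x *\<^sub>R g x)) \<partial>lebesgue) < \<infinity>"
          using g1 by (rule le_less_trans)
      qed measurable
      then have "integrable lebesgue (\<lambda>x. (indicator K x *\<^sub>R g x) \<bullet> e)" by (rule integrable_inner_left [rotated])
      moreover have "integrable lebesgue (\<lambda>x. indicator K x *\<^sub>R (a \<bullet> e))"
        using \<open>emeasure lebesgue K < \<infinity>\<close> by (intro integrable_scaleR_left integrable_real_indicator) auto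
      ultimately have "integrable lebesgue (\<lambda>x. (indicator K x *\<^sub>R g x) \<bullet> e - indicator K x *\<^sub>R (a \<bullet> e))"
        by (rule Bochner_Integration.integrable_diff)
      then show ?thesis by (simp add: set_integrable_def right_diff_distrib)
    qed
    fix \<psi> \<psi>' :: "'a \<Rightarrow> real" and K
    assume K: "compact K" "K \<subseteq> U" and supp: "\<And>x. x \<notin> K \<Longrightarrow> \<psi> x = 0"
      and c: "continuous_on UNIV \<psi>" "continuous_on UNIV \<psi>'" and D: "has_dir_deriv e \<psi> \<psi>'"
    have supp': "\<psi>' x = 0" if "x \<notin> K" for x
      using has_dir_deriv_zero_outside [OF D compact_imp_closed [OF K(1)] supp that] .
    note [measurable] = continuous_imp_lebesgue_measurable [OF c(1)] continuous_imp_lebesgue_measurable [OF c(2)]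
    obtain B1 B2 where B12: "\<And>x. \<bar>\<psi> x\<bar> \<le> B1" "\<And>x. \<bar>\<psi>' x\<bar> \<le> B2" "0 \<le> B1" "0 \<le> B2"
      using bounded_compact_support [OF c(1) K(1) supp] bounded_compact_support [OF c(2) K(1) supp'] by metis
    define B where "B = max B1 B2"
    have B: "\<bar>\<psi> x\<bar> \<le> B" "\<bar>\<psi>' x\<bar> \<le> B" "0 \<le> B" for x
      using B12(1) [of x] B12(2) [of x] B12(3) by (auto simp: B_def)
    define X where "X = integral\<^sup>L lebesgue (\<lambda>x. ?h x * \<psi> x)"
    have ih: "integrable lebesgue (\<lambda>x. ?h x * \<psi> x)"
    proof (rule Bochner_Integration.integrable_bound)
      show "integrable lebesgue (\<lambda>x. B * (indicator K x *\<^sub>R ?h x))"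
        using loc [OF K] by (simp add: set_integrable_def)
      show "AE x in lebesgue. norm (?h x * \<psi> x) \<le> norm (B * (indicator K x *\<^sub>R ?h x))"
      proof (intro AE_I2)
        fix x
        show "norm (?h x * \<psi> x) \<le> norm (B * (indicator K x *\<^sub>R ?h x))"
          using mult_left_mono [OF B(1) [of x], of "\<bar>?h x\<bar>"] B(3) supp [of x]
          by (cases "x \<in> K") (auto simp: abs_mult mult.commute)
      qed
    qed measurable
    have est: "ennreal \<bar>X\<bar> \<le> ennreal B * (Lp_int 1 \<Omega> (\<lambda>x. norm (grad (\<phi> n) x - g x)) + Lp_int 1 \<Omega> (\<lambda>x. \<phi> n x - u x))" for n
    proof -
      let ?l = "\<lambda>x. a \<bullet> x + b"
      \<comment> \<open>Subtracting this function of integral 0 turns \<open>?h x * \<psi> x\<close>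
        into terms in \<open>grad (\<phi> n) x - g x\<close> and \<open>\<phi> n x - u x\<close>
        only, both small in L^p.\<close>
      define G' where "G' x = (grad (\<phi> n) x \<bullet> e - a \<bullet> e) * \<psi> x + (\<phi> n x - ?l x) * \<psi>' x" for x
      have DG: "has_dir_deriv e (\<lambda>x. (\<phi> n x - ?l x) * \<psi> x) G'"
        unfolding G'_def
        by (rule has_dir_deriv_mult [OF has_dir_deriv_diff [OF Cc_inf_has_dir_deriv [OF \<phi>(1)] has_dir_deriv_affine] D])
      have cG: "continuous_on UNIV (\<lambda>x. (\<phi> n x - ?l x) * \<psi> x)" "continuous_on UNIV G'"
        unfolding G'_def
        by (intro continuous_intros c Cc_inf_continuous [OF \<phi>(1)] Cc_inf_continuous_grad [OF \<phi>(1)])+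
      have G'0: "G' x = 0" if "x \<notin> K" for x using that supp supp' by (simp add: G'_def)
      have "integral\<^sup>L lborel G' = 0"
        by (rule integral_dir_deriv_eq_0 [OF DG cG K(1)]) (simp add: supp)
      moreover have G'b: "G' \<in> borel_measurable borel" using cG(2) by (rule borel_measurable_continuous_onI)
      ultimately have iG: "integral\<^sup>L lebesgue G' = 0" "integrable lebesgue G'"
        using integrable_continuous_compact_support [OF cG(2) K(1) G'0]
        by (simp_all add: integral_completion integrable_completion)
      have "X = integral\<^sup>L lebesgue (\<lambda>x. ?h x * \<psi> x - G' x)"
        using ih iG by (simp add: X_def)
      then have "ennreal \<bar>X\<bar> \<le> (\<integral>\<^sup>+ x. ennreal (norm (?h x * \<psi> x - G' x)) \<partial>lebesgue)"
        using integral_norm_bound_ennreal [OF Bochner_Integration.integrable_diff [OF ih iG(2)]] by simp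
      also have "\<dots> \<le> (\<integral>\<^sup>+ x. ennreal B * (ennreal (\<bar>norm (grad (\<phi> n) x - g x)\<bar> powr 1) * indicator \<Omega> x
           + ennreal (\<bar>\<phi> n x - u x\<bar> powr 1) * indicator \<Omega> x) \<partial>lebesgue)"
      proof (rule nn_integral_mono)
        fix x
        show "ennreal (norm (?h x * \<psi> x - G' x)) \<le> ennreal B * (ennreal (\<bar>norm (grad (\<phi> n) x - g x)\<bar> powr 1) * indicator \<Omega> x
           + ennreal (\<bar>\<phi> n x - u x\<bar> powr 1) * indicator \<Omega> x)"
        proof (cases "x \<in> K")
          case True
          then have xU: "x \<in> U" "x \<in> \<Omega>" using K U by auto
          have "?h x * \<psi> x - G' x = - ((grad (\<phi> n) x - g x) \<bullet> e) * \<psi> x - (\<phi> n x - u x) * \<psi>' x"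
            by (simp add: G'_def aff [OF xU(1)] inner_diff_left algebra_simps)
          also have "\<bar>\<dots>\<bar> \<le> \<bar>(grad (\<phi> n) x - g x) \<bullet> e\<bar> * \<bar>\<psi> x\<bar> + \<bar>\<phi> n x - u x\<bar> * \<bar>\<psi>' x\<bar>"
            by (simp add: abs_mult [symmetric])
          also have "\<dots> \<le> norm (grad (\<phi> n) x - g x) * B + \<bar>\<phi> n x - u x\<bar> * B"
            using B Basis_le_norm [OF e] by (intro add_mono mult_mono) auto
          finally have "norm (?h x * \<psi> x - G' x) \<le> B * (norm (grad (\<phi> n) x - g x) + \<bar>\<phi> n x - u x\<bar>)"
            by (simp add: algebra_simps)
          then show ?thesis using xU B(3) by (simp flip: ennreal_plus ennreal_mult add: ennreal_leI)
        qed (simp add: supp G'0)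
      qed
      also have "\<dots> = ennreal B * (Lp_int 1 \<Omega> (\<lambda>x. norm (grad (\<phi> n) x - g x)) + Lp_int 1 \<Omega> (\<lambda>x. \<phi> n x - u x))"
        unfolding Lp_int_def by (simp add: nn_integral_cmult nn_integral_add)
      finally show ?thesis .
    qed
    \<comment> \<open>Order of limits: first n at fixed epsilon, where the large factor
      epsilon^(1-p) multiplies quantities tending to 0, and only then epsilon.\<close>
    have "\<bar>X\<bar> \<le> B * (2 * (\<epsilon> * m))" if \<epsilon>: "0 < \<epsilon>" for \<epsilon>
    proof -
      let ?a = "\<lambda>n. Lp_int p \<Omega> (\<lambda>x. norm (grad (\<phi> n) x - g x))" and ?b = "\<lambda>n. Lp_int p \<Omega> (\<lambda>x. \<phi> n x - u x)"
      let ?c = "\<lambda>n. ennreal B * ((ennreal (\<epsilon> * m) + ennreal (\<epsilon> powr (1 - p)) * ?a n) + (ennreal (\<epsilon> * m) + ennreal (\<epsilon> powr (1 - p)) * ?b n))"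
      have "ennreal \<bar>X\<bar> \<le> ?c n" for n
        by (rule order_trans [OF est [of n]]) (intro mult_left_mono add_mono Lp_int_1_le A m p \<epsilon>, auto)
      moreover have "?c \<longlonglongrightarrow> ennreal B * ((ennreal (\<epsilon> * m) + ennreal (\<epsilon> powr (1 - p)) * 0) + (ennreal (\<epsilon> * m) + ennreal (\<epsilon> powr (1 - p)) * 0))"
        by (intro ennreal_tendsto_cmult tendsto_add tendsto_const \<phi>) auto
      ultimately have "ennreal \<bar>X\<bar> \<le> ennreal B * ((ennreal (\<epsilon> * m) + ennreal (\<epsilon> powr (1 - p)) * 0) + (ennreal (\<epsilon> * m) + ennreal (\<epsilon> powr (1 - p)) * 0))"
        by (intro LIMSEQ_le_const) auto
      also have "\<dots> = ennreal B * (ennreal (\<epsilon> * m) + ennreal (\<epsilon> * m))" by simp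
      also have "\<dots> = ennreal B * ennreal (2 * (\<epsilon> * m))"
        using m \<epsilon> by (subst mult_2, subst ennreal_plus) auto
      also have "\<dots> = ennreal (B * (2 * (\<epsilon> * m)))"
        using B(3) m \<epsilon> by (subst ennreal_mult) auto
      finally show ?thesis
        using B(3) m \<epsilon> by (subst (asm) ennreal_le_iff) auto
    qed
    note bound = this
    have "((\<lambda>\<epsilon>. B * (2 * (\<epsilon> * m))) \<longlongrightarrow> B * (2 * (0 * m))) (at_right 0)" by (intro tendsto_intros)
    then have "\<bar>X\<bar> \<le> B * (2 * (0 * m))"
      by (rule tendsto_lowerbound) (auto intro!: eventually_at_rightI [of 0 1] bound)
    then show "integral\<^sup>L lebesgue (\<lambda>x. ?h x * \<psi> x) = 0" by (simp add: X_def)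
  qed
  have "AE x in lebesgue. \<forall>e\<in>Basis. x \<in> U \<longrightarrow> g x \<bullet> e - a \<bullet> e = 0"
    by (rule AE_finite_allI [OF finite_Basis]) (rule comp)
  then show ?thesis
  proof eventually_elim
    case (elim x)
    show ?case
    proof
      assume "x \<in> U"
      then have "g x \<bullet> e = a \<bullet> e" if "e \<in> Basis" for e using elim that by force
      then show "g x = a" by (rule euclidean_eqI)
    qed
  qed
qed

text \<open>The difference of the two is a gradient of the zero function, which is affine with slope
  0 on the whole domain.\<close>

lemma W1p0_gradient_unique:
  fixes \<Omega> :: "'a::euclidean_space set"
  assumes "open \<Omega>" "bounded \<Omega>" "1 \<le> p" "W1p0 p \<Omega> u g" "W1p0 p \<Omega> u k"
  shows "AE x in lebesgue. x \<in> \<Omega> \<longrightarrow> g x = k x"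
proof -
  have "W1p0 p \<Omega> (\<lambda>x. 1 * u x + (-1) * u x) (\<lambda>x. 1 *\<^sub>R g x + (-1) *\<^sub>R k x)"
    using assms by (intro W1p0_lincomb) auto
  then have "AE x in lebesgue. x \<in> \<Omega> \<longrightarrow> 1 *\<^sub>R g x + (-1) *\<^sub>R k x = 0"
    using assms by (intro weak_gradient_of_affine [where b = 0]) auto
  then show ?thesis by eventually_elim auto
qed

lemma W1p0_wgrad: "W1p0 p \<Omega> u g \<Longrightarrow> W1p0 p \<Omega> u (wgrad p \<Omega> u)"
  unfolding wgrad_def by (rule someI [of "W1p0 p \<Omega> u"])

lemma wgrad_AE_eq:
  fixes \<Omega> :: "'a::euclidean_space set"
  assumes "open \<Omega>" "bounded \<Omega>" "1 \<le> p" "W1p0 p \<Omega> u g"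
  shows "AE x in lebesgue. x \<in> \<Omega> \<longrightarrow> wgrad p \<Omega> u x = g x"
  using assms W1p0_gradient_unique W1p0_wgrad by blast

lemma Lp_int_cong_AE:
  assumes "AE x in lebesgue. x \<in> A \<longrightarrow> u x = v x"
  shows "Lp_int p A u = Lp_int p A v"
  unfolding Lp_int_def
  by (intro nn_integral_cong_AE) (use assms in eventually_elim, auto split: split_indicator)

section \<open>The Poincare inequality in W^{1,p}_0 and the local quasi-best approximation\<close>

lemma has_real_derivative_abs_powr:
  fixes p :: real
  assumes p: "1 < p"
  shows "((\<lambda>y. \<bar>y\<bar> powr p) has_real_derivative p * (sgn y * \<bar>y\<bar> powr (p - 1))) (at y)"
proof -
  consider "y > 0" | "y < 0" | "y = 0" by linarith
  then show ?thesis
  proof cases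
    case 1
    have "eventually (\<lambda>z. \<bar>z\<bar> powr p = z powr p) (nhds y)"
      using eventually_nhds_in_open [of "{0<..}" y] 1 by (auto elim!: eventually_mono)
    moreover have "((\<lambda>y. y powr p) has_real_derivative p * y powr (p - 1)) (at y)"
      using has_real_derivative_powr [OF 1] .
    ultimately show ?thesis using 1 by (subst DERIV_cong_ev [OF refl _ refl]) auto
  next
    case 2
    have "eventually (\<lambda>z. \<bar>z\<bar> powr p = (- z) powr p) (nhds y)"
      using eventually_nhds_in_open [of "{..<0}" y] 2 by (auto elim!: eventually_mono)
    moreover have "((\<lambda>y. (- y) powr p) has_real_derivative (p * (- y) powr (p - 1)) * (- 1)) (at y)"
      by (rule DERIV_chain2 [where f = "\<lambda>z. z powr p" and g = uminus])
        (use 2 in \<open>auto intro!: has_real_derivative_powr derivative_eq_intros\<close>)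
    ultimately show ?thesis using 2 by (subst DERIV_cong_ev [OF refl _ refl]) auto
  next
    case 3
    have "((\<lambda>h. \<bar>h\<bar> powr p / h) \<longlongrightarrow> 0) (at (0::real))"
    proof (rule Lim_null_comparison)
      show "\<forall>\<^sub>F h in at (0::real). norm (\<bar>h\<bar> powr p / h) \<le> \<bar>h\<bar> powr (p - 1)"
        by (intro always_eventually allI) (simp add: powr_diff abs_divide)
      have "((\<lambda>h::real. \<bar>h\<bar> powr (p - 1)) \<longlongrightarrow> \<bar>0\<bar> powr (p - 1)) (at 0)"
        using p by (intro tendsto_powr' tendsto_intros) auto
      then show "((\<lambda>h::real. \<bar>h\<bar> powr (p - 1)) \<longlongrightarrow> 0) (at 0)" by simp
    qed
    then show ?thesis using 3 by (simp add: has_field_derivative_iff)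
  qed
qed

lemma continuous_sgn_abs_powr:
  assumes q: "0 < q" shows "continuous_on UNIV (\<lambda>y::real. sgn y * \<bar>y\<bar> powr q)"
proof (intro continuous_at_imp_continuous_on ballI)
  fix y :: real
  show "isCont (\<lambda>y. sgn y * \<bar>y\<bar> powr q) y"
  proof (cases "y = 0")
    case True
    have "((\<lambda>h::real. sgn h * \<bar>h\<bar> powr q) \<longlongrightarrow> 0) (at 0)"
    proof (rule Lim_null_comparison)
      show "\<forall>\<^sub>F h in at (0::real). norm (sgn h * \<bar>h\<bar> powr q) \<le> \<bar>h\<bar> powr q"
        by (intro always_eventually allI) (auto simp: abs_mult sgn_if)
      have "((\<lambda>h::real. \<bar>h\<bar> powr q) \<longlongrightarrow> \<bar>0\<bar> powr q) (at 0)"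
        using q by (intro tendsto_powr' tendsto_intros) auto
      then show "((\<lambda>h::real. \<bar>h\<bar> powr q) \<longlongrightarrow> 0) (at 0)" by simp
    qed
    then show ?thesis using True by (simp add: isCont_def)
  next
    case False
    then show ?thesis by (intro continuous_intros) auto
  qed
qed

text \<open>Integrating the derivative of \<open>(e \<bullet> x) |\<phi>|^p\<close> in the direction \<open>e\<close> bounds \<open>\<integral>|\<phi>|^p\<close> by
  \<open>\<integral>|\<phi>|^(p-1) |\<nabla>\<phi>|\<close>, and Young's inequality absorbs the first factor.\<close>

lemma poincare_Cc_inf:
  fixes \<Omega> :: "'a::euclidean_space set"
  assumes \<Omega>: "bounded \<Omega>" and p: "1 < p"
  obtains C where "0 \<le> C" "\<And>\<phi>. \<phi> \<in> Cc_inf \<Omega> \<Longrightarrow> Lp_int p \<Omega> \<phi> \<le> ennreal C * Lp_int p \<Omega> (\<lambda>x. norm (grad \<phi> x))"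
proof -
  obtain R where R: "0 < R" "\<And>x. x \<in> \<Omega> \<Longrightarrow> norm x \<le> R" using \<Omega> bounded_pos by metis
  obtain e :: 'a where e: "e \<in> Basis" using nonempty_Basis by blast
  \<comment> \<open>If 2 p R d <= s, the product in \<open>young\<close> is absorbed into s^p / 2;
    otherwise s < 2 p R d, and inserting this bound leaves exactly c d^p.\<close>
  define c where "c = p * R * (2 * p * R) powr (p - 1)"
  have c: "0 \<le> c" using p R by (simp add: c_def)
  have young: "p * R * (s powr (p - 1) * d) \<le> 1/2 * s powr p + c * d powr p" if sd: "0 \<le> s" "0 \<le> d" for s d
  proof (cases "2 * p * R * d \<le> s")
    case True
    have "p * R * (s powr (p - 1) * d) = s powr (p - 1) * (p * R * d)" by simp
    also have "\<dots> \<le> s powr (p - 1) * (s / 2)" using True by (intro mult_left_mono) auto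
    also have "\<dots> = 1/2 * s powr p" using sd by (cases "s = 0") (auto simp: powr_diff)
    finally show ?thesis using c by (simp add: add_increasing2)
  next
    case False
    then have "d \<noteq> 0" using sd by auto
    have "s powr (p - 1) \<le> (2 * p * R * d) powr (p - 1)" using False sd p by (intro powr_mono2) auto
    then have "p * R * (s powr (p - 1) * d) \<le> p * R * ((2 * p * R * d) powr (p - 1) * d)"
      using p R sd by (intro mult_left_mono mult_right_mono) auto
    also have "\<dots> = c * (d powr (p - 1) * d)" using p R sd by (simp add: c_def powr_mult)
    also have "d powr (p - 1) * d = d powr p" using sd \<open>d \<noteq> 0\<close> by (simp add: powr_diff)
    finally show ?thesis by (simp add: add_increasing)
  qed
  show thesis
  proof (rule that [of "2 * c"])
    show "0 \<le> 2 * c" using c by simp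
    fix \<phi> assume \<phi>: "\<phi> \<in> Cc_inf \<Omega>"
    obtain K where K: "compact K" "K \<subseteq> \<Omega>" "\<And>x. x \<notin> K \<Longrightarrow> \<phi> x = 0"
      using \<phi> by (auto simp: Cc_inf_def)
    have gK: "grad \<phi> x = 0" if "x \<notin> K" for x
      using grad_zero_outside [OF \<phi> compact_imp_closed [OF K(1)] K(3) that] .
    note cont = Cc_inf_continuous [OF \<phi>] Cc_inf_continuous_grad [OF \<phi>]
    define P where "P x = \<bar>\<phi> x\<bar> powr p" for x
    define Q where "Q x = norm (grad \<phi> x) powr p" for x
    \<comment> \<open>As e . e = 1, the derivative of (e . x) P along e is P + Z, and its vanishing
      integral expresses that of P through Z. The summand 0 matches the form of
      \<open>has_dir_deriv_affine\<close>.\<close>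
    define Z where "Z x = (e \<bullet> x + 0) * (p * (sgn (\<phi> x) * \<bar>\<phi> x\<bar> powr (p - 1)) * (grad \<phi> x \<bullet> e))" for x
    have cP: "continuous_on UNIV P" unfolding P_def using p
      by (intro continuous_on_powr' continuous_intros cont) auto
    have cQ: "continuous_on UNIV Q" unfolding Q_def using p
      by (intro continuous_on_powr' continuous_intros cont) auto
    have cS: "continuous_on UNIV (\<lambda>x. sgn (\<phi> x) * \<bar>\<phi> x\<bar> powr (p - 1))"
      using continuous_on_compose2 [OF continuous_sgn_abs_powr [of "p - 1"] cont(1)] p by simp
    have cZ: "continuous_on UNIV Z" unfolding Z_def by (intro continuous_intros cS cont)
    have supp: "P x = 0" "Q x = 0" "Z x = 0" if "x \<notin> K" for x
      using K(3) [OF that] gK [OF that] p by (auto simp: P_def Q_def Z_def)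
    have iP: "integrable lborel P" and iQ: "integrable lborel Q" and iZ: "integrable lborel Z"
      using integrable_continuous_compact_support [OF cP K(1)] integrable_continuous_compact_support [OF cQ K(1)]
        integrable_continuous_compact_support [OF cZ K(1)] supp by auto
    have DP: "has_dir_deriv e P (\<lambda>x. p * (sgn (\<phi> x) * \<bar>\<phi> x\<bar> powr (p - 1)) * (grad \<phi> x \<bullet> e))"
      unfolding has_dir_deriv_def P_def
    proof
      fix x
      show "((\<lambda>t. \<bar>\<phi> (x + t *\<^sub>R e)\<bar> powr p) has_real_derivative
          p * (sgn (\<phi> x) * \<bar>\<phi> x\<bar> powr (p - 1)) * (grad \<phi> x \<bullet> e)) (at 0)"
        using DERIV_chain2 [of "\<lambda>y. \<bar>y\<bar> powr p" _ "\<lambda>t. \<phi> (x + t *\<^sub>R e)" 0, OF has_real_derivative_abs_powr [OF p]]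
          Cc_inf_has_dir_deriv [OF \<phi>, of e] by (simp add: has_dir_deriv_def)
    qed
    have DG: "has_dir_deriv e (\<lambda>x. (e \<bullet> x + 0) * P x) (\<lambda>x. e \<bullet> e * P x + Z x)"
      unfolding Z_def by (rule has_dir_deriv_mult [OF has_dir_deriv_affine DP])
    have "integral\<^sup>L lborel (\<lambda>x. e \<bullet> e * P x + Z x) = 0"
      by (rule integral_dir_deriv_eq_0 [OF DG _ _ K(1)]) (use supp in \<open>auto intro!: continuous_intros cP cZ\<close>)
    then have "integral\<^sup>L lborel P = integral\<^sup>L lborel (\<lambda>x. - Z x)"
      using iP iZ e by simp
    also have "\<dots> \<le> integral\<^sup>L lborel (\<lambda>x. 1/2 * P x + c * Q x)"
    proof (rule integral_mono)
      fix x
      show "- Z x \<le> 1/2 * P x + c * Q x"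
      proof (cases "x \<in> K")
        case True
        then have "norm x \<le> R" using R K by auto
        then have "\<bar>e \<bullet> x\<bar> \<le> R" using Basis_le_norm [OF e, of x] by (simp add: inner_commute)
        have "- Z x \<le> \<bar>Z x\<bar>" by simp
        also have "\<dots> = \<bar>e \<bullet> x\<bar> * (p * (\<bar>sgn (\<phi> x)\<bar> * \<bar>\<phi> x\<bar> powr (p - 1)) * \<bar>grad \<phi> x \<bullet> e\<bar>)"
          using p by (simp add: Z_def abs_mult)
        also have "\<dots> \<le> R * (p * (1 * \<bar>\<phi> x\<bar> powr (p - 1)) * norm (grad \<phi> x))"
          using p R \<open>\<bar>e \<bullet> x\<bar> \<le> R\<close> Basis_le_norm [OF e, of "grad \<phi> x"]
          by (intro mult_mono) (auto simp: abs_sgn_eq)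
        also have "\<dots> = p * R * (\<bar>\<phi> x\<bar> powr (p - 1) * norm (grad \<phi> x))" by simp
        also have "\<dots> \<le> 1/2 * P x + c * Q x" unfolding P_def Q_def by (rule young) auto
        finally show ?thesis .
      qed (simp add: supp)
    qed (use iP iQ iZ in auto)
    also have "\<dots> = 1/2 * integral\<^sup>L lborel P + c * integral\<^sup>L lborel Q" using iP iQ by simp
    finally have le: "integral\<^sup>L lborel P \<le> 2 * c * integral\<^sup>L lborel Q" by simp
    have "Lp_int p \<Omega> \<phi> = (\<integral>\<^sup>+ x. ennreal (P x) \<partial>lborel)"
      unfolding Lp_int_def nn_integral_completion P_def using K p
      by (intro nn_integral_cong) (auto split: split_indicator)
    also have "\<dots> = ennreal (integral\<^sup>L lborel P)" by (rule nn_integral_eq_integral [OF iP]) (simp add: P_def)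
    also have "\<dots> \<le> ennreal (2 * c) * ennreal (integral\<^sup>L lborel Q)"
      using le c by (subst ennreal_mult [symmetric]) (auto intro!: ennreal_leI Bochner_Integration.integral_nonneg simp: Q_def)
    also have "ennreal (integral\<^sup>L lborel Q) = (\<integral>\<^sup>+ x. ennreal (Q x) \<partial>lborel)"
      by (rule nn_integral_eq_integral [symmetric, OF iQ]) (simp add: Q_def)
    also have "\<dots> = Lp_int p \<Omega> (\<lambda>x. norm (grad \<phi> x))"
      unfolding Lp_int_def nn_integral_completion Q_def using K gK p
      by (intro nn_integral_cong) (auto split: split_indicator)
    finally show "Lp_int p \<Omega> \<phi> \<le> ennreal (2 * c) * Lp_int p \<Omega> (\<lambda>x. norm (grad \<phi> x))" .
  qed
qed

lemma W1p0_poincare: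
  fixes \<Omega> :: "'a::euclidean_space set"
  assumes \<Omega>: "open \<Omega>" "bounded \<Omega>" and p: "1 < p"
  obtains C where "0 \<le> C" "\<And>u g. W1p0 p \<Omega> u g \<Longrightarrow> Lp_int p \<Omega> u \<le> ennreal C * Lp_int p \<Omega> (\<lambda>x. norm (g x))"
proof -
  have A: "\<Omega> \<in> sets lebesgue" using \<Omega> by auto
  obtain C where C: "0 \<le> C" "\<And>\<phi>. \<phi> \<in> Cc_inf \<Omega> \<Longrightarrow> Lp_int p \<Omega> \<phi> \<le> ennreal C * Lp_int p \<Omega> (\<lambda>x. norm (grad \<phi> x))"
    using poincare_Cc_inf [OF \<Omega>(2) p] by blast
  show thesis
  \<comment> \<open>One factor 2^p comes from comparing \<open>u\<close> with
    \<open>\<phi> n\<close>, the other from comparing the gradient of \<open>\<phi> n\<close> with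
    \<open>g\<close>.\<close>
  proof (rule that [of "2 powr p * (C * 2 powr p)"])
    show "0 \<le> 2 powr p * (C * 2 powr p)" using C by simp
    fix u g assume W: "W1p0 p \<Omega> u g"
    obtain \<phi> where \<phi>: "\<And>n. \<phi> n \<in> Cc_inf \<Omega>" "(\<lambda>n. Lp_int p \<Omega> (\<lambda>x. \<phi> n x - u x)) \<longlonglongrightarrow> 0"
       "(\<lambda>n. Lp_int p \<Omega> (\<lambda>x. norm (grad (\<phi> n) x - g x))) \<longlonglongrightarrow> 0"
      using W unfolding W1p0_def by blast
    have [measurable]: "u \<in> borel_measurable lebesgue" "g \<in> borel_measurable lebesgue"
      and gfin: "Lp_int p \<Omega> (\<lambda>x. norm (g x)) < \<infinity>"
      using W by (auto simp: W1p0_def in_Lp_def)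
    have [measurable]: "\<phi> n \<in> borel_measurable lebesgue" "grad (\<phi> n) \<in> borel_measurable lebesgue" for n
      using \<phi>(1) Cc_inf_continuous Cc_inf_continuous_grad continuous_imp_lebesgue_measurable by blast+
    let ?a = "\<lambda>n. Lp_int p \<Omega> (\<lambda>x. \<phi> n x - u x)" and ?b = "\<lambda>n. Lp_int p \<Omega> (\<lambda>x. norm (grad (\<phi> n) x - g x))"
      and ?g = "Lp_int p \<Omega> (\<lambda>x. norm (g x))" and ?t = "ennreal (2 powr p)"
    have "Lp_int p \<Omega> u \<le> ?t * (?a n + ennreal C * (?t * (?b n + ?g)))" for n
    proof -
      have "Lp_int p \<Omega> u = Lp_int p \<Omega> (\<lambda>x. (u x - \<phi> n x) + \<phi> n x)" by simp
      also have "\<dots> \<le> ?t * (Lp_int p \<Omega> (\<lambda>x. u x - \<phi> n x) + Lp_int p \<Omega> (\<phi> n))"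
        using A p by (intro Lp_int_triangle_real) auto
      also have "Lp_int p \<Omega> (\<lambda>x. u x - \<phi> n x) = ?a n"
        by (simp add: Lp_int_def abs_minus_commute)
      also have "Lp_int p \<Omega> (\<phi> n) \<le> ennreal C * Lp_int p \<Omega> (\<lambda>x. norm ((grad (\<phi> n) x - g x) + g x))"
        using C(2) [OF \<phi>(1)] by simp
      also have "Lp_int p \<Omega> (\<lambda>x. norm ((grad (\<phi> n) x - g x) + g x)) \<le> ?t * (?b n + ?g)"
        using A p by (intro Lp_int_triangle) auto
      finally show ?thesis by (simp add: mult_left_mono add_left_mono)
    qed
    moreover have "(\<lambda>n. ?t * (?a n + ennreal C * (?t * (?b n + ?g)))) \<longlonglongrightarrow> ?t * (0 + ennreal C * (?t * (0 + ?g)))"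
      by (intro ennreal_tendsto_cmult tendsto_add tendsto_const \<phi>) auto
    ultimately have "Lp_int p \<Omega> u \<le> ?t * (0 + ennreal C * (?t * (0 + ?g)))"
      by (intro LIMSEQ_le_const) auto
    then show "Lp_int p \<Omega> u \<le> ennreal (2 powr p * (C * 2 powr p)) * ?g"
      using C(1) by (simp add: ennreal_mult mult_ac)
  qed
qed

lemma cea_local:
  fixes \<Omega> :: "'a::euclidean_space set"
  assumes p: "2 \<le> p" and \<Omega>: "open \<Omega>" "bounded \<Omega>"
    and f: "f \<in> borel_measurable lebesgue" "Lp_int (p / (p - 1)) \<Omega> f < \<infinity>"
    and E: "\<And>v. E v = (1/p) * enn2real (Lp_int p \<Omega> (\<lambda>x. norm (wgrad p \<Omega> v x))) - (LINT x:\<Omega>|lebesgue. f x * v x)"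
    and u: "is_minimizer E {u. \<exists>g. W1p0 p \<Omega> u g} u"
  obtains C where "0 < C"
    "\<And>V uh v. V \<subseteq> {u. \<exists>g. W1p0 p \<Omega> u g} \<Longrightarrow> (\<lambda>_. 0) \<in> V \<Longrightarrow> is_minimizer E V uh \<Longrightarrow> v \<in> V \<Longrightarrow>
       (enn2real (Lp_int p \<Omega> (\<lambda>x. uh x - u x)) +
        enn2real (Lp_int p \<Omega> (\<lambda>x. norm (wgrad p \<Omega> (\<lambda>x. uh x - u x) x)))) powr (1/p)
       \<le> C * ((enn2real (Lp_int p \<Omega> (\<lambda>x. v x - u x)) +
               enn2real (Lp_int p \<Omega> (\<lambda>x. norm (wgrad p \<Omega> (\<lambda>x. v x - u x) x)))) powr (1/p)) powr (2 / p)"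
proof -
  have A: "\<Omega> \<in> sets lebesgue" using \<Omega> by auto
  have p0: "0 \<le> p" "1 < p" "1 \<le> p" using p by auto
  define T where "T = {u. \<exists>g. W1p0 p \<Omega> u g}"
  have wg: "W1p0 p \<Omega> v (wgrad p \<Omega> v)" if "v \<in> T" for v
    using that W1p0_wgrad by (auto simp: T_def)
  obtain P where P: "0 \<le> P" "\<And>u g. W1p0 p \<Omega> u g \<Longrightarrow> Lp_int p \<Omega> u \<le> ennreal P * Lp_int p \<Omega> (\<lambda>x. norm (g x))"
    using W1p0_poincare [OF \<Omega> p0(2)] by blast
  show thesis
  proof (rule cea_estimate_weighted [where E = E and T = T and p = p
        and I = "\<lambda>v. enn2real (Lp_int p \<Omega> (\<lambda>x. norm (wgrad p \<Omega> v x)))" and L = "\<lambda>v. LINT x:\<Omega>|lebesgue. f x * v x"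
        and X = "\<lambda>v. enn2real (Lp_int p \<Omega> v) + enn2real (Lp_int p \<Omega> (\<lambda>x. norm (wgrad p \<Omega> v x)))"
        and M = lebesgue and W = "indicator \<Omega>"
        and D = "\<lambda>v. wgrad p \<Omega> v" and u = u and ?c1.0 = "1 / (1 + P)" and ?c2.0 = 1])
    fix v assume v: "v \<in> T"
    note W = wg [OF v]
    show "wgrad p \<Omega> v \<in> borel_measurable lebesgue" using W by (simp add: W1p0_def)
    have fin: "Lp_int p \<Omega> (\<lambda>x. norm (wgrad p \<Omega> v x)) < \<infinity>" using W by (simp add: W1p0_def)
    then show "weighted_Lp_int p lebesgue (indicator \<Omega>) (wgrad p \<Omega> v) < \<infinity>"
      by (simp add: Lp_int_norm_eq_weighted)
    show "enn2real (Lp_int p \<Omega> (\<lambda>x. norm (wgrad p \<Omega> v x))) = enn2real (weighted_Lp_int p lebesgue (indicator \<Omega>) (wgrad p \<Omega> v))"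
      by (simp add: Lp_int_norm_eq_weighted)
    let ?J = "enn2real (Lp_int p \<Omega> (\<lambda>x. norm (wgrad p \<Omega> v x)))"
    have "enn2real (Lp_int p \<Omega> v) \<le> enn2real (ennreal P * Lp_int p \<Omega> (\<lambda>x. norm (wgrad p \<Omega> v x)))"
      using fin by (intro enn2real_mono P(2) [OF W]) (simp add: ennreal_mult_less_top)
    then have "enn2real (Lp_int p \<Omega> v) + ?J \<le> (1 + P) * ?J"
      using P(1) by (simp add: enn2real_mult algebra_simps)
    then show "1 / (1 + P) * (enn2real (Lp_int p \<Omega> v) + ?J) \<le> ?J"
      using P(1) by (simp add: divide_le_eq mult_ac)
    show "?J \<le> 1 * (enn2real (Lp_int p \<Omega> v) + ?J)" by simp
  next
    fix v w \<alpha> \<beta> assume v: "v \<in> T" and w: "w \<in> T"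
    note lc = W1p0_lincomb [OF \<Omega>(1) p0(1) wg [OF v] wg [OF w], of \<alpha> \<beta>]
    show "(\<lambda>x. \<alpha> * v x + \<beta> * w x) \<in> T" using lc by (auto simp: T_def)
    show "(LINT x:\<Omega>|lebesgue. f x * (\<alpha> * v x + \<beta> * w x))
      = \<alpha> * (LINT x:\<Omega>|lebesgue. f x * v x) + \<beta> * (LINT x:\<Omega>|lebesgue. f x * w x)"
      using wg [OF v] wg [OF w] by (intro pairing_lincomb [OF A p0(2) f]) (auto simp: W1p0_def in_Lp_def)
    show "AE z in lebesgue. (indicator \<Omega> z :: ennreal) = 0 \<or>
       wgrad p \<Omega> (\<lambda>x. \<alpha> * v x + \<beta> * w x) z = \<alpha> *\<^sub>R wgrad p \<Omega> v z + \<beta> *\<^sub>R wgrad p \<Omega> w z"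
      using wgrad_AE_eq [OF \<Omega> p0(3) lc] by eventually_elim (auto simp: indicator_def)
  next
    show "indicator \<Omega> \<in> borel_measurable lebesgue" using A by simp
    show "0 \<le> enn2real (Lp_int p \<Omega> v) + enn2real (Lp_int p \<Omega> (\<lambda>x. norm (wgrad p \<Omega> v x)))" for v by simp
    show "0 < 1 / (1 + P)" using P(1) by simp
    show "is_minimizer E T u" using u by (simp add: T_def)
  qed (fact p E enn2real_nonneg zero_less_one that [folded T_def])+
qed

section \<open>Density of piecewise linear functions\<close>

lemma Lp_int_le_const:
  assumes A: "A \<in> sets lebesgue" and m: "emeasure lebesgue A = ennreal m" "0 \<le> m" and t: "0 \<le> p"
    and le: "AE x in lebesgue. x \<in> A \<longrightarrow> \<bar>w x\<bar> \<le> t"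
  shows "Lp_int p A w \<le> ennreal (t powr p * m)"
proof -
  have "Lp_int p A w \<le> (\<integral>\<^sup>+ x. ennreal (t powr p) * indicator A x \<partial>lebesgue)"
    unfolding Lp_int_def
    by (rule nn_integral_mono_AE, use le in eventually_elim)
      (use t in \<open>auto split: split_indicator intro!: ennreal_leI powr_mono2\<close>)
  also have "\<dots> = ennreal (t powr p * m)"
    using A m by (simp add: nn_integral_cmult_indicator ennreal_mult)
  finally show ?thesis .
qed

text \<open>Frontiers of convex sets are negligible, so almost every point is interior to a simplex,
  where the affine case applies. Membership in \<open>W1p0\<close> is a hypothesis, so no jumps
  across faces have to be discussed.\<close>

lemma weak_gradient_of_piecewise_affine:
  fixes \<Omega> :: "'a::euclidean_space set"
  assumes \<Omega>: "open \<Omega>" "bounded \<Omega>" and p: "1 \<le> p" and W: "W1p0 p \<Omega> v g"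
    and tri: "triangulation_of \<T> \<Omega>" and aff: "\<And>T x. T \<in> \<T> \<Longrightarrow> x \<in> T \<Longrightarrow> v x = a T \<bullet> x + b T"
  shows "AE x in lebesgue. x \<in> \<Omega> \<longrightarrow> (\<exists>T\<in>\<T>. x \<in> T \<and> g x = a T)"
proof -
  have fin: "finite \<T>" and cover: "\<Union>\<T> = closure \<Omega>" and simplex: "\<And>T. T \<in> \<T> \<Longrightarrow> int DIM('a) simplex T"
    using tri by (auto simp: triangulation_of_def triangulation_def)
  have "AE x in lebesgue. x \<notin> frontier T" if "T \<in> \<T>" for T
  proof -
    have "convex T" using simplex [OF that] by (auto simp: simplex_def)
    then have "negligible (frontier T)" by (rule negligible_convex_frontier)
    then show ?thesis by (simp add: negligible_iff_null_sets AE_not_in)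
  qed
  then have 1: "AE x in lebesgue. \<forall>T\<in>\<T>. x \<notin> frontier T" by (rule AE_finite_allI [OF fin])
  have "AE x in lebesgue. x \<in> interior T \<inter> \<Omega> \<longrightarrow> g x = a T" if T: "T \<in> \<T>" for T
    using \<Omega> by (intro weak_gradient_of_affine [OF \<Omega> p W, where b = "b T"])
      (auto intro!: aff [OF T] dest: subsetD [OF interior_subset])
  then have 2: "AE x in lebesgue. \<forall>T\<in>\<T>. x \<in> interior T \<inter> \<Omega> \<longrightarrow> g x = a T"
    by (rule AE_finite_allI [OF fin])
  show ?thesis
    using 1 2
  proof eventually_elim
    case (elim x)
    show ?case
    proof
      assume x: "x \<in> \<Omega>"
      then obtain T where T: "T \<in> \<T>" "x \<in> T" using cover closure_subset by blast
      then have "x \<in> interior T" using elim(1) closure_subset by (auto simp: frontier_def)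
      then show "\<exists>T\<in>\<T>. x \<in> T \<and> g x = a T" using elim(2) T x by blast
    qed
  qed
qed

lemma small_tolerances:
  fixes e m p :: real
  assumes "0 < e" "0 \<le> m" "0 < p"
  obtains s t where "0 < s" "0 < t" "2 powr p * (t powr p * m + s) < e"
proof
  \<comment> \<open>The two terms are at most \<open>s\<close> each, and 2^p times their sum is at
    most e / 2; the m + 1 below guards against m = 0.\<close>
  define s where "s = e / (4 * 2 powr p)"
  define t where "t = (s / (m + 1)) powr (1/p)"
  show s: "0 < s" using assms by (simp add: s_def)
  then show "0 < t" using assms by (simp add: t_def)
  have "t powr p = s / (m + 1)" using s assms by (simp add: t_def powr_powr)
  then have "t powr p * m \<le> s" using s assms by (simp add: divide_le_eq algebra_simps)
  then have "2 powr p * (t powr p * m + s) \<le> 2 powr p * (2 * s)" by (intro mult_left_mono) auto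
  also have "\<dots> = e / 2" by (simp add: s_def)
  finally show "2 powr p * (t powr p * m + s) < e" using assms by simp
qed

text \<open>Closeness in L^p suffices here, because at a fixed horizon it controls the nonlocal
  seminorm.\<close>

lemma P1_dense_nonlocal:
  fixes \<Omega> :: "'a::euclidean_space set"
  assumes \<Omega>: "open \<Omega>" "bounded \<Omega>" and p: "0 < p" and fam: "qu_sr_family \<F> \<Omega>"
    and u: "u \<in> borel_measurable lebesgue" "Lp_int p \<Omega> u < \<infinity>" and e: "0 < e"
  obtains \<eta> where "0 < \<eta>" "\<And>\<T>. \<T> \<in> \<F> \<Longrightarrow> mesh_size \<T> < \<eta> \<Longrightarrow>
    \<exists>v\<in>P1_space \<Omega> \<T>. Lp_int p \<Omega> (\<lambda>x. v x - u x) < ennreal e"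
proof -
  have A: "\<Omega> \<in> sets lebesgue" using \<Omega> by auto
  obtain m where m: "emeasure lebesgue \<Omega> = ennreal m" "0 \<le> m"
    using bounded_imp_finite_lebesgue [OF \<Omega>(2) A] by blast
  obtain s t where st: "0 < s" "0 < t" "2 powr p * (t powr p * m + s) < e"
    using small_tolerances [OF e m(2) p] by blast
  have "0 < ennreal s" using st by simp
  then obtain \<phi> K where \<phi>: "continuous_on UNIV \<phi>" "compact K" "K \<subseteq> \<Omega>" "\<And>x. x \<notin> K \<Longrightarrow> \<phi> x = 0"
    and s: "Lp_int p \<Omega> (\<lambda>x. \<phi> x - u x) < ennreal s"
    using Lp_approx_continuous_compact_support [OF \<Omega> p u] by metis
  obtain \<eta> where \<eta>: "0 < \<eta>" "\<And>\<T>. \<T> \<in> \<F> \<Longrightarrow> mesh_size \<T> < \<eta> \<Longrightarrow>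
    \<exists>v\<in>P1_space \<Omega> \<T>. (\<forall>x. \<bar>v x - \<phi> x\<bar> \<le> t) \<and> (\<forall>T\<in>\<T>. interpolates_on_simplex \<phi> v T)"
    using P1_approximation_continuous [OF fam \<Omega> \<phi> st(2)] by metis
  show thesis
  proof (rule that [OF \<eta>(1)])
    fix \<T> assume "\<T> \<in> \<F>" "mesh_size \<T> < \<eta>"
    then obtain v where v: "v \<in> P1_space \<Omega> \<T>" "\<And>x. \<bar>v x - \<phi> x\<bar> \<le> t" using \<eta>(2) by blast
    have [measurable]: "v \<in> borel_measurable lebesgue" "\<phi> \<in> borel_measurable lebesgue" "u \<in> borel_measurable lebesgue"
      using v(1) \<phi>(1) u by (auto simp: P1_space_def intro: continuous_imp_lebesgue_measurable)
    have "Lp_int p \<Omega> (\<lambda>x. v x - u x) = Lp_int p \<Omega> (\<lambda>x. (v x - \<phi> x) + (\<phi> x - u x))" by simp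
    also have "\<dots> \<le> ennreal (2 powr p) * (Lp_int p \<Omega> (\<lambda>x. v x - \<phi> x) + Lp_int p \<Omega> (\<lambda>x. \<phi> x - u x))"
      using A p by (intro Lp_int_triangle_real) auto
    also have "\<dots> \<le> ennreal (2 powr p) * (ennreal (t powr p * m) + ennreal s)"
      using s v(2) p by (intro mult_left_mono add_mono Lp_int_le_const [OF A m]) auto
    also have "\<dots> = ennreal (2 powr p * (t powr p * m + s))"
      using m st by (simp add: ennreal_mult ennreal_plus)
    also have "\<dots> < ennreal e" using st e by (intro ennreal_lessI) auto
    finally show "\<exists>v\<in>P1_space \<Omega> \<T>. Lp_int p \<Omega> (\<lambda>x. v x - u x) < ennreal e" using v(1) by blast
  qed
qed

text \<open>The hypothesis on \<open>P1_space\<close> supplies a weak gradient of the interpolant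
  but not its value. \<open>weak_gradient_of_piecewise_affine\<close> identifies it with the slopes
  on the simplices, which shape regularity keeps close to the gradient of a smooth
  approximant.\<close>

lemma P1_dense_local:
  fixes \<Omega> :: "'a::euclidean_space set"
  assumes \<Omega>: "open \<Omega>" "bounded \<Omega>" and p: "1 \<le> p" and fam: "qu_sr_family \<F> \<Omega>"
    and P1: "\<And>\<T> v. \<T> \<in> \<F> \<Longrightarrow> v \<in> P1_space \<Omega> \<T> \<Longrightarrow> \<exists>g. W1p0 p \<Omega> v g"
    and W: "W1p0 p \<Omega> u g" and e: "0 < e"
  obtains \<eta> where "0 < \<eta>" "\<And>\<T>. \<T> \<in> \<F> \<Longrightarrow> mesh_size \<T> < \<eta> \<Longrightarrow>
    \<exists>v\<in>P1_space \<Omega> \<T>. Lp_int p \<Omega> (\<lambda>x. v x - u x) < ennreal e \<and>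
      Lp_int p \<Omega> (\<lambda>x. norm (wgrad p \<Omega> (\<lambda>x. v x - u x) x)) < ennreal e"
proof -
  have A: "\<Omega> \<in> sets lebesgue" using \<Omega> by auto
  have p0: "0 < p" "0 \<le> p" using p by auto
  obtain m where m: "emeasure lebesgue \<Omega> = ennreal m" "0 \<le> m"
    using bounded_imp_finite_lebesgue [OF \<Omega>(2) A] by blast
  obtain s t where st: "0 < s" "0 < t" "2 powr p * (t powr p * m + s) < e"
    using small_tolerances [OF e m(2) p0(1)] by blast
  obtain \<phi>s where \<phi>s: "\<And>n. \<phi>s n \<in> Cc_inf \<Omega>" "(\<lambda>n. Lp_int p \<Omega> (\<lambda>x. \<phi>s n x - u x)) \<longlonglongrightarrow> 0"
     "(\<lambda>n. Lp_int p \<Omega> (\<lambda>x. norm (grad (\<phi>s n) x - g x))) \<longlonglongrightarrow> 0"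
    using W unfolding W1p0_def by blast
  have s0: "0 < ennreal s" using st by simp
  have "eventually (\<lambda>n. Lp_int p \<Omega> (\<lambda>x. \<phi>s n x - u x) < ennreal s \<and> Lp_int p \<Omega> (\<lambda>x. norm (grad (\<phi>s n) x - g x)) < ennreal s) sequentially"
    using order_tendstoD(2) [OF \<phi>s(2) s0] order_tendstoD(2) [OF \<phi>s(3) s0] by (rule eventually_conj)
  then obtain n where n: "Lp_int p \<Omega> (\<lambda>x. \<phi>s n x - u x) < ennreal s" "Lp_int p \<Omega> (\<lambda>x. norm (grad (\<phi>s n) x - g x)) < ennreal s"
    by (auto simp: eventually_sequentially)
  define \<phi> where "\<phi> = \<phi>s n"
  have \<phi>: "\<phi> \<in> Cc_inf \<Omega>" and s: "Lp_int p \<Omega> (\<lambda>x. \<phi> x - u x) < ennreal s" "Lp_int p \<Omega> (\<lambda>x. norm (grad \<phi> x - g x)) < ennreal s"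
    using n \<phi>s(1) by (auto simp: \<phi>_def)
  obtain K where K: "compact K" "K \<subseteq> \<Omega>" "\<And>x. x \<notin> K \<Longrightarrow> \<phi> x = 0"
    using \<phi> by (auto simp: Cc_inf_def)
  obtain \<eta> where \<eta>: "0 < \<eta>" "\<And>\<T>. \<T> \<in> \<F> \<Longrightarrow> mesh_size \<T> < \<eta> \<Longrightarrow>
    \<exists>v\<in>P1_space \<Omega> \<T>. (\<forall>x. \<bar>v x - \<phi> x\<bar> \<le> t) \<and>
      (\<forall>T\<in>\<T>. \<exists>a b. (\<forall>x\<in>T. v x = a \<bullet> x + b) \<and> (\<forall>x\<in>T. norm (a - grad \<phi> x) \<le> t))"
    using P1_approximation_C1 [OF fam \<Omega> K st(2) Cc_inf_has_derivative [OF \<phi>] Cc_inf_continuous_grad [OF \<phi>]] by metis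
  show thesis
  proof (rule that [OF \<eta>(1)])
    fix \<T> assume F: "\<T> \<in> \<F>" and mesh: "mesh_size \<T> < \<eta>"
    have tri: "triangulation_of \<T> \<Omega>" using fam F by (auto simp: qu_sr_family_def)
    obtain v where v: "v \<in> P1_space \<Omega> \<T>" "\<And>x. \<bar>v x - \<phi> x\<bar> \<le> t"
      and ab: "\<forall>T\<in>\<T>. \<exists>a b. (\<forall>x\<in>T. v x = a \<bullet> x + b) \<and> (\<forall>x\<in>T. norm (a - grad \<phi> x) \<le> t)"
      using \<eta>(2) [OF F mesh] by blast
    from ab obtain a b where a: "\<And>T x. T \<in> \<T> \<Longrightarrow> x \<in> T \<Longrightarrow> v x = a T \<bullet> x + b T"
      "\<And>T x. T \<in> \<T> \<Longrightarrow> x \<in> T \<Longrightarrow> norm (a T - grad \<phi> x) \<le> t"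
      by metis
    obtain k where k: "W1p0 p \<Omega> v k" using P1 [OF F v(1)] by blast
    have [measurable]: "v \<in> borel_measurable lebesgue" "\<phi> \<in> borel_measurable lebesgue" "u \<in> borel_measurable lebesgue"
      "grad \<phi> \<in> borel_measurable lebesgue" "g \<in> borel_measurable lebesgue" "k \<in> borel_measurable lebesgue"
      using k W Cc_inf_continuous [OF \<phi>] Cc_inf_continuous_grad [OF \<phi>]
      by (auto simp: W1p0_def in_Lp_def intro: continuous_imp_lebesgue_measurable)
    have final: "ennreal (2 powr p) * (ennreal (t powr p * m) + ennreal s) < ennreal e"
    proof -
      have "ennreal (2 powr p) * (ennreal (t powr p * m) + ennreal s) = ennreal (2 powr p * (t powr p * m + s))"
        using m st by (simp add: ennreal_mult ennreal_plus)
      also have "\<dots> < ennreal e" using st e by (intro ennreal_lessI) auto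
      finally show ?thesis .
    qed
    have "Lp_int p \<Omega> (\<lambda>x. v x - u x) = Lp_int p \<Omega> (\<lambda>x. (v x - \<phi> x) + (\<phi> x - u x))" by simp
    also have "\<dots> \<le> ennreal (2 powr p) * (Lp_int p \<Omega> (\<lambda>x. v x - \<phi> x) + Lp_int p \<Omega> (\<lambda>x. \<phi> x - u x))"
      using A p by (intro Lp_int_triangle_real) auto
    also have "\<dots> \<le> ennreal (2 powr p) * (ennreal (t powr p * m) + ennreal s)"
      using s v(2) p by (intro mult_left_mono add_mono Lp_int_le_const [OF A m]) auto
    also note final
    finally have 1: "Lp_int p \<Omega> (\<lambda>x. v x - u x) < ennreal e" .
    have "W1p0 p \<Omega> (\<lambda>x. 1 * v x + (-1) * u x) (\<lambda>x. 1 *\<^sub>R k x + (-1) *\<^sub>R g x)"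
      by (rule W1p0_lincomb [OF \<Omega>(1) p0(2) k W])
    then have "W1p0 p \<Omega> (\<lambda>x. v x - u x) (\<lambda>x. k x - g x)" by simp
    from wgrad_AE_eq [OF \<Omega> p this]
    have "AE x in lebesgue. x \<in> \<Omega> \<longrightarrow> norm (wgrad p \<Omega> (\<lambda>x. v x - u x) x) = norm (k x - g x)"
      by eventually_elim auto
    then have "Lp_int p \<Omega> (\<lambda>x. norm (wgrad p \<Omega> (\<lambda>x. v x - u x) x)) = Lp_int p \<Omega> (\<lambda>x. norm (k x - g x))"
      by (rule Lp_int_cong_AE)
    also have "\<dots> = Lp_int p \<Omega> (\<lambda>x. norm ((k x - grad \<phi> x) + (grad \<phi> x - g x)))" by simp
    also have "\<dots> \<le> ennreal (2 powr p) * (Lp_int p \<Omega> (\<lambda>x. norm (k x - grad \<phi> x)) + Lp_int p \<Omega> (\<lambda>x. norm (grad \<phi> x - g x)))"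
      using A p by (intro Lp_int_triangle) auto
    also have "\<dots> \<le> ennreal (2 powr p) * (ennreal (t powr p * m) + ennreal s)"
    proof (intro mult_left_mono add_mono Lp_int_le_const [OF A m p0(2)])
      have "AE x in lebesgue. x \<in> \<Omega> \<longrightarrow> (\<exists>T\<in>\<T>. x \<in> T \<and> k x = a T)"
        by (rule weak_gradient_of_piecewise_affine [where b = b, OF \<Omega> p k tri a(1)])
      then show "AE x in lebesgue. x \<in> \<Omega> \<longrightarrow> \<bar>norm (k x - grad \<phi> x)\<bar> \<le> t"
        by eventually_elim (use a(2) in auto)
    qed (use s in auto)
    also note final
    finally have "Lp_int p \<Omega> (\<lambda>x. norm (wgrad p \<Omega> (\<lambda>x. v x - u x) x)) < ennreal e" .
    then show "\<exists>v\<in>P1_space \<Omega> \<T>. Lp_int p \<Omega> (\<lambda>x. v x - u x) < ennreal e \<and>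
      Lp_int p \<Omega> (\<lambda>x. norm (wgrad p \<Omega> (\<lambda>x. v x - u x) x)) < ennreal e"
      using 1 v(1) by blast
  qed
qed

section \<open>Convergence of the discrete minimizers\<close>

text \<open>The infimum need not be attained. Raising the estimate to the power p / 2 isolates
  \<open>N v\<close>, so the left side becomes a lower bound for all \<open>v\<close>, hence for the
  infimum.\<close>

lemma quasi_optimality_imp_convergence:
  fixes N :: "'f \<Rightarrow> real" and mesh :: "'t \<Rightarrow> real"
  assumes p: "0 < p" and C: "0 < C" and N: "\<And>v. 0 \<le> N v"
    and est: "\<And>\<T> v. \<T> \<in> \<F> \<Longrightarrow> v \<in> W \<T> \<Longrightarrow> N (uh \<T>) \<le> C * N v powr (2 / p)"
    and uhW: "\<And>\<T>. \<T> \<in> \<F> \<Longrightarrow> uh \<T> \<in> W \<T>"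
    and dens: "\<And>\<epsilon>. 0 < \<epsilon> \<Longrightarrow> \<exists>\<eta>>0. \<forall>\<T>\<in>\<F>. mesh \<T> < \<eta> \<longrightarrow> (\<exists>v\<in>W \<T>. N v < \<epsilon>)"
  shows "(\<exists>C>0. \<forall>\<T>\<in>\<F>. N (uh \<T>) \<le> C * (INF v\<in>W \<T>. N v) powr (2 / p)) \<and>
    (\<forall>\<epsilon>>0. \<exists>\<eta>>0. \<forall>\<T>\<in>\<F>. mesh \<T> < \<eta> \<longrightarrow> N (uh \<T>) < \<epsilon>)"
proof
  have "N (uh \<T>) \<le> C * (INF v\<in>W \<T>. N v) powr (2 / p)" if F: "\<T> \<in> \<F>" for \<T>
  proof -
    have "(N (uh \<T>) / C) powr (p / 2) \<le> (INF v\<in>W \<T>. N v)"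
    proof (rule cINF_greatest)
      show "W \<T> \<noteq> {}" using uhW [OF F] by blast
      fix v assume v: "v \<in> W \<T>"
      have "N (uh \<T>) / C \<le> N v powr (2 / p)"
        using est [OF F v] C by (simp add: divide_le_eq mult.commute)
      then have "(N (uh \<T>) / C) powr (p / 2) \<le> (N v powr (2 / p)) powr (p / 2)"
        using N C p by (intro powr_mono2) auto
      then show "(N (uh \<T>) / C) powr (p / 2) \<le> N v"
        using p N by (simp add: powr_powr)
    qed
    then have "((N (uh \<T>) / C) powr (p / 2)) powr (2 / p) \<le> (INF v\<in>W \<T>. N v) powr (2 / p)"
      using p by (intro powr_mono2) auto
    then have "N (uh \<T>) / C \<le> (INF v\<in>W \<T>. N v) powr (2 / p)"
      using p N C by (simp add: powr_powr)
    then show ?thesis using C by (simp add: divide_le_eq mult.commute)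
  qed
  then show "\<exists>C>0. \<forall>\<T>\<in>\<F>. N (uh \<T>) \<le> C * (INF v\<in>W \<T>. N v) powr (2 / p)"
    using C by blast
  show "\<forall>\<epsilon>>0. \<exists>\<eta>>0. \<forall>\<T>\<in>\<F>. mesh \<T> < \<eta> \<longrightarrow> N (uh \<T>) < \<epsilon>"
  proof (intro allI impI)
    fix \<epsilon> :: real assume \<epsilon>: "0 < \<epsilon>"
    \<comment> \<open>This tolerance is the preimage of epsilon under t -> C t^(2/p).\<close>
    have "0 < (\<epsilon> / C) powr (p / 2)" using \<epsilon> C by simp
    from dens [OF this] obtain \<eta> where \<eta>: "0 < \<eta>"
      "\<And>\<T>. \<T> \<in> \<F> \<Longrightarrow> mesh \<T> < \<eta> \<Longrightarrow> \<exists>v\<in>W \<T>. N v < (\<epsilon> / C) powr (p / 2)"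
      by blast
    have "N (uh \<T>) < \<epsilon>" if T: "\<T> \<in> \<F>" "mesh \<T> < \<eta>" for \<T>
    proof -
      obtain v where v: "v \<in> W \<T>" "N v < (\<epsilon> / C) powr (p / 2)" using \<eta>(2) [OF T] by blast
      have "N v powr (2 / p) < ((\<epsilon> / C) powr (p / 2)) powr (2 / p)"
        using v(2) N p by (intro powr_less_mono2) auto
      also have "\<dots> = \<epsilon> / C" using \<epsilon> C p by (simp add: powr_powr)
      finally have "C * N v powr (2 / p) < \<epsilon>" using C by (simp add: less_divide_eq mult.commute)
      then show ?thesis using est [OF T(1) v(1)] by simp
    qed
    then show "\<exists>\<eta>>0. \<forall>\<T>\<in>\<F>. mesh \<T> < \<eta> \<longrightarrow> N (uh \<T>) < \<epsilon>" using \<eta>(1) by blast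
  qed
qed

lemma enn2real_less:
  assumes "x < ennreal e" shows "enn2real x < e"
proof (cases x)
  case (real r)
  then show ?thesis using assms by (simp add: ennreal_less_iff)
qed (use assms in simp)

lemma powr_inverse_less:
  fixes x e p :: real
  assumes "0 \<le> x" "x < e powr p" "0 < e" "0 < p"
  shows "x powr (1 / p) < e"
proof -
  have "x powr (1 / p) < (e powr p) powr (1 / p)" using assms by (intro powr_less_mono2) auto
  then show ?thesis using assms by (simp add: powr_powr)
qed

theorem theorem4p8:
  fixes p \<delta>\<^sub>0 :: real and \<rho> :: "real \<Rightarrow> real" and \<Omega> :: "'a::euclidean_space set"
    and \<sigma> :: ereal and f :: "'a \<Rightarrow> real" and N :: nat and \<F> :: "'a set set set"
    and u :: "'a \<Rightarrow> real" and uh :: "'a set set \<Rightarrow> 'a \<Rightarrow> real"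
  assumes p: "2 \<le> p"
    and dom: "piecewise_flat_domain \<Omega>"
    and ker: "admissible_kernel TYPE('a) p \<rho>"
    and \<delta>\<^sub>0: "poincare_threshold p \<rho> \<Omega> \<delta>\<^sub>0"
    and \<sigma>: "0 < \<sigma>"
    and f: "in_Lp (p / (p - 1)) (if \<sigma> = \<infinity> then \<Omega> else ext_dom \<Omega> (hor \<delta>\<^sub>0 \<sigma>)) f"
    and fam: "qu_sr_family \<F> \<Omega>"
    and P1: "\<forall>\<T>\<in>\<F>. P1_space \<Omega> \<T> \<subseteq> Wsh p \<rho> \<Omega> \<delta>\<^sub>0 \<sigma> N \<T>"
    and u: "is_minimizer (energy p \<rho> \<Omega> \<sigma> f) (Tspace p \<rho> \<Omega> \<delta>\<^sub>0 \<sigma>) u"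
    and uh: "\<forall>\<T>\<in>\<F>. is_minimizer (energy p \<rho> \<Omega> \<sigma> f) (Wsh p \<rho> \<Omega> \<delta>\<^sub>0 \<sigma> N \<T>) (uh \<T>)"
  shows "(\<exists>C>0. \<forall>\<T>\<in>\<F>.
            Tnorm p \<rho> \<Omega> \<delta>\<^sub>0 \<sigma> (\<lambda>x. uh \<T> x - u x)
              \<le> C * (INF v\<in>Wsh p \<rho> \<Omega> \<delta>\<^sub>0 \<sigma> N \<T>. Tnorm p \<rho> \<Omega> \<delta>\<^sub>0 \<sigma> (\<lambda>x. v x - u x)) powr (2 / p))
       \<and> (\<forall>\<epsilon>>0. \<exists>\<eta>>0. \<forall>\<T>\<in>\<F>. mesh_size \<T> < \<eta> \<longrightarrow>
            Tnorm p \<rho> \<Omega> \<delta>\<^sub>0 \<sigma> (\<lambda>x. uh \<T> x - u x) < \<epsilon>)"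
proof -
  have \<Omega>: "open \<Omega>" "bounded \<Omega>" using dom by (auto simp: piecewise_flat_domain_def)
  have p0: "0 < p" "0 \<le> p" "1 \<le> p" using p by auto
  let ?E = "energy p \<rho> \<Omega> \<sigma> f" and ?T = "Tspace p \<rho> \<Omega> \<delta>\<^sub>0 \<sigma>" and ?W = "Wsh p \<rho> \<Omega> \<delta>\<^sub>0 \<sigma> N"
  let ?N = "\<lambda>v. Tnorm p \<rho> \<Omega> \<delta>\<^sub>0 \<sigma> (\<lambda>x. v x - u x)"
  have WT: "?W \<T> \<subseteq> ?T" for \<T> by (simp add: Wsh_def)
  \<comment> \<open>The inclusion of the piecewise linear space puts 0 into every discrete space,
    where it is the competitor behind the a priori bound.\<close>
  have zero: "(\<lambda>_. 0) \<in> ?W \<T>" if "\<T> \<in> \<F>" for \<T>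
  proof -
    have "(\<lambda>_. 0) \<in> P1_space \<Omega> \<T>" by (auto simp: P1_space_def intro!: exI [of _ 0])
    then show ?thesis using P1 that by blast
  qed
  have uT: "u \<in> ?T" using u by (simp add: is_minimizer_def)
  have "\<exists>C>0. (\<forall>\<T>\<in>\<F>. \<forall>v\<in>?W \<T>. ?N (uh \<T>) \<le> C * ?N v powr (2 / p)) \<and>
      (\<forall>\<epsilon>>0. \<exists>\<eta>>0. \<forall>\<T>\<in>\<F>. mesh_size \<T> < \<eta> \<longrightarrow> (\<exists>v\<in>?W \<T>. ?N v < \<epsilon>))"
  proof (cases "\<sigma> = \<infinity>")
    case True
    have T: "?T = {u. \<exists>g. W1p0 p \<Omega> u g}" by (simp add: Tspace_def True)
    have f': "f \<in> borel_measurable lebesgue" "Lp_int (p / (p - 1)) \<Omega> f < \<infinity>"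
      using f True by (auto simp: in_Lp_def)
    have N: "Tnorm p \<rho> \<Omega> \<delta>\<^sub>0 \<sigma> w = (enn2real (Lp_int p \<Omega> w) + enn2real (Lp_int p \<Omega> (\<lambda>x. norm (wgrad p \<Omega> w x)))) powr (1/p)" for w
      by (simp add: Tnorm_def True)
    have E: "?E v = (1/p) * enn2real (Lp_int p \<Omega> (\<lambda>x. norm (wgrad p \<Omega> v x))) - (LINT x:\<Omega>|lebesgue. f x * v x)" for v
      by (simp add: energy_def True)
    obtain C where C: "0 < C"
      "\<And>V uh v. V \<subseteq> ?T \<Longrightarrow> (\<lambda>_. 0) \<in> V \<Longrightarrow> is_minimizer ?E V uh \<Longrightarrow> v \<in> V \<Longrightarrow> ?N uh \<le> C * ?N v powr (2 / p)"
      by (rule cea_local [where E = ?E, OF p \<Omega> f' E u [unfolded T], folded T N]) (rule that; blast)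
    obtain g where g: "W1p0 p \<Omega> u g" using uT T by blast
    have dens: "\<exists>\<eta>>0. \<forall>\<T>\<in>\<F>. mesh_size \<T> < \<eta> \<longrightarrow> (\<exists>v\<in>?W \<T>. ?N v < \<epsilon>)" if \<epsilon>: "0 < \<epsilon>" for \<epsilon>
    proof -
      \<comment> \<open>Each of the two parts of the norm receives half of epsilon^p.\<close>
      define e where "e = \<epsilon> powr p / 2"
      have e: "0 < e" using \<epsilon> by (simp add: e_def)
      have P1T: "\<exists>g. W1p0 p \<Omega> v g" if "\<T> \<in> \<F>" "v \<in> P1_space \<Omega> \<T>" for \<T> v
        using P1 WT T that by blast
      obtain \<eta> where \<eta>: "0 < \<eta>" "\<And>\<T>. \<T> \<in> \<F> \<Longrightarrow> mesh_size \<T> < \<eta> \<Longrightarrow>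
        \<exists>v\<in>P1_space \<Omega> \<T>. Lp_int p \<Omega> (\<lambda>x. v x - u x) < ennreal e \<and>
          Lp_int p \<Omega> (\<lambda>x. norm (wgrad p \<Omega> (\<lambda>x. v x - u x) x)) < ennreal e"
        by (rule P1_dense_local [OF \<Omega> p0(3) fam P1T g e]) (assumption | (rule that; blast))+
      have "\<exists>v\<in>?W \<T>. ?N v < \<epsilon>" if F: "\<T> \<in> \<F>" "mesh_size \<T> < \<eta>" for \<T>
      proof -
        obtain v where v: "v \<in> P1_space \<Omega> \<T>" "Lp_int p \<Omega> (\<lambda>x. v x - u x) < ennreal e"
          "Lp_int p \<Omega> (\<lambda>x. norm (wgrad p \<Omega> (\<lambda>x. v x - u x) x)) < ennreal e"
          using \<eta>(2) [OF F] by blast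
        have "enn2real (Lp_int p \<Omega> (\<lambda>x. v x - u x)) < e"
          "enn2real (Lp_int p \<Omega> (\<lambda>x. norm (wgrad p \<Omega> (\<lambda>x. v x - u x) x))) < e"
          using v(2,3) by (auto intro: enn2real_less)
        then have "?N v < \<epsilon>"
          unfolding N using \<epsilon> p0 by (intro powr_inverse_less) (auto simp: e_def)
        then show ?thesis using v(1) P1 F(1) by blast
      qed
      then show ?thesis using \<eta>(1) by blast
    qed
    show ?thesis using C WT zero uh dens by blast
  next
    case False
    \<comment> \<open>The space and the norm use \<open>\<delta>\<close>, the energy uses
      \<open>\<delta>'\<close>; they differ when 1/sigma exceeds
      \<open>\<delta>\<^sub>0\<close>.\<close>
    define \<delta> \<delta>' where "\<delta> = hor \<delta>\<^sub>0 \<sigma>" and "\<delta>' = 1 / real_of_ereal \<sigma>"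
    have "0 < real_of_ereal \<sigma>" using \<sigma> False by (cases \<sigma>) auto
    moreover have "0 < \<delta>\<^sub>0" using \<delta>\<^sub>0 by (simp add: poincare_threshold_def)
    ultimately have \<delta>: "0 < \<delta>" "\<delta> \<le> \<delta>\<^sub>0" "\<delta> \<le> \<delta>'" by (auto simp: \<delta>_def \<delta>'_def hor_def)
    have T: "?T = S0 p \<rho> \<Omega> \<delta>" by (simp add: Tspace_def False \<delta>_def)
    have "Lp_int (p / (p - 1)) \<Omega> f \<le> Lp_int (p / (p - 1)) (ext_dom \<Omega> \<delta>) f"
      unfolding Lp_int_def by (intro nn_integral_mono) (auto simp: ext_dom_def split: split_indicator)
    then have f': "f \<in> borel_measurable lebesgue" "Lp_int (p / (p - 1)) \<Omega> f < \<infinity>"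
      using f False by (auto simp: in_Lp_def \<delta>_def)
    have N: "Tnorm p \<rho> \<Omega> \<delta>\<^sub>0 \<sigma> w = (enn2real (Lp_int p \<Omega> w) + enn2real (nl_semi_p p \<rho> \<Omega> \<delta> w)) powr (1/p)" for w
      by (simp add: Tnorm_def False \<delta>_def)
    have E: "?E v = (1/p) * enn2real (nl_semi_p p \<rho> \<Omega> \<delta>' v) - (LINT x:\<Omega>|lebesgue. f x * v x)" for v
      by (simp add: energy_def False \<delta>'_def)
    obtain C where C: "0 < C"
      "\<And>V uh v. V \<subseteq> ?T \<Longrightarrow> (\<lambda>_. 0) \<in> V \<Longrightarrow> is_minimizer ?E V uh \<Longrightarrow> v \<in> V \<Longrightarrow> ?N uh \<le> C * ?N v powr (2 / p)"
      by (rule cea_nonlocal [where E = ?E, OF p dom ker \<delta>\<^sub>0 \<delta> f' E u [unfolded T], folded T N]) (rule that; blast)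
    \<comment> \<open>With both horizons equal to \<open>\<delta>\<close>, the upper bound concerns
      the seminorm that is part of the norm.\<close>
    obtain B where B: "0 < B"
      "\<And>v. v \<in> S0 p \<rho> \<Omega> \<delta> \<Longrightarrow> enn2real (nl_semi_p p \<rho> \<Omega> \<delta> v) \<le> B * enn2real (Lp_int p \<Omega> v)"
      by (rule nonlocal_norm_equivalences [OF p dom ker \<delta>\<^sub>0 \<delta>(1,2) order_refl]) (rule that [rotated], assumption+)
    have uS: "u \<in> S0 p \<rho> \<Omega> \<delta>" using uT T by simp
    have um: "u \<in> borel_measurable lebesgue" "Lp_int p \<Omega> u < \<infinity>"
      using uS S0_iff [OF dom ker p0(2) \<delta>(1)] by auto
    have dens: "\<exists>\<eta>>0. \<forall>\<T>\<in>\<F>. mesh_size \<T> < \<eta> \<longrightarrow> (\<exists>v\<in>?W \<T>. ?N v < \<epsilon>)" if \<epsilon>: "0 < \<epsilon>" for \<epsilon>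
    proof -
      \<comment> \<open>The factor 1 + B turns the L^p integral of the difference into a bound for
        the p-th power of its norm.\<close>
      define e where "e = \<epsilon> powr p / (1 + B)"
      have e: "0 < e" using \<epsilon> B by (simp add: e_def)
      obtain \<eta> where \<eta>: "0 < \<eta>" "\<And>\<T>. \<T> \<in> \<F> \<Longrightarrow> mesh_size \<T> < \<eta> \<Longrightarrow>
        \<exists>v\<in>P1_space \<Omega> \<T>. Lp_int p \<Omega> (\<lambda>x. v x - u x) < ennreal e"
        by (rule P1_dense_nonlocal [OF \<Omega> p0(1) fam um e]) (rule that; blast)
      have "\<exists>v\<in>?W \<T>. ?N v < \<epsilon>" if F: "\<T> \<in> \<F>" "mesh_size \<T> < \<eta>" for \<T>
      proof -
        obtain v where v: "v \<in> P1_space \<Omega> \<T>" "Lp_int p \<Omega> (\<lambda>x. v x - u x) < ennreal e"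
          using \<eta>(2) [OF F] by blast
        have vW: "v \<in> ?W \<T>" using P1 F(1) v(1) by blast
        then have "v \<in> S0 p \<rho> \<Omega> \<delta>" using WT T by blast
        from S0_lincomb [OF dom ker p0(2) \<delta>(1) this uS, of 1 "-1"]
        have "(\<lambda>x. v x - u x) \<in> S0 p \<rho> \<Omega> \<delta>" by simp
        from B(2) [OF this]
        have "enn2real (Lp_int p \<Omega> (\<lambda>x. v x - u x)) + enn2real (nl_semi_p p \<rho> \<Omega> \<delta> (\<lambda>x. v x - u x))
            \<le> (1 + B) * enn2real (Lp_int p \<Omega> (\<lambda>x. v x - u x))" by (simp add: algebra_simps)
        also have "\<dots> < (1 + B) * e"
          using v(2) B by (intro mult_strict_left_mono enn2real_less) auto
        also have "\<dots> = \<epsilon> powr p" using B by (simp add: e_def)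
        finally have "?N v < \<epsilon>"
          unfolding N using \<epsilon> p0 by (intro powr_inverse_less) auto
        then show ?thesis using vW by blast
      qed
      then show ?thesis using \<eta>(1) by blast
    qed
    show ?thesis using C WT zero uh dens by blast
  qed
  then obtain C where C: "0 < C" "\<And>\<T> v. \<T> \<in> \<F> \<Longrightarrow> v \<in> ?W \<T> \<Longrightarrow> ?N (uh \<T>) \<le> C * ?N v powr (2 / p)"
    and dens: "\<And>\<epsilon>. 0 < \<epsilon> \<Longrightarrow> \<exists>\<eta>>0. \<forall>\<T>\<in>\<F>. mesh_size \<T> < \<eta> \<longrightarrow> (\<exists>v\<in>?W \<T>. ?N v < \<epsilon>)"
    by blast
  have N0: "0 \<le> ?N v" for v by (simp add: Tnorm_def)
  have uhW: "uh \<T> \<in> ?W \<T>" if "\<T> \<in> \<F>" for \<T> using uh that by (auto simp: is_minimizer_def)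
  show ?thesis
    by (rule quasi_optimality_imp_convergence [where N = ?N and W = ?W and uh = uh and mesh = mesh_size,
          OF p0(1) C(1) N0 C(2) uhW dens])
qed

end
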